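(* Let $\{\xi_i(x)\}_{i\ge 1}$, $x\in X$, be a sequence of centered random fields on $X$ which are martingale differences in the index $i$ with respect to a filtration $\{F(i)\}_{i\ge 0}$ with $F(0)$ trivial. Let $B\in(2,\infty]$ be such that the natural function $\psi(p)=\sup_i\sup_{x\in X}\left[\mathbf{E}|\xi_i(x)|^p\right]^{1/p}$ is finite for all $p\in[1,B)$. Let $\overline{d}$ be the semi-distance on $X$ generated by $\psi$ and $\{\xi_i\}$ as defined in the context, with $(X,\overline d)$ compact, let $\psi_R(p)=\frac{p}{\log p}\,\psi(p)$, and let $\psi_{R,*}$ be defined from $\psi_R$ as in the context. Suppose that $$\sigma^2:=\inf_{x\in X}\sup_n\left[n^{-1}\sum_{k=1}^n \mathrm{Var}(\xi_k(x))\right]<\infty$$ and $$\int_0^{D(\overline{d})}\exp\left(\psi_{R,*}\left(\ln 2+H(X,\overline{d},\epsilon)\right)\right)\,d\epsilon<\infty,$$ where $D(\overline d)=\sup_{x_1,x_2\in X}\overline d(x_1,x_2)$. Then the family of distributions of the random fields $$\eta_n(x)=n^{-1/2}\sum_{i=1}^n\xi_i(x),\qquad n=1,2,\ldots,$$ is weakly compact in the space $C(X,\overline{d})$.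
   Context: Setting: $(\Omega,F,\mathbf{P})$ is a probability space with expectation $\mathbf{E}$; $F(0)\subset F(1)\subset F(2)\subset\cdots$ are sub-sigma-algebras of $F$ with $F(0)=\{\emptyset,\Omega\}$. For every $x\in X$ and $i\ge1$, $\xi_i(x)$ is a real random variable with $\mathbf{E}[\xi_i(x)\mid F(k)]=0$ for $k<i$ and $\mathbf{E}[\xi_i(x)\mid F(i)]=\xi_i(x)$ almost surely. Sample-path continuity of the fields is not assumed: under the hypotheses the fields $\xi_i$ (hence $\eta_n$) are almost surely $\overline d$-continuous, in the usual sense that they are replaced by continuous modifications. Notation: $|f|_p=[\mathbf{E}|f|^p]^{1/p}$. The function $\psi$ is regarded as a positive function on the open interval $(2,B)$ with $\inf_{p\in(2,B)}\psi(p)>0$, and by convention $\psi(p)=\infty$ for $p\notin(2,B)$ (the same convention applies to $\psi_R$). The Grand Lebesgue norm is $\|f\|G\psi=\sup_{p\in(2,B)}\left[|f|_p/\psi(p)\right]$. Semi-distances: $d_i(x_1,x_2)=\|\xi_i(x_1)-\xi_i(x_2)\|G\psi$ and $$\overline d(x_1,x_2)=\sup_n\sqrt{n^{-1}\sum_{i=1}^n d_i^2(x_1,x_2)}.$$ Transform: for a function $\phi$ of this type, $\phi_*(x)=\inf_{y\in(0,1)}\left(xy+\log\phi(1/y)\right)$ (so, by the convention above, only $y$ with $1/y\in(2,B)$ matter); $\psi_{R,*}$ denotes $(\psi_R)_*$. Entropy: for a semi-distance $d$ on $X$, $N(X,d,\epsilon)$ is the minimal number of closed $d$-balls of radius $\epsilon$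 with centers in $X$ that cover $X$, and $H(X,d,\epsilon)=\log N(X,d,\epsilon)$. $C(X,\overline d)$ is the space of all $\overline d$-continuous numerical functions on $X$ with the supremum norm. A family of distributions is called weakly compact if it is relatively compact in the topology of weak convergence of probability measures on this space (Prokhorov's sense). *)

theory Defs
  imports "HOL-Probability.Probability"
begin

section \<open>Topology of a semi-distance and covering numbers\<close>

text \<open>The library's metric spaces require that points at distance zero coincide. A semi-distance
  does not, so the topology generated by its open balls is introduced directly.\<close>

definition semidist_topology :: "'x set \<Rightarrow> ('x \<Rightarrow> 'x \<Rightarrow> real) \<Rightarrow> 'x topology" where
  "semidist_topology X d =
     topology (\<lambda>U. U \<subseteq> X \<and> (\<forall>x\<in>U. \<exists>r>0. \<forall>y\<in>X. d x y < r \<longrightarrow> y \<in> U))"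

lemma openin_semidist_topology:
  "openin (semidist_topology X d) U \<longleftrightarrow> U \<subseteq> X \<and> (\<forall>x\<in>U. \<exists>r>0. \<forall>y\<in>X. d x y < r \<longrightarrow> y \<in> U)"
proof -
  have "istopology (\<lambda>U. U \<subseteq> X \<and> (\<forall>x\<in>U. \<exists>r>0. \<forall>y\<in>X. d x y < r \<longrightarrow> y \<in> U))"
    unfolding istopology_def
  proof (intro conjI allI impI)
    fix S T
    assume S: "S \<subseteq> X \<and> (\<forall>x\<in>S. \<exists>r>0. \<forall>y\<in>X. d x y < r \<longrightarrow> y \<in> S)"
      and T: "T \<subseteq> X \<and> (\<forall>x\<in>T. \<exists>r>0. \<forall>y\<in>X. d x y < r \<longrightarrow> y \<in> T)"
    show "S \<inter> T \<subseteq> X" using S by blast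
    show "\<forall>x\<in>S \<inter> T. \<exists>r>0. \<forall>y\<in>X. d x y < r \<longrightarrow> y \<in> S \<inter> T"
    proof
      fix x assume x: "x \<in> S \<inter> T"
      obtain r where "r > 0" "\<forall>y\<in>X. d x y < r \<longrightarrow> y \<in> S"
        using S x by auto
      moreover obtain s where "s > 0" "\<forall>y\<in>X. d x y < s \<longrightarrow> y \<in> T"
        using T x by auto
      ultimately show "\<exists>r>0. \<forall>y\<in>X. d x y < r \<longrightarrow> y \<in> S \<inter> T"
        by (intro exI[of _ "min r s"]) auto
    qed
  next
    fix K
    assume K: "\<forall>S\<in>K. S \<subseteq> X \<and> (\<forall>x\<in>S. \<exists>r>0. \<forall>y\<in>X. d x y < r \<longrightarrow> y \<in> S)"
    show "\<Union>K \<subseteq> X" using K by blast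
    show "\<forall>x\<in>\<Union>K. \<exists>r>0. \<forall>y\<in>X. d x y < r \<longrightarrow> y \<in> \<Union>K"
    proof
      fix x assume "x \<in> \<Union>K"
      then obtain S where S: "S \<in> K" "x \<in> S" by auto
      then obtain r where "r > 0" "\<forall>y\<in>X. d x y < r \<longrightarrow> y \<in> S" using K by fast
      then show "\<exists>r>0. \<forall>y\<in>X. d x y < r \<longrightarrow> y \<in> \<Union>K"
        using S by (intro exI[of _ r]) auto
    qed
  qed
  then show ?thesis
    by (simp add: semidist_topology_def topology_inverse')
qed

lemma topspace_semidist_topology [simp]: "topspace (semidist_topology X d) = X"
proof -
  have "openin (semidist_topology X d) X"
    by (auto simp: openin_semidist_topology intro: exI[of _ 1])
  then have "X \<subseteq> topspace (semidist_topology X d)"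
    by (rule openin_subset)
  moreover have "topspace (semidist_topology X d) \<subseteq> X"
    by (rule conjunct1[OF iffD1[OF openin_semidist_topology openin_topspace]])
  ultimately show ?thesis by simp
qed

text \<open>The covering number is finite for all \<open>\<epsilon> > 0\<close> when the space is compact, the only case
  in which it is used; otherwise the infimum may be that of the empty set of naturals.\<close>

definition covering_number :: "'x set \<Rightarrow> ('x \<Rightarrow> 'x \<Rightarrow> real) \<Rightarrow> real \<Rightarrow> nat" where
  "covering_number X d \<epsilon> =
     Inf {card A | A. finite A \<and> A \<subseteq> X \<and> X \<subseteq> (\<Union>c\<in>A. {x\<in>X. d c x \<le> \<epsilon>})}"

definition metric_entropy :: "'x set \<Rightarrow> ('x \<Rightarrow> 'x \<Rightarrow> real) \<Rightarrow> real \<Rightarrow> real" where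
  "metric_entropy X d \<epsilon> = ln (real (covering_number X d \<epsilon>))"

definition semidist_diameter :: "'x set \<Rightarrow> ('x \<Rightarrow> 'x \<Rightarrow> real) \<Rightarrow> real" where
  "semidist_diameter X d = (SUP (x, y)\<in>X \<times> X. d x y)"

section \<open>Grand Lebesgue norms\<close>

definition Lp_norm :: "'a measure \<Rightarrow> real \<Rightarrow> ('a \<Rightarrow> real) \<Rightarrow> ennreal" where
  "Lp_norm M p f =
     (let I = (\<integral>\<^sup>+\<omega>. ennreal (\<bar>f \<omega>\<bar> powr p) \<partial>M)
      in if I = \<infinity> then \<infinity> else ennreal (enn2real I powr (1 / p)))"

definition GLS_norm :: "'a measure \<Rightarrow> ereal \<Rightarrow> (real \<Rightarrow> ennreal) \<Rightarrow> ('a \<Rightarrow> real) \<Rightarrow> ennreal" where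
  "GLS_norm M B \<psi> f = (SUP p\<in>{p. 2 < p \<and> ereal p < B}. Lp_norm M p f / \<psi> p)"

definition natural_fun :: "'a measure \<Rightarrow> 'x set \<Rightarrow> (nat \<Rightarrow> 'x \<Rightarrow> 'a \<Rightarrow> real) \<Rightarrow> real \<Rightarrow> ennreal" where
  "natural_fun M X \<xi> p = (SUP i\<in>{1..}. SUP x\<in>X. Lp_norm M p (\<xi> i x))"

definition rosenthal_fun :: "(real \<Rightarrow> ennreal) \<Rightarrow> real \<Rightarrow> ennreal" where
  "rosenthal_fun \<psi> p = ennreal (p / ln p) * \<psi> p"

text \<open>The convention that \<open>\<phi>\<close> is infinite outside \<open>(2, B)\<close> is rendered by restricting the infimum to
  \<open>1 / y \<in> (2, B)\<close>. On this range \<open>\<phi>\<close> is assumed finite and bounded away from \<open>0\<close>.\<close>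

definition lower_transform :: "ereal \<Rightarrow> (real \<Rightarrow> ennreal) \<Rightarrow> real \<Rightarrow> real" where
  "lower_transform B \<phi> x =
     (INF y\<in>{y. 0 < y \<and> y < 1 \<and> 2 < 1 / y \<and> ereal (1 / y) < B}. x * y + ln (enn2real (\<phi> (1 / y))))"

text \<open>For \<open>x, y \<in> X\<close> and the natural function \<open>\<psi>\<close>, the Grand Lebesgue norm below is at most \<open>2\<close> by
  Minkowski's inequality, so that \<^const>\<open>enn2real\<close> loses nothing and the supremum in \<open>d_bar\<close> is that
  of a bounded set.\<close>

definition d_inc ::
  "'a measure \<Rightarrow> 'x set \<Rightarrow> ereal \<Rightarrow> (nat \<Rightarrow> 'x \<Rightarrow> 'a \<Rightarrow> real) \<Rightarrow> nat \<Rightarrow> 'x \<Rightarrow> 'x \<Rightarrow> real" where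
  "d_inc M X B \<xi> i x y = enn2real (GLS_norm M B (natural_fun M X \<xi>) (\<lambda>\<omega>. \<xi> i x \<omega> - \<xi> i y \<omega>))"

definition d_bar ::
  "'a measure \<Rightarrow> 'x set \<Rightarrow> ereal \<Rightarrow> (nat \<Rightarrow> 'x \<Rightarrow> 'a \<Rightarrow> real) \<Rightarrow> 'x \<Rightarrow> 'x \<Rightarrow> real" where
  "d_bar M X B \<xi> x y = (SUP n\<in>{1..}. sqrt ((1 / real n) * (\<Sum>i=1..n. (d_inc M X B \<xi> i x y)\<^sup>2)))"

section \<open>Martingale difference fields\<close>

definition martingale_difference_field ::
  "'a measure \<Rightarrow> (nat \<Rightarrow> 'a measure) \<Rightarrow> 'x set \<Rightarrow> (nat \<Rightarrow> 'x \<Rightarrow> 'a \<Rightarrow> real) \<Rightarrow> bool" where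
  "martingale_difference_field M F X \<xi> \<longleftrightarrow>
     (\<forall>i\<ge>1. \<forall>x\<in>X.
        (\<forall>k<i. AE \<omega> in M. real_cond_exp M (F k) (\<xi> i x) \<omega> = 0) \<and>
        (AE \<omega> in M. real_cond_exp M (F i) (\<xi> i x) \<omega> = \<xi> i x \<omega>))"

definition normalized_sum :: "(nat \<Rightarrow> 'x \<Rightarrow> 'a \<Rightarrow> real) \<Rightarrow> nat \<Rightarrow> 'x \<Rightarrow> 'a \<Rightarrow> real" where
  "normalized_sum \<xi> n x \<omega> = (1 / sqrt (real n)) * (\<Sum>i=1..n. \<xi> i x \<omega>)"

definition continuous_modification ::
  "'a measure \<Rightarrow> 'x topology \<Rightarrow> (nat \<Rightarrow> 'x \<Rightarrow> 'a \<Rightarrow> real) \<Rightarrow> (nat \<Rightarrow> 'x \<Rightarrow> 'a \<Rightarrow> real) \<Rightarrow> bool" where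
  "continuous_modification M T \<xi> \<zeta> \<longleftrightarrow>
     (\<forall>i\<ge>1.
        (\<forall>x\<in>topspace T. \<zeta> i x \<in> borel_measurable M \<and> (AE \<omega> in M. \<zeta> i x \<omega> = \<xi> i x \<omega>)) \<and>
        (\<forall>\<omega>\<in>space M. continuous_map T euclideanreal (\<lambda>x. \<zeta> i x \<omega>)))"

section \<open>Weak compactness of families of distributions\<close>

definition borel_of :: "'c topology \<Rightarrow> 'c measure" where
  "borel_of T = sigma (topspace T) {U. openin T U}"

definition borel_prob_measures :: "'c topology \<Rightarrow> 'c measure set" where
  "borel_prob_measures T = {\<mu>. prob_space \<mu> \<and> sets \<mu> = sets (borel_of T)}"

definition bounded_continuous_functions :: "'c topology \<Rightarrow> ('c \<Rightarrow> real) set" where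
  "bounded_continuous_functions T = {f. continuous_map T euclideanreal f \<and> bounded (f ` topspace T)}"

text \<open>The coarsest topology on the Borel probability measures for which \<open>\<mu> \<mapsto> \<integral> f d\<mu>\<close> is
  continuous for every bounded continuous \<open>f\<close>.\<close>

definition weak_convergence_topology :: "'c topology \<Rightarrow> 'c measure topology" where
  "weak_convergence_topology T =
     pullback_topology (borel_prob_measures T)
       (\<lambda>\<mu>. \<lambda>f\<in>bounded_continuous_functions T. \<integral>c. f c \<partial>\<mu>)
       (product_topology (\<lambda>_. euclideanreal) (bounded_continuous_functions T))"

definition relatively_compact_in :: "'b topology \<Rightarrow> 'b set \<Rightarrow> bool" where
  "relatively_compact_in T S \<longleftrightarrow> S \<subseteq> topspace T \<and> compactin T (T closure_of S)"

definition weakly_compact :: "'c topology \<Rightarrow> 'c measure set \<Rightarrow> bool" where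
  "weakly_compact T S \<longleftrightarrow> relatively_compact_in (weak_convergence_topology T) S"

text \<open>For a compact \<open>T\<close> every continuous function is bounded, and this is the space of all
  continuous real functions with the uniform topology. Its elements are \<^const>\<open>extensional\<close>, whence
  the restrictions of sample paths to \<open>X\<close> below.\<close>

definition C_space :: "'x topology \<Rightarrow> ('x \<Rightarrow> real) topology" where
  "C_space T = mtopology_of (cfunspace T euclidean_metric)"

definition sample_path :: "'x set \<Rightarrow> ('x \<Rightarrow> 'a \<Rightarrow> real) \<Rightarrow> 'a \<Rightarrow> 'x \<Rightarrow> real" where
  "sample_path X \<eta> \<omega> = (\<lambda>x\<in>X. \<eta> x \<omega>)"

definition field_distribution ::
  "'a measure \<Rightarrow> 'x topology \<Rightarrow> ('x \<Rightarrow> 'a \<Rightarrow> real) \<Rightarrow> ('x \<Rightarrow> real) measure" where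
  "field_distribution M T \<eta> = distr M (borel_of (C_space T)) (sample_path (topspace T) \<eta>)"

end

theory Submission
  imports Defs
begin

text \<open>
  The normalized sums \<open>\<eta>\<^sub>n\<close> turn out to be equicontinuous in probability, uniformly in \<open>n\<close>,
  with respect to the semi-distance \<open>d\<close> averaged over the summands; together with boundedness in
  probability this gives tightness in the space of continuous functions, and tightness gives relative
  compactness.

  \<^item> Moments. For martingale differences \<open>Y\<^sub>i\<close> and \<open>p > 2\<close> the square of the \<open>L\<^sup>p\<close> norm is
  almost additive: \<open>|\<Sum> Y\<^sub>i|\<^sub>p\<^sup>2 \<le> 5 p \<Sum> |Y\<^sub>i|\<^sub>p\<^sup>2\<close>, by a second order expansion of \<open>|s + y|\<^sup>p\<close> whose
  linear term has conditional mean zero (\<open>Lp_norm_martingale_sum\<close>). As \<open>\<surd>(5 p) \<le> 3 p / ln p\<close>,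
  the increments satisfy \<open>|\<eta>\<^sub>n(x) - \<eta>\<^sub>n(y)|\<^sub>p \<le> 3 \<psi>\<^sub>R(p) d(x, y)\<close> for every \<open>p\<close> in \<open>(2, B)\<close> and
  every \<open>n\<close>, where \<open>\<psi>\<^sub>R(p) = (p / ln p) \<psi>(p)\<close>.

  \<^item> Chaining. A maximum of \<open>N\<close> increments of \<open>d\<close>-size at most \<open>r\<close> has mean at most
  \<open>N\<^sup>1\<^sup>/\<^sup>p \<psi>\<^sub>R(p) r\<close>. Optimizing over \<open>p\<close> replaces \<open>N\<^sup>1\<^sup>/\<^sup>p \<psi>\<^sub>R(p)\<close> by the exponential of the
  lower transform of \<open>\<psi>\<^sub>R\<close> at \<open>ln N\<close> (\<open>maximal_inequality\<close>). Summing along minimal nets of radii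
  \<open>D / 2\<^sup>k\<close> produces a tail of the entropy integral, so the expected oscillation is small on small
  scales, with a bound that does not depend on the field (\<open>expected_oscillation\<close>). Applied to a
  single \<open>\<xi>\<^sub>i\<close> this yields a continuous modification; applied to all \<open>\<eta>\<^sub>n\<close> simultaneously it yields
  compact sets of continuous functions that carry almost all of the mass of every \<open>\<eta>\<^sub>n\<close>.

  \<^item> Compactness. Weak convergence is tested by the map sending a measure to its integrals of
  bounded continuous functions. The closure of a tight family in the product of intervals is compact
  by Tychonoff's theorem, and each point of it is a positive linear functional. By tightness and Dini's
  theorem this functional is continuous along decreasing sequences, hence is the integral with
  respect to a measure (\<open>representation\<close>), so the limit points are again probability measures.
\<close>

section \<open>Moment norms\<close>

text \<open>The two forms of a moment bound, through the extended norm and through the integral of the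
  power, are interchangeable for every real bound; the latter is the one that can be computed with.\<close>

lemma Lp_norm_le_iff:
  assumes p: "p > 0" and a: "a \<ge> 0"
  shows "Lp_norm M p f \<le> ennreal a \<longleftrightarrow> (\<integral>\<^sup>+\<omega>. ennreal (\<bar>f \<omega>\<bar> powr p) \<partial>M) \<le> ennreal (a powr p)"
proof (cases "(\<integral>\<^sup>+\<omega>. ennreal (\<bar>f \<omega>\<bar> powr p) \<partial>M)")
  case (real r)
  have "r powr (1 / p) \<le> a \<longleftrightarrow> r \<le> a powr p"
  proof
    assume "r powr (1 / p) \<le> a"
    then have "(r powr (1 / p)) powr p \<le> a powr p" using p by (intro powr_mono2) auto
    then show "r \<le> a powr p" using p real by (simp add: powr_powr)
  next
    assume "r \<le> a powr p"
    then have "r powr (1 / p) \<le> (a powr p) powr (1 / p)" using p real by (intro powr_mono2) auto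
    then show "r powr (1 / p) \<le> a" using p a by (simp add: powr_powr)
  qed
  then show ?thesis using real a by (simp add: Lp_norm_def Let_def)
qed (simp add: Lp_norm_def Let_def top_unique)

lemma Lp_norm_le_iff_integral:
  assumes p: "p > 0" and a: "a \<ge> 0" and f: "f \<in> borel_measurable M"
  shows "Lp_norm M p f \<le> ennreal a \<longleftrightarrow>
    integrable M (\<lambda>\<omega>. \<bar>f \<omega>\<bar> powr p) \<and> (\<integral>\<omega>. \<bar>f \<omega>\<bar> powr p \<partial>M) \<le> a powr p"
  unfolding Lp_norm_le_iff[OF p a]
proof
  assume *: "(\<integral>\<^sup>+\<omega>. ennreal (\<bar>f \<omega>\<bar> powr p) \<partial>M) \<le> ennreal (a powr p)"
  then have "integrable M (\<lambda>\<omega>. \<bar>f \<omega>\<bar> powr p)"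
    using f by (intro integrableI_nonneg) (auto intro: le_less_trans)
  then show "integrable M (\<lambda>\<omega>. \<bar>f \<omega>\<bar> powr p) \<and> (\<integral>\<omega>. \<bar>f \<omega>\<bar> powr p \<partial>M) \<le> a powr p"
    using * by (simp add: nn_integral_eq_integral)
qed (auto simp: nn_integral_eq_integral)

lemma Lp_norm_mono_AE:
  assumes p: "p > 0" and le: "AE \<omega> in M. \<bar>f \<omega>\<bar> \<le> \<bar>g \<omega>\<bar>"
  shows "Lp_norm M p f \<le> Lp_norm M p g"
proof (cases "Lp_norm M p g")
  case (real a)
  have "(\<integral>\<^sup>+\<omega>. ennreal (\<bar>f \<omega>\<bar> powr p) \<partial>M) \<le> (\<integral>\<^sup>+\<omega>. ennreal (\<bar>g \<omega>\<bar> powr p) \<partial>M)"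
    using le p by (intro nn_integral_mono_AE) (auto elim!: eventually_mono intro!: ennreal_leI powr_mono2)
  then show ?thesis
    using real p Lp_norm_le_iff[of p a M g] Lp_norm_le_iff[of p a M f] by auto
qed simp

lemma Lp_norm_cong_AE:
  assumes "p > 0" and "AE \<omega> in M. \<bar>f \<omega>\<bar> = \<bar>g \<omega>\<bar>"
  shows "Lp_norm M p f = Lp_norm M p g"
  using assms by (intro antisym Lp_norm_mono_AE) (auto elim!: eventually_mono)

lemma Lp_norm_zero [simp]: "p > 0 \<Longrightarrow> Lp_norm M p (\<lambda>_. 0) = 0"
  by (simp add: Lp_norm_def)

lemma Lp_norm_le_0_AE:
  assumes p: "p > 0" and f: "f \<in> borel_measurable M" and 0: "Lp_norm M p f \<le> 0"
  shows "AE \<omega> in M. f \<omega> = 0"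
proof -
  have "(\<integral>\<^sup>+\<omega>. ennreal (\<bar>f \<omega>\<bar> powr p) \<partial>M) \<le> ennreal (0 powr p)"
    using Lp_norm_le_iff[of p 0 M f] p 0 by simp
  then have "(\<integral>\<^sup>+\<omega>. ennreal (\<bar>f \<omega>\<bar> powr p) \<partial>M) = 0" by simp
  then have "AE \<omega> in M. ennreal (\<bar>f \<omega>\<bar> powr p) = 0"
    using f by (subst (asm) nn_integral_0_iff_AE) auto
  then show ?thesis by (rule eventually_mono) (auto simp: ennreal_eq_0_iff)
qed

lemma Lp_norm_cmult:
  assumes p: "p > 0" and a: "a \<ge> 0" and le: "Lp_norm M p f \<le> ennreal a" and f: "f \<in> borel_measurable M"
  shows "Lp_norm M p (\<lambda>\<omega>. c * f \<omega>) \<le> ennreal (\<bar>c\<bar> * a)"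
proof -
  have "(\<integral>\<^sup>+\<omega>. ennreal (\<bar>c * f \<omega>\<bar> powr p) \<partial>M) = ennreal (\<bar>c\<bar> powr p) * (\<integral>\<^sup>+\<omega>. ennreal (\<bar>f \<omega>\<bar> powr p) \<partial>M)"
    using f by (subst nn_integral_cmult[symmetric]) (auto simp: abs_mult powr_mult ennreal_mult)
  also have "\<dots> \<le> ennreal (\<bar>c\<bar> powr p) * ennreal (a powr p)"
    using le p a by (intro mult_left_mono) (auto simp: Lp_norm_le_iff)
  also have "\<dots> = ennreal ((\<bar>c\<bar> * a) powr p)" using a by (simp add: powr_mult ennreal_mult)
  finally show ?thesis using p a by (simp add: Lp_norm_le_iff)
qed

lemma convex_combination_powr_le:
  fixes s t u v p :: real
  assumes p: "p \<ge> 1" and s: "s > 0" and t: "t > 0" and st: "s + t = 1" and u: "u \<ge> 0" and v: "v \<ge> 0"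
  shows "(s * u + t * v) powr p \<le> s * u powr p + t * v powr p"
proof -
  have le: "r powr p \<le> r" if "0 < r" "r < 1" for r :: real
    using powr_mono'[of 1 p r] that p by simp
  consider "u > 0" "v > 0" | "u = 0" | "v = 0" using u v by fastforce
  then show ?thesis
  proof cases
    case 1
    have "s = 1 - t" using st by simp
    then show ?thesis
      using convex_onD[OF powr_convex[OF p], of t u v] 1 s t by simp
  next
    case 2
    have "t powr p * v powr p \<le> t * v powr p" using le[of t] s t st by (intro mult_right_mono) auto
    then show ?thesis using 2 t v p by (simp add: powr_mult)
  next
    case 3
    have "s powr p * u powr p \<le> s * u powr p" using le[of s] s t st by (intro mult_right_mono) auto
    then show ?thesis using 3 s u p by (simp add: powr_mult)
  qed
qed

text \<open>Minkowski's inequality with prescribed bounds \<open>a\<close>, \<open>b\<close> in place of the norms: after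
  normalization \<open>|f| + |g|\<close> is \<open>a + b\<close> times a convex combination of \<open>|f| / a\<close> and \<open>|g| / b\<close>, so
  convexity of the power suffices. Stating it for \<open>|f| + |g|\<close> also covers sums and differences.\<close>

lemma Lp_norm_triangle:
  assumes p: "p \<ge> 1" and a: "a \<ge> 0" and b: "b \<ge> 0"
    and f[measurable]: "f \<in> borel_measurable M" and g[measurable]: "g \<in> borel_measurable M"
    and fa: "Lp_norm M p f \<le> ennreal a" and gb: "Lp_norm M p g \<le> ennreal b"
  shows "Lp_norm M p (\<lambda>\<omega>. \<bar>f \<omega>\<bar> + \<bar>g \<omega>\<bar>) \<le> ennreal (a + b)"
proof -
  have p0: "p > 0" using p by simp
  consider "a = 0" | "b = 0" | "a > 0" "b > 0" using a b by fastforce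
  then show ?thesis
  proof cases
    case 1
    then have "AE \<omega> in M. f \<omega> = 0" using Lp_norm_le_0_AE[OF p0 f] fa by simp
    then have "Lp_norm M p (\<lambda>\<omega>. \<bar>f \<omega>\<bar> + \<bar>g \<omega>\<bar>) = Lp_norm M p g"
      by (intro Lp_norm_cong_AE[OF p0]) (auto elim!: eventually_mono)
    then show ?thesis using gb 1 by simp
  next
    case 2
    then have "AE \<omega> in M. g \<omega> = 0" using Lp_norm_le_0_AE[OF p0 g] gb by simp
    then have "Lp_norm M p (\<lambda>\<omega>. \<bar>f \<omega>\<bar> + \<bar>g \<omega>\<bar>) = Lp_norm M p f"
      by (intro Lp_norm_cong_AE[OF p0]) (auto elim!: eventually_mono)
    then show ?thesis using fa 2 by simp
  next
    case 3
    define c where "c = (a + b) powr p"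
    define k where "k = c * (a / (a + b)) / a powr p"
    define l where "l = c * (b / (a + b)) / b powr p"
    have nn: "k \<ge> 0" "l \<ge> 0" "c > 0" unfolding k_def l_def c_def using 3 by auto
    have pt: "\<bar>\<bar>x\<bar> + \<bar>y\<bar>\<bar> powr p \<le> k * \<bar>x\<bar> powr p + l * \<bar>y\<bar> powr p" for x y :: real
    proof -
      have "a / (a + b) + b / (a + b) = 1" using 3 by (simp flip: add_divide_distrib)
      then have *: "(a / (a + b) * (\<bar>x\<bar> / a) + b / (a + b) * (\<bar>y\<bar> / b)) powr p
            \<le> a / (a + b) * (\<bar>x\<bar> / a) powr p + b / (a + b) * (\<bar>y\<bar> / b) powr p"
        using 3 p by (intro convex_combination_powr_le) auto
      have "\<bar>\<bar>x\<bar> + \<bar>y\<bar>\<bar> = (a + b) * (a / (a + b) * (\<bar>x\<bar> / a) + b / (a + b) * (\<bar>y\<bar> / b))"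
      proof -
        have "(a + b) * (a / (a + b) * (\<bar>x\<bar> / a)) = \<bar>x\<bar>" "(a + b) * (b / (a + b) * (\<bar>y\<bar> / b)) = \<bar>y\<bar>"
          using 3 by auto
        then show ?thesis by (simp only: distrib_left)
      qed
      then have "\<bar>\<bar>x\<bar> + \<bar>y\<bar>\<bar> powr p = c * (a / (a + b) * (\<bar>x\<bar> / a) + b / (a + b) * (\<bar>y\<bar> / b)) powr p"
        using 3 by (simp add: powr_mult c_def)
      also have "\<dots> \<le> c * (a / (a + b) * (\<bar>x\<bar> / a) powr p + b / (a + b) * (\<bar>y\<bar> / b) powr p)"
        using * nn by (intro mult_left_mono) auto
      also have "\<dots> = k * \<bar>x\<bar> powr p + l * \<bar>y\<bar> powr p"
        using 3 by (simp add: powr_divide k_def l_def distrib_left)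
      finally show ?thesis .
    qed
    have "(\<integral>\<^sup>+\<omega>. ennreal (\<bar>\<bar>f \<omega>\<bar> + \<bar>g \<omega>\<bar>\<bar> powr p) \<partial>M)
        \<le> (\<integral>\<^sup>+\<omega>. ennreal k * ennreal (\<bar>f \<omega>\<bar> powr p) + ennreal l * ennreal (\<bar>g \<omega>\<bar> powr p) \<partial>M)"
      using pt nn by (intro nn_integral_mono) (auto simp: ennreal_mult'[symmetric] ennreal_plus[symmetric] simp del: ennreal_plus)
    also have "\<dots> = ennreal k * (\<integral>\<^sup>+\<omega>. ennreal (\<bar>f \<omega>\<bar> powr p) \<partial>M) + ennreal l * (\<integral>\<^sup>+\<omega>. ennreal (\<bar>g \<omega>\<bar> powr p) \<partial>M)"
      by (simp add: nn_integral_add nn_integral_cmult)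
    also have "\<dots> \<le> ennreal k * ennreal (a powr p) + ennreal l * ennreal (b powr p)"
      using fa gb p0 a b by (intro add_mono mult_left_mono) (auto simp: Lp_norm_le_iff)
    also have "\<dots> = ennreal (k * a powr p + l * b powr p)"
      using nn by (simp add: ennreal_mult)
    also have "k * a powr p + l * b powr p = c"
      unfolding k_def l_def using 3 by (simp flip: distrib_left add_divide_distrib)
    finally show ?thesis using p0 a b unfolding c_def by (subst Lp_norm_le_iff) auto
  qed
qed

lemma (in prob_space) nn_integral_abs_le_Lp_norm:
  assumes p: "p > 1" and f[measurable]: "f \<in> borel_measurable M"
  shows "(\<integral>\<^sup>+\<omega>. ennreal \<bar>f \<omega>\<bar> \<partial>M) \<le> Lp_norm M p f"
proof (cases "Lp_norm M p f")
  case (real a)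
  have p0: "p > 0" using p by simp
  show ?thesis
  proof (cases "a = 0")
    case True
    then have "AE \<omega> in M. f \<omega> = 0" using Lp_norm_le_0_AE[OF p0 f] real by simp
    then have "(\<integral>\<^sup>+\<omega>. ennreal \<bar>f \<omega>\<bar> \<partial>M) = (\<integral>\<^sup>+\<omega>. 0 \<partial>M)"
      by (intro nn_integral_cong_AE) (auto elim!: eventually_mono)
    then show ?thesis by simp
  next
    case False
    then have a: "a > 0" using real by simp
    define k where "k = a / p / a powr p"
    define q where "q = p / (p - 1)"
    have q: "q > 1" "1 / p + 1 / q = 1" using p by (auto simp: q_def field_simps)
    have pt: "\<bar>x\<bar> \<le> k * \<bar>x\<bar> powr p + a / q" for x :: real
    proof -
      have "(\<bar>x\<bar> / a) * 1 \<le> (\<bar>x\<bar> / a) powr p / p + 1 powr q / q"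
        using p q a by (intro Youngs_inequality) auto
      then have "a * (\<bar>x\<bar> / a) \<le> a * ((\<bar>x\<bar> / a) powr p / p + 1 / q)"
        using a by (intro mult_left_mono) auto
      then show ?thesis using a by (simp add: powr_divide k_def distrib_left mult.commute)
    qed
    have k: "k \<ge> 0" unfolding k_def using a p by simp
    have "(\<integral>\<^sup>+\<omega>. ennreal \<bar>f \<omega>\<bar> \<partial>M) \<le> (\<integral>\<^sup>+\<omega>. ennreal k * ennreal (\<bar>f \<omega>\<bar> powr p) + ennreal (a / q) \<partial>M)"
      using pt k q a by (intro nn_integral_mono) (auto simp: ennreal_mult'[symmetric] ennreal_plus[symmetric] simp del: ennreal_plus)
    also have "\<dots> = ennreal k * (\<integral>\<^sup>+\<omega>. ennreal (\<bar>f \<omega>\<bar> powr p) \<partial>M) + ennreal (a / q)"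
      by (simp add: nn_integral_add nn_integral_cmult emeasure_space_1)
    also have "\<dots> \<le> ennreal k * ennreal (a powr p) + ennreal (a / q)"
      using real p0 a Lp_norm_le_iff[OF p0, of a M f] by (intro add_mono mult_left_mono) auto
    also have "\<dots> = ennreal (k * a powr p + a / q)" using k a q by (simp add: ennreal_mult)
    also have "k * a powr p + a / q = a * (1 / p + 1 / q)" using a by (simp add: k_def distrib_left)
    also have "\<dots> = a" using q by simp
    finally show ?thesis using real by simp
  qed
qed simp

text \<open>The maximum is dominated by the \<open>\<ell>\<^sup>p\<close> norm of the family, whose \<open>p\<close>-th moment is the sum of
  the \<open>p\<close>-th moments. Hence passing from one variable to \<open>N\<close> of them costs only a factor \<open>N\<^sup>1\<^sup>/\<^sup>p\<close>,
  and it is this factor that is balanced against the growth of the moments in \<open>p\<close>.\<close>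

lemma (in prob_space) nn_integral_Max_le:
  fixes Z :: "'i \<Rightarrow> 'a \<Rightarrow> real"
  assumes p: "p > 1" and A: "finite A" "card A \<le> N" and c: "c \<ge> 0"
    and Z[measurable]: "\<And>i. i \<in> A \<Longrightarrow> Z i \<in> borel_measurable M"
    and le: "\<And>i. i \<in> A \<Longrightarrow> Lp_norm M p (Z i) \<le> ennreal c"
  shows "(\<integral>\<^sup>+\<omega>. (SUP i\<in>A. ennreal \<bar>Z i \<omega>\<bar>) \<partial>M) \<le> ennreal (real N powr (1 / p) * c)"
proof (cases "A = {}")
  case True
  then show ?thesis by (simp add: bot_ennreal)
next
  case False
  have p0: "p > 0" using p by simp
  define W where "W \<omega> = (\<Sum>i\<in>A. \<bar>Z i \<omega>\<bar> powr p) powr (1 / p)" for \<omega>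
  have [measurable]: "W \<in> borel_measurable M" unfolding W_def by measurable
  have S0: "(\<Sum>i\<in>A. \<bar>Z i \<omega>\<bar> powr p) \<ge> 0" for \<omega> by (intro sum_nonneg) auto
  have "Lp_norm M p W \<le> ennreal (real N powr (1 / p) * c)"
  proof -
    have "(\<integral>\<^sup>+\<omega>. ennreal (\<bar>W \<omega>\<bar> powr p) \<partial>M) = (\<integral>\<^sup>+\<omega>. (\<Sum>i\<in>A. ennreal (\<bar>Z i \<omega>\<bar> powr p)) \<partial>M)"
      unfolding W_def using p S0 by (intro nn_integral_cong) (auto simp: powr_powr)
    also have "\<dots> = (\<Sum>i\<in>A. \<integral>\<^sup>+\<omega>. ennreal (\<bar>Z i \<omega>\<bar> powr p) \<partial>M)"
      by (intro nn_integral_sum) auto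
    also have "\<dots> \<le> (\<Sum>i\<in>A. ennreal (c powr p))"
      using le p0 c by (intro sum_mono) (auto simp: Lp_norm_le_iff)
    also have "\<dots> = ennreal (real (card A) * c powr p)" by (simp add: ennreal_mult ennreal_of_nat_eq_real_of_nat)
    also have "\<dots> \<le> ennreal (real N * c powr p)" using A by (intro ennreal_leI mult_right_mono) auto
    also have "\<dots> = ennreal ((real N powr (1 / p) * c) powr p)"
      using p0 c by (simp add: powr_mult powr_powr)
    finally show ?thesis using p0 c by (subst Lp_norm_le_iff) auto
  qed
  moreover have "(\<integral>\<^sup>+\<omega>. (SUP i\<in>A. ennreal \<bar>Z i \<omega>\<bar>) \<partial>M) \<le> (\<integral>\<^sup>+\<omega>. ennreal \<bar>W \<omega>\<bar> \<partial>M)"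
  proof (intro nn_integral_mono SUP_least ennreal_leI)
    fix \<omega> i assume i: "i \<in> A"
    have "\<bar>Z i \<omega>\<bar> powr p \<le> (\<Sum>i\<in>A. \<bar>Z i \<omega>\<bar> powr p)" using i A by (intro member_le_sum) auto
    then have "(\<bar>Z i \<omega>\<bar> powr p) powr (1 / p) \<le> W \<omega>" unfolding W_def using p by (intro powr_mono2) auto
    then show "\<bar>Z i \<omega>\<bar> \<le> \<bar>W \<omega>\<bar>" using p by (simp add: powr_powr)
  qed
  ultimately show ?thesis
    using nn_integral_abs_le_Lp_norm[OF p, of W] by (auto intro: order_trans)
qed

section \<open>Moments of martingales\<close>

lemma powr_DERIV_abs:
  fixes p :: real assumes "p > 1"
  shows "((\<lambda>t. \<bar>t\<bar> powr p) has_real_derivative p * sgn t * \<bar>t\<bar> powr (p - 1)) (at t)"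
proof (cases t "0 :: real" rule: linorder_cases)
  case greater
  have "((\<lambda>t. t powr p) has_real_derivative p * t powr (p - 1)) (at t)"
    using greater by (auto intro!: derivative_eq_intros)
  then have "((\<lambda>t. \<bar>t\<bar> powr p) has_real_derivative p * t powr (p - 1)) (at t)"
    by (rule has_field_derivative_transform_within[where d = t]) (use greater in \<open>auto simp: dist_real_def\<close>)
  then show ?thesis using greater by simp
next
  case less
  have "((\<lambda>t. (- t) powr p) has_real_derivative - p * (- t) powr (p - 1)) (at t)"
    using less by (auto intro!: derivative_eq_intros)
  then have "((\<lambda>t. \<bar>t\<bar> powr p) has_real_derivative - p * (- t) powr (p - 1)) (at t)"
    by (rule has_field_derivative_transform_within[where d = "- t"]) (use less in \<open>auto simp: dist_real_def\<close>)
  then show ?thesis using less by simp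
next
  case equal
  have "((\<lambda>h. \<bar>h\<bar> powr (p - 1)) \<longlongrightarrow> \<bar>0\<bar> powr (p - 1)) (at (0::real))"
    by (intro tendsto_intros) (use assms in auto)
  then have "((\<lambda>h. \<bar>h\<bar> powr (p - 1)) \<longlongrightarrow> 0) (at (0::real))" by simp
  then have "((\<lambda>h. sgn h * \<bar>h\<bar> powr (p - 1)) \<longlongrightarrow> 0) (at (0::real))"
    by (rule Lim_null_comparison[rotated]) (auto simp: abs_mult sgn_if intro!: always_eventually)
  then have "((\<lambda>h. (\<bar>0 + h\<bar> powr p - \<bar>0\<bar> powr p) / h) \<longlongrightarrow> 0) (at (0::real))"
  proof (rule Lim_transform_eventually)
    show "\<forall>\<^sub>F h in at (0::real). sgn h * \<bar>h\<bar> powr (p - 1) = (\<bar>0 + h\<bar> powr p - \<bar>0\<bar> powr p) / h"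
      unfolding eventually_at_filter
      by (rule always_eventually) (auto simp: powr_diff sgn_if)
  qed
  then show ?thesis using equal by (simp add: DERIV_def)
qed

text \<open>The derivative of \<open>|t|\<^sup>q\<^sup>+\<^sup>1 / (q + 1)\<close> is Lipschitz on bounded intervals. Arguments of equal sign are
  compared by the mean value theorem; across the origin this is replaced by a direct estimate.\<close>

lemma signed_powr_diff_le:
  fixes a b m q :: real
  assumes q: "q > 1" and a: "\<bar>a\<bar> \<le> m" and b: "\<bar>b\<bar> \<le> m"
  shows "\<bar>sgn a * \<bar>a\<bar> powr q - sgn b * \<bar>b\<bar> powr q\<bar> \<le> q * m powr (q - 1) * \<bar>a - b\<bar>"
proof -
  have pos: "v powr q - u powr q \<le> q * m powr (q - 1) * (v - u)" if uv: "0 < u" "u < v" "v \<le> m" for u v :: real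
  proof -
    have "\<And>x. u \<le> x \<Longrightarrow> x \<le> v \<Longrightarrow> ((\<lambda>t. t powr q) has_real_derivative q * x powr (q - 1)) (at x)"
      using uv by (auto intro!: derivative_eq_intros)
    from MVT2[OF uv(2) this] obtain z where z: "u < z" "z < v" "v powr q - u powr q = (v - u) * (q * z powr (q - 1))"
      by metis
    have "(v - u) * (q * z powr (q - 1)) \<le> (v - u) * (q * m powr (q - 1))"
      using z uv q by (intro mult_left_mono powr_mono2) auto
    then show ?thesis using z by (simp add: algebra_simps)
  qed
  have one: "u powr q \<le> q * m powr (q - 1) * u" if "0 \<le> u" "u \<le> m" for u
  proof (cases "u = 0")
    case False
    have "u powr q = u powr (q - 1) * u" using that False by (simp add: powr_diff)
    also have "\<dots> \<le> m powr (q - 1) * u" using that q by (intro mult_right_mono powr_mono2) auto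
    also have "\<dots> \<le> q * (m powr (q - 1) * u)" using q that mult_right_mono[of 1 q "m powr (q - 1) * u"] by simp
    finally show ?thesis by (simp add: algebra_simps)
  qed simp
  have pos': "\<bar>v powr q - u powr q\<bar> \<le> q * m powr (q - 1) * \<bar>v - u\<bar>" if "0 < u" "u \<le> m" "0 < v" "v \<le> m" for u v :: real
  proof (cases u v rule: linorder_cases)
    case less
    then have "u powr q \<le> v powr q" using q that by (intro powr_mono2) auto
    then show ?thesis using pos[of u v] less that by auto
  next
    case greater
    then have "v powr q \<le> u powr q" using q that by (intro powr_mono2) auto
    then show ?thesis using pos[of v u] greater that by auto
  qed simp
  \<comment> \<open>opposite signs: both powers count, and \<open>q \<ge> 1\<close> absorbs the missing factor\<close>
  consider "a > 0" "b > 0" | "a < 0" "b < 0" | "a \<ge> 0" "b \<le> 0" | "a \<le> 0" "b \<ge> 0" by linarith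
  then show ?thesis
  proof cases
    case 1 then show ?thesis using pos'[of b a] a b by auto
  next
    case 2 then show ?thesis using pos'[of "-b" "-a"] a b by (auto simp: abs_minus_commute)
  next
    case 3
    then have "sgn a * \<bar>a\<bar> powr q = (\<bar>a\<bar> powr q)" "sgn b * \<bar>b\<bar> powr q = - (\<bar>b\<bar> powr q)"
      by (auto simp: sgn_if)
    then have "\<bar>sgn a * \<bar>a\<bar> powr q - sgn b * \<bar>b\<bar> powr q\<bar> = \<bar>a\<bar> powr q + \<bar>b\<bar> powr q"
      using powr_ge_zero[of "\<bar>a\<bar>" q] powr_ge_zero[of "\<bar>b\<bar>" q] by linarith
    also have "\<dots> \<le> q * m powr (q - 1) * \<bar>a\<bar> + q * m powr (q - 1) * \<bar>b\<bar>"
      using one[of "\<bar>a\<bar>"] one[of "\<bar>b\<bar>"] a b by auto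
    also have "\<dots> = q * m powr (q - 1) * \<bar>a - b\<bar>" using 3 by (simp add: algebra_simps)
    finally show ?thesis .
  next
    case 4
    then have "sgn a * \<bar>a\<bar> powr q = - (\<bar>a\<bar> powr q)" "sgn b * \<bar>b\<bar> powr q = (\<bar>b\<bar> powr q)"
      by (auto simp: sgn_if)
    then have "\<bar>sgn a * \<bar>a\<bar> powr q - sgn b * \<bar>b\<bar> powr q\<bar> = \<bar>a\<bar> powr q + \<bar>b\<bar> powr q"
      using powr_ge_zero[of "\<bar>a\<bar>" q] powr_ge_zero[of "\<bar>b\<bar>" q] by linarith
    also have "\<dots> \<le> q * m powr (q - 1) * \<bar>a\<bar> + q * m powr (q - 1) * \<bar>b\<bar>"
      using one[of "\<bar>a\<bar>"] one[of "\<bar>b\<bar>"] a b by auto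
    also have "\<dots> = q * m powr (q - 1) * \<bar>a - b\<bar>" using 4 by (simp add: algebra_simps)
    finally show ?thesis .
  qed
qed

text \<open>A second order Taylor bound for \<open>|t|\<^sup>p\<close>. It is used with \<open>x\<close> a martingale and \<open>y\<close> its next
  increment: the linear term then integrates to zero. The quadratic term has twice the
  constant of Taylor's formula, since the mean value theorem is applied twice instead.\<close>

lemma abs_powr_add_le:
  fixes x y p :: real
  assumes p: "p > 2"
  shows "\<bar>x + y\<bar> powr p \<le> \<bar>x\<bar> powr p + p * (sgn x * \<bar>x\<bar> powr (p - 1)) * y
           + p * (p - 1) * (y\<^sup>2 * (\<bar>x\<bar> + \<bar>y\<bar>) powr (p - 2))"
proof -
  define g where "g t = p * sgn t * \<bar>t\<bar> powr (p - 1)" for t :: real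
  have dv: "((\<lambda>t. \<bar>t\<bar> powr p) has_real_derivative g t) (at t)" for t
    unfolding g_def using p by (intro powr_DERIV_abs) auto
  have "\<exists>z. \<bar>z\<bar> \<le> \<bar>x\<bar> + \<bar>y\<bar> \<and> \<bar>z - x\<bar> \<le> \<bar>y\<bar> \<and> \<bar>x + y\<bar> powr p - \<bar>x\<bar> powr p = y * g z"
  proof (cases y "0::real" rule: linorder_cases)
    case less
    then have "x + y < x" by simp
    from MVT2[OF this dv] obtain z where "x + y < z" "z < x" "\<bar>x\<bar> powr p - \<bar>x + y\<bar> powr p = (x - (x + y)) * g z"
      by metis
    then show ?thesis by (intro exI[of _ z]) (auto simp: algebra_simps)
  next
    case greater
    then have "x < x + y" by simp
    from MVT2[OF this dv] obtain z where "x < z" "z < x + y" "\<bar>x + y\<bar> powr p - \<bar>x\<bar> powr p = (x + y - x) * g z"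
      by metis
    then show ?thesis by (intro exI[of _ z]) auto
  qed (auto intro: exI[of _ x])
  then obtain z where z: "\<bar>z\<bar> \<le> \<bar>x\<bar> + \<bar>y\<bar>" "\<bar>z - x\<bar> \<le> \<bar>y\<bar>" "\<bar>x + y\<bar> powr p - \<bar>x\<bar> powr p = y * g z" by blast
  have "\<bar>g z - g x\<bar> = p * \<bar>sgn z * \<bar>z\<bar> powr (p - 1) - sgn x * \<bar>x\<bar> powr (p - 1)\<bar>"
  proof -
    have "g z - g x = p * (sgn z * \<bar>z\<bar> powr (p - 1) - sgn x * \<bar>x\<bar> powr (p - 1))"
      unfolding g_def by (simp add: algebra_simps)
    then show ?thesis using p by (simp only: abs_mult)
  qed
  also have "\<dots> \<le> p * ((p - 1) * (\<bar>x\<bar> + \<bar>y\<bar>) powr (p - 1 - 1) * \<bar>z - x\<bar>)"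
    using p z by (intro mult_left_mono signed_powr_diff_le) auto
  also have "\<dots> \<le> p * ((p - 1) * (\<bar>x\<bar> + \<bar>y\<bar>) powr (p - 2) * \<bar>y\<bar>)"
    using p z by (intro mult_left_mono) (auto simp: mult_left_mono)
  finally have 1: "\<bar>g z - g x\<bar> \<le> p * ((p - 1) * (\<bar>x\<bar> + \<bar>y\<bar>) powr (p - 2) * \<bar>y\<bar>)" .
  have y2: "y\<^sup>2 = \<bar>y\<bar> * \<bar>y\<bar>" by (simp add: power2_eq_square)
  have "y * (g z - g x) \<le> \<bar>y\<bar> * \<bar>g z - g x\<bar>" by (metis abs_ge_self abs_mult)
  also have "\<dots> \<le> \<bar>y\<bar> * (p * ((p - 1) * (\<bar>x\<bar> + \<bar>y\<bar>) powr (p - 2) * \<bar>y\<bar>))"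
    using 1 by (intro mult_left_mono) auto
  also have "\<dots> = p * (p - 1) * (y\<^sup>2 * (\<bar>x\<bar> + \<bar>y\<bar>) powr (p - 2))"
    by (simp only: y2 mult_ac)
  finally have "y * g z \<le> y * g x + p * (p - 1) * (y\<^sup>2 * (\<bar>x\<bar> + \<bar>y\<bar>) powr (p - 2))"
    by (simp add: algebra_simps)
  then show ?thesis using z(3) by (simp add: g_def algebra_simps)
qed

text \<open>The numerical step that turns the expansion of \<open>p\<close>-th moments into additivity of squared norms.
  With \<open>w = a\<^sup>2 + p b\<^sup>2\<close> one has \<open>(a + b)\<^sup>2 \<le> (1 + 1/p) w\<close>, so \<open>(a + b)\<^sup>p\<^sup>-\<^sup>2\<close> exceeds the corresponding
  power of \<open>w\<close> by a factor of at most \<open>\<surd>e < 2\<close>; the room for the quadratic term is then the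
  increment of \<open>v \<mapsto> v\<^sup>p\<^sup>/\<^sup>2\<close> between \<open>w\<close> and \<open>w + 4 p b\<^sup>2\<close>.\<close>

lemma martingale_step_arith:
  fixes a b p :: real
  assumes p: "p > 2" and a: "0 \<le> a" and b: "0 \<le> b"
  shows "a powr p + p * (p - 1) * (b\<^sup>2 * (a + b) powr (p - 2)) \<le> (sqrt (a\<^sup>2 + 5 * p * b\<^sup>2)) powr p"
proof (cases "b = 0")
  case True
  then show ?thesis using a by simp
next
  case False
  then have b: "b > 0" using assms by simp
  define w where "w = a\<^sup>2 + p * b\<^sup>2"
  define v where "v = a\<^sup>2 + 5 * p * b\<^sup>2"
  have w: "w > 0" unfolding w_def using b p by (simp add: add_nonneg_pos)
  have wv: "w < v" unfolding w_def v_def using b p by auto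
  have aw: "a\<^sup>2 \<le> w" unfolding w_def using p by simp
  have "p * (a + b)\<^sup>2 \<le> (p + 1) * w"
  proof -
    have "0 \<le> (a - p * b)\<^sup>2" by simp
    then show ?thesis unfolding w_def by (simp add: power2_eq_square algebra_simps)
  qed
  then have ab: "(a + b)\<^sup>2 \<le> (1 + 1 / p) * w" using p by (simp add: field_simps)
  have "(a + b) powr (p - 2) = ((a + b)\<^sup>2) powr ((p - 2) / 2)"
  proof -
    have "((a + b) powr 2) powr ((p - 2) / 2) = (a + b) powr (p - 2)"
      unfolding powr_powr by (rule arg_cong[where f = "(powr) (a + b)"]) (simp add: field_simps)
    then show ?thesis using a b by simp
  qed
  also have "\<dots> \<le> ((1 + 1 / p) * w) powr ((p - 2) / 2)"
    using ab p by (intro powr_mono2) auto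
  also have "\<dots> = (1 + 1 / p) powr ((p - 2) / 2) * w powr ((p - 2) / 2)"
    using p w by (simp add: powr_mult)
  also have "\<dots> \<le> 2 * w powr ((p - 2) / 2)"
  proof (intro mult_right_mono)
    have "(1 + 1 / p) powr ((p - 2) / 2) \<le> exp (1 / p) powr ((p - 2) / 2)"
      using p by (intro powr_mono2 exp_ge_add_one_self) auto
    also have "\<dots> = exp ((p - 2) / (2 * p))" by (simp add: powr_def)
    also have "\<dots> \<le> exp (1 / 2)" using p by (simp add: field_simps)
    also have "\<dots> \<le> 2" using exp_bound[of "1/2 :: real"] by (simp add: power2_eq_square)
    finally show "(1 + 1 / p) powr ((p - 2) / 2) \<le> 2" .
  qed simp
  finally have 1: "(a + b) powr (p - 2) \<le> 2 * w powr ((p - 2) / 2)" .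
  have "\<And>x. w \<le> x \<Longrightarrow> x \<le> v \<Longrightarrow> ((\<lambda>t. t powr (p/2)) has_real_derivative (p/2) * x powr (p/2 - 1)) (at x)"
    using w by (auto intro!: derivative_eq_intros)
  from MVT2[OF wv this] obtain z where z: "w < z" "z < v"
      "v powr (p/2) - w powr (p/2) = (v - w) * ((p/2) * z powr (p/2 - 1))" by metis
  have "(v - w) * ((p/2) * w powr (p/2 - 1)) \<le> (v - w) * ((p/2) * z powr (p/2 - 1))"
    using wv w z p by (intro mult_left_mono powr_mono2) auto
  then have 2: "w powr (p/2) + (4 * p * b\<^sup>2) * ((p/2) * w powr (p/2 - 1)) \<le> v powr (p/2)"
    using z by (simp add: v_def w_def)
  have 3: "a powr p \<le> w powr (p/2)"
  proof -
    have "a powr p = (a\<^sup>2) powr (p/2)" using a b powr_powr[of a 2 "p / 2"] by (cases "a = 0") auto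
    also have "\<dots> \<le> w powr (p/2)" using aw p by (intro powr_mono2) auto
    finally show ?thesis .
  qed
  have "p * (p - 1) * (b\<^sup>2 * (a + b) powr (p - 2)) \<le> p * p * (b\<^sup>2 * (2 * w powr ((p - 2) / 2)))"
    using 1 p by (intro mult_mono) auto
  also have "\<dots> = (4 * p * b\<^sup>2) * ((p/2) * w powr (p/2 - 1))"
    by (simp add: diff_divide_distrib)
  finally have "a powr p + p * (p - 1) * (b\<^sup>2 * (a + b) powr (p - 2)) \<le> v powr (p/2)"
    using 2 3 by linarith
  also have "v powr (p/2) = sqrt v powr p"
    using w wv by (simp add: powr_half_sqrt[symmetric] powr_powr)
  finally show ?thesis by (simp add: v_def)
qed

text \<open>This is how the square root growth of the martingale constant is absorbed in the factor
  \<open>p / ln p\<close>; it reduces to \<open>ln p \<le> \<surd>p\<close>.\<close>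

lemma sqrt_le_div_ln:
  fixes p :: real assumes p: "p > 2"
  shows "sqrt (5 * p) \<le> 3 * (p / ln p)"
proof -
  have l0: "0 < ln p" using p by simp
  have "ln p = 2 * ln (sqrt p)" using p by (simp add: ln_sqrt)
  also have "ln (sqrt p) = ln (sqrt p / 2) + ln 2" using p by (simp add: ln_div)
  also have "\<dots> \<le> (sqrt p / 2 - 1) + 1"
    using p ln_le_minus_one[of "sqrt p / 2"] ln_2_less_1 by auto
  finally have l: "ln p \<le> sqrt p" by simp
  have "sqrt 5 \<le> sqrt 9" by (rule real_sqrt_le_mono) simp
  then have "sqrt 5 \<le> 3" by simp
  have "sqrt (5 * p) * ln p \<le> sqrt (5 * p) * sqrt p" using l p by (intro mult_left_mono) auto
  also have "\<dots> = sqrt 5 * p" using p by (simp add: real_sqrt_mult)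
  also have "\<dots> \<le> 3 * p" using \<open>sqrt 5 \<le> 3\<close> p by (intro mult_right_mono) auto
  finally show ?thesis using l0 by (simp add: field_simps)
qed

text \<open>Integrating the expansion of \<open>|S + Y|\<^sup>p\<close>: the linear term vanishes because its coefficient is
  measurable with respect to \<open>G\<close>, and Young's inequality, normalized by \<open>b\<close> and \<open>L = a + b\<close>, plays
  the role of Hoelder's inequality for the product \<open>Y\<^sup>2 (|S| + |Y|)\<^sup>p\<^sup>-\<^sup>2\<close>.\<close>

lemma Lp_norm_martingale_step:
  assumes M: "prob_space M" and G: "subalgebra M G" and p: "p > 2"
    and S: "S \<in> borel_measurable G" and Y[measurable]: "Y \<in> borel_measurable M"
    and Y0: "AE \<omega> in M. real_cond_exp M G Y \<omega> = 0"
    and a: "a \<ge> 0" and b: "b \<ge> 0" and Sa: "Lp_norm M p S \<le> ennreal a" and Yb: "Lp_norm M p Y \<le> ennreal b"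
  shows "Lp_norm M p (\<lambda>\<omega>. S \<omega> + Y \<omega>) \<le> ennreal (sqrt (a\<^sup>2 + 5 * p * b\<^sup>2))"
proof -
  interpret prob_space M by fact
  interpret finite_measure_subalgebra M G by unfold_locales (fact G)
  have [measurable]: "S \<in> borel_measurable M" by (rule measurable_from_subalg[OF G S])
  have p0: "p > 0" using p by simp
  show ?thesis
  proof (cases "b = 0")
    case True
    then have "AE \<omega> in M. Y \<omega> = 0" using Lp_norm_le_0_AE[OF p0 Y] Yb by simp
    then have "Lp_norm M p (\<lambda>\<omega>. S \<omega> + Y \<omega>) = Lp_norm M p S"
      by (intro Lp_norm_cong_AE[OF p0]) (auto elim!: eventually_mono)
    then show ?thesis using Sa a True by simp
  next
    case False
    then have b: "b > 0" using b by simp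
    define L where "L = a + b"
    have L: "L > 0" using a b by (simp add: L_def)
    let ?Z = "\<lambda>\<omega>. \<bar>S \<omega>\<bar> + \<bar>Y \<omega>\<bar>"
    let ?g = "\<lambda>\<omega>. sgn (S \<omega>) * \<bar>S \<omega>\<bar> powr (p - 1)"
    have Z: "Lp_norm M p ?Z \<le> ennreal L" unfolding L_def using p a b Sa Yb by (intro Lp_norm_triangle) auto
    have intS: "integrable M (\<lambda>\<omega>. \<bar>S \<omega>\<bar> powr p)" "(\<integral>\<omega>. \<bar>S \<omega>\<bar> powr p \<partial>M) \<le> a powr p"
      using Sa p0 a by (auto simp: Lp_norm_le_iff_integral)
    have intY: "integrable M (\<lambda>\<omega>. \<bar>Y \<omega>\<bar> powr p)" "(\<integral>\<omega>. \<bar>Y \<omega>\<bar> powr p \<partial>M) \<le> b powr p"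
      using Yb p0 b by (auto simp: Lp_norm_le_iff_integral)
    have intZ: "integrable M (\<lambda>\<omega>. ?Z \<omega> powr p)" "(\<integral>\<omega>. ?Z \<omega> powr p \<partial>M) \<le> L powr p"
      using Z p0 L by (auto simp: Lp_norm_le_iff_integral)
    have gY: "integrable M (\<lambda>\<omega>. ?g \<omega> * Y \<omega>)"
    proof (rule Bochner_Integration.integrable_bound[OF intZ(1)])
      have "\<bar>?g \<omega> * Y \<omega>\<bar> \<le> ?Z \<omega> powr p" for \<omega>
      proof -
        have "\<bar>?g \<omega> * Y \<omega>\<bar> \<le> \<bar>S \<omega>\<bar> powr (p - 1) * \<bar>Y \<omega>\<bar>" by (auto simp: abs_mult sgn_if)
        also have "\<dots> \<le> ?Z \<omega> powr (p - 1) * ?Z \<omega>" using p by (intro mult_mono powr_mono2) auto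
        also have "\<dots> = ?Z \<omega> powr p" using powr_mult_base[of "?Z \<omega>" "p - 1"] by (simp add: mult.commute)
        finally show ?thesis .
      qed
      then show "AE \<omega> in M. norm (?g \<omega> * Y \<omega>) \<le> norm (?Z \<omega> powr p)" by simp
    qed measurable
    have gY0: "(\<integral>\<omega>. ?g \<omega> * Y \<omega> \<partial>M) = 0"
    proof -
      have "(\<integral>\<omega>. ?g \<omega> * Y \<omega> \<partial>M) = (\<integral>\<omega>. ?g \<omega> * real_cond_exp M G Y \<omega> \<partial>M)"
        by (rule real_cond_exp_intg(2)[symmetric, OF gY _ Y]) (use S in measurable)
      also have "\<dots> = (\<integral>\<omega>. 0 \<partial>M)" using Y0
        by (intro integral_cong_AE) (auto elim!: eventually_mono)
      finally show ?thesis by simp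
    qed
    define k l where "k = b\<^sup>2 * L powr (p - 2) * (2 / p) / b powr p"
      and "l = b\<^sup>2 * L powr (p - 2) * ((p - 2) / p) / L powr p"
    have kl: "k \<ge> 0" "l \<ge> 0" unfolding k_def l_def using b L p by auto
    have young: "y\<^sup>2 * z powr (p - 2) \<le> k * \<bar>y\<bar> powr p + l * z powr p" if "z \<ge> 0" for y z :: real
    proof -
      define q where "q = p / (p - 2)"
      have q: "q > 1" "1 / (p / 2) + 1 / q = 1" using p by (auto simp: q_def field_simps)
      have e1: "((\<bar>y\<bar> / b) powr 2) powr (p / 2) = (\<bar>y\<bar> / b) powr p" by (simp only: powr_powr) simp
      have "(p - 2) * q = p" using p by (simp add: q_def)
      then have e2: "((z / L) powr (p - 2)) powr q = (z / L) powr p" by (simp only: powr_powr)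
      have "(\<bar>y\<bar> / b) powr 2 * (z / L) powr (p - 2)
            \<le> ((\<bar>y\<bar> / b) powr 2) powr (p / 2) / (p / 2) + ((z / L) powr (p - 2)) powr q / q"
        using p q b L that by (intro Youngs_inequality) auto
      then have "(\<bar>y\<bar> / b) powr 2 * (z / L) powr (p - 2) \<le> (\<bar>y\<bar> / b) powr p / (p / 2) + (z / L) powr p / q"
        unfolding e1 e2 .
      then have "(b\<^sup>2 * L powr (p - 2)) * ((\<bar>y\<bar> / b) powr 2 * (z / L) powr (p - 2))
          \<le> (b\<^sup>2 * L powr (p - 2)) * ((\<bar>y\<bar> / b) powr p / (p / 2) + (z / L) powr p / q)"
        using b L by (intro mult_left_mono) auto
      moreover have "(b\<^sup>2 * L powr (p - 2)) * ((\<bar>y\<bar> / b) powr 2 * (z / L) powr (p - 2)) = y\<^sup>2 * z powr (p - 2)"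
        using b L that by (simp add: powr_divide power_divide)
      moreover have "(b\<^sup>2 * L powr (p - 2)) * ((\<bar>y\<bar> / b) powr p / (p / 2) + (z / L) powr p / q)
          = k * \<bar>y\<bar> powr p + l * z powr p"
        unfolding k_def l_def q_def using b L that p by (simp add: powr_divide distrib_left mult_ac)
      ultimately show ?thesis by simp
    qed
    have kl_int: "integrable M (\<lambda>\<omega>. k * \<bar>Y \<omega>\<bar> powr p + l * ?Z \<omega> powr p)"
      using intY(1) intZ(1) by auto
    define U where "U \<omega> = \<bar>S \<omega>\<bar> powr p + p * (?g \<omega> * Y \<omega>) + p * (p - 1) * (k * \<bar>Y \<omega>\<bar> powr p + l * ?Z \<omega> powr p)" for \<omega>
    have intU: "integrable M U" unfolding U_def using intS(1) gY kl_int by auto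
    have le: "\<bar>S \<omega> + Y \<omega>\<bar> powr p \<le> U \<omega>" for \<omega>
    proof -
      have "p * (p - 1) * ((Y \<omega>)\<^sup>2 * ?Z \<omega> powr (p - 2)) \<le> p * (p - 1) * (k * \<bar>Y \<omega>\<bar> powr p + l * ?Z \<omega> powr p)"
        using young[of "?Z \<omega>" "Y \<omega>"] p by (intro mult_left_mono) auto
      then show ?thesis using abs_powr_add_le[OF p, of "S \<omega>" "Y \<omega>"] by (simp add: U_def mult.assoc)
    qed
    have "integrable M (\<lambda>\<omega>. \<bar>S \<omega> + Y \<omega>\<bar> powr p)"
      by (rule Bochner_Integration.integrable_bound[OF intU])
         (use le in \<open>auto intro!: AE_I2 order_trans[OF _ abs_ge_self]\<close>)
    moreover have "(\<integral>\<omega>. \<bar>S \<omega> + Y \<omega>\<bar> powr p \<partial>M) \<le> sqrt (a\<^sup>2 + 5 * p * b\<^sup>2) powr p"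
    proof -
      have "(\<integral>\<omega>. \<bar>S \<omega> + Y \<omega>\<bar> powr p \<partial>M) \<le> (\<integral>\<omega>. U \<omega> \<partial>M)"
        by (rule integral_mono[OF calculation intU le])
      also have "\<dots> = (\<integral>\<omega>. \<bar>S \<omega>\<bar> powr p \<partial>M) + p * (p - 1) * (k * (\<integral>\<omega>. \<bar>Y \<omega>\<bar> powr p \<partial>M) + l * (\<integral>\<omega>. ?Z \<omega> powr p \<partial>M))"
        unfolding U_def using intS(1) intY(1) intZ(1) gY gY0 by simp
      also have "\<dots> \<le> a powr p + p * (p - 1) * (k * b powr p + l * L powr p)"
        using intS(2) intY(2) intZ(2) kl p by (intro add_mono mult_left_mono) auto
      also have "k * b powr p + l * L powr p = b\<^sup>2 * L powr (p - 2) * (2 / p + (p - 2) / p)"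
        using b L by (simp add: k_def l_def distrib_left)
      also have "2 / p + (p - 2) / p = 1" using p by (simp add: field_simps)
      finally show ?thesis using martingale_step_arith[OF p a, of b] b by (simp add: L_def)
    qed
    ultimately show ?thesis
      using p0 by (subst Lp_norm_le_iff_integral) auto
  qed
qed

text \<open>Induction on the number of summands. The partial sums are only almost surely equal to
  adapted variables, so each is replaced by the sum of the conditional expectations of its
  summands, which is genuinely measurable with respect to the current sub-algebra.\<close>

lemma Lp_norm_martingale_sum:
  fixes Y :: "nat \<Rightarrow> 'a \<Rightarrow> real"
  assumes M: "prob_space M" and F: "filtration (space M) F" and sub: "\<And>i. subalgebra M (F i)" and p: "p > 2"
    and Y[measurable]: "\<And>i. i \<ge> 1 \<Longrightarrow> Y i \<in> borel_measurable M"
    and Y0: "\<And>i k. i \<ge> 1 \<Longrightarrow> k < i \<Longrightarrow> AE \<omega> in M. real_cond_exp M (F k) (Y i) \<omega> = 0"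
    and YF: "\<And>i. i \<ge> 1 \<Longrightarrow> AE \<omega> in M. real_cond_exp M (F i) (Y i) \<omega> = Y i \<omega>"
    and b: "\<And>i. i \<ge> 1 \<Longrightarrow> b i \<ge> 0" and Yb: "\<And>i. i \<ge> 1 \<Longrightarrow> Lp_norm M p (Y i) \<le> ennreal (b i)"
  shows "Lp_norm M p (\<lambda>\<omega>. \<Sum>i=1..n. Y i \<omega>) \<le> ennreal (sqrt (5 * p * (\<Sum>i=1..n. (b i)\<^sup>2)))"
proof (induction n)
  case 0
  then show ?case using p by simp
next
  case (Suc n)
  have p0: "p > 0" using p by simp
  interpret F: filtration "space M" F by fact
  define S where "S \<omega> = (\<Sum>i=1..n. real_cond_exp M (F i) (Y i) \<omega>)" for \<omega>
  have S: "S \<in> borel_measurable (F n)" unfolding S_def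
  proof (intro borel_measurable_sum)
    fix i assume "i \<in> {1..n}"
    then have "subalgebra (F n) (F i)"
      using F.sets_F_mono[of i n] by (auto simp: subalgebra_def F.space_F)
    then show "real_cond_exp M (F i) (Y i) \<in> borel_measurable (F n)"
      by (rule measurable_from_subalg) simp
  qed
  have "AE \<omega> in M. \<forall>i\<in>{1..n}. real_cond_exp M (F i) (Y i) \<omega> = Y i \<omega>"
    by (rule AE_finite_allI) (use YF in auto)
  then have SY: "AE \<omega> in M. S \<omega> = (\<Sum>i=1..n. Y i \<omega>)"
    by (rule eventually_mono) (simp add: S_def)
  have nn: "(\<Sum>i=1..n. (b i)\<^sup>2) \<ge> 0" by (intro sum_nonneg) auto
  have "Lp_norm M p S = Lp_norm M p (\<lambda>\<omega>. \<Sum>i=1..n. Y i \<omega>)"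
    by (rule Lp_norm_cong_AE[OF p0]) (use SY in \<open>auto elim!: eventually_mono\<close>)
  then have "Lp_norm M p (\<lambda>\<omega>. S \<omega> + Y (Suc n) \<omega>)
      \<le> ennreal (sqrt ((sqrt (5 * p * (\<Sum>i=1..n. (b i)\<^sup>2)))\<^sup>2 + 5 * p * (b (Suc n))\<^sup>2))"
    using Suc.IH p nn by (intro Lp_norm_martingale_step[OF M sub p S _ Y0 _ b _ Yb]) auto
  also have "(sqrt (5 * p * (\<Sum>i=1..n. (b i)\<^sup>2)))\<^sup>2 + 5 * p * (b (Suc n))\<^sup>2 = 5 * p * (\<Sum>i=1..Suc n. (b i)\<^sup>2)"
    using p nn by (simp add: distrib_left)
  finally have "Lp_norm M p (\<lambda>\<omega>. S \<omega> + Y (Suc n) \<omega>) \<le> ennreal (sqrt (5 * p * (\<Sum>i=1..Suc n. (b i)\<^sup>2)))" .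
  moreover have "Lp_norm M p (\<lambda>\<omega>. S \<omega> + Y (Suc n) \<omega>) = Lp_norm M p (\<lambda>\<omega>. \<Sum>i=1..Suc n. Y i \<omega>)"
    by (rule Lp_norm_cong_AE[OF p0]) (use SY in \<open>auto elim!: eventually_mono\<close>)
  ultimately show ?case by simp
qed

section \<open>Integral representation of positive functionals\<close>

lemma bounded_continuous_functions_iff:
  "f \<in> bounded_continuous_functions T \<longleftrightarrow>
    continuous_map T euclideanreal f \<and> (\<exists>K>0. \<forall>x\<in>topspace T. \<bar>f x\<bar> \<le> K)"
  by (auto simp: bounded_continuous_functions_def bounded_pos)

lemma BC_bound:
  assumes "f \<in> bounded_continuous_functions T"
  obtains K where "K > 0" "\<And>x. x \<in> topspace T \<Longrightarrow> \<bar>f x\<bar> \<le> K"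
  using assms by (auto simp: bounded_continuous_functions_iff)

lemma BC_dominated:
  assumes "continuous_map T euclideanreal h" "f \<in> bounded_continuous_functions T" "g \<in> bounded_continuous_functions T"
    and "\<And>x. x \<in> topspace T \<Longrightarrow> \<bar>h x\<bar> \<le> \<bar>f x\<bar> + \<bar>g x\<bar>"
  shows "h \<in> bounded_continuous_functions T"
proof -
  obtain K where K: "K > 0" "\<And>x. x \<in> topspace T \<Longrightarrow> \<bar>f x\<bar> \<le> K" using BC_bound[OF assms(2)] by metis
  obtain L where L: "L > 0" "\<And>x. x \<in> topspace T \<Longrightarrow> \<bar>g x\<bar> \<le> L" using BC_bound[OF assms(3)] by metis
  have "\<bar>h x\<bar> \<le> K + L" if "x \<in> topspace T" for x
    using K(2)[OF that] L(2)[OF that] assms(4)[OF that] by linarith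
  then show ?thesis using assms(1) K L by (auto simp: bounded_continuous_functions_iff intro!: exI[of _ "K + L"])
qed

lemma BC_const: "(\<lambda>_. c) \<in> bounded_continuous_functions T"
  by (auto simp: bounded_continuous_functions_iff intro!: exI[of _ "\<bar>c\<bar> + 1"])

lemma BC_add:
  "f \<in> bounded_continuous_functions T \<Longrightarrow> g \<in> bounded_continuous_functions T \<Longrightarrow>
    (\<lambda>x. f x + g x) \<in> bounded_continuous_functions T"
  by (rule BC_dominated[of _ _ f g]) (auto simp: bounded_continuous_functions_iff intro!: continuous_intros)

lemma BC_diff:
  "f \<in> bounded_continuous_functions T \<Longrightarrow> g \<in> bounded_continuous_functions T \<Longrightarrow>
    (\<lambda>x. f x - g x) \<in> bounded_continuous_functions T"
  by (rule BC_dominated[of _ _ f g]) (auto simp: bounded_continuous_functions_iff intro!: continuous_intros)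

lemma BC_max:
  "f \<in> bounded_continuous_functions T \<Longrightarrow> g \<in> bounded_continuous_functions T \<Longrightarrow>
    (\<lambda>x. max (f x) (g x)) \<in> bounded_continuous_functions T"
  by (rule BC_dominated[of _ _ f g]) (auto simp: bounded_continuous_functions_iff intro!: continuous_intros)

lemma BC_min:
  "f \<in> bounded_continuous_functions T \<Longrightarrow> g \<in> bounded_continuous_functions T \<Longrightarrow>
    (\<lambda>x. min (f x) (g x)) \<in> bounded_continuous_functions T"
  by (rule BC_dominated[of _ _ f g]) (auto simp: bounded_continuous_functions_iff intro!: continuous_intros)

lemma BC_cmult:
  assumes "f \<in> bounded_continuous_functions T"
  shows "(\<lambda>x. c * f x) \<in> bounded_continuous_functions T"
proof -
  obtain K where K: "K > 0" "\<And>x. x \<in> topspace T \<Longrightarrow> \<bar>f x\<bar> \<le> K" using BC_bound[OF assms] by metis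
  have "\<bar>c * f x\<bar> \<le> \<bar>\<bar>c\<bar> * K\<bar> + \<bar>0\<bar>" if "x \<in> topspace T" for x
    using K(1) K(2)[OF that] by (simp add: abs_mult mult_left_mono)
  moreover have "continuous_map T euclideanreal (\<lambda>x. c * f x)"
    using assms by (intro continuous_map_real_mult_left) (simp add: bounded_continuous_functions_iff)
  ultimately show ?thesis by (intro BC_dominated[OF _ BC_const BC_const])
qed

lemma BC_sum:
  "(\<And>i. i \<in> A \<Longrightarrow> f i \<in> bounded_continuous_functions T) \<Longrightarrow> (\<lambda>x. \<Sum>i\<in>A. f i x) \<in> bounded_continuous_functions T"
  by (induction A rule: infinite_finite_induct) (auto intro: BC_const BC_add)

lemmas BC_intros = BC_const BC_add BC_diff BC_max BC_min BC_cmult BC_sum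

lemma BC_cong:
  assumes "f \<in> bounded_continuous_functions T" "\<And>x. x \<in> topspace T \<Longrightarrow> f x = g x"
  shows "g \<in> bounded_continuous_functions T"
  using assms continuous_map_eq[of T euclideanreal f g] unfolding bounded_continuous_functions_iff by force

lemma space_borel_of [simp]: "space (borel_of T) = topspace T"
  unfolding borel_of_def by (rule space_measure_of) (auto dest: openin_subset)

lemma sets_borel_of: "sets (borel_of T) = sigma_sets (topspace T) {U. openin T U}"
  unfolding borel_of_def by (rule sets_measure_of) (auto dest: openin_subset)

lemma openin_sets_borel_of [intro]: "openin T U \<Longrightarrow> U \<in> sets (borel_of T)"
  by (auto simp: sets_borel_of)

lemma continuous_map_borel_measurable:
  assumes "continuous_map T euclideanreal f"
  shows "f \<in> borel_measurable (borel_of T)"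
proof (rule borel_measurableI)
  fix S :: "real set" assume "open S"
  then have "openin T {x \<in> topspace T. f x \<in> S}"
    using assms by (intro openin_continuous_map_preimage[of T euclideanreal]) auto
  also have "{x \<in> topspace T. f x \<in> S} = f -` S \<inter> space (borel_of T)" by auto
  finally show "f -` S \<inter> space (borel_of T) \<in> sets (borel_of T)" by blast
qed

lemma borel_prob_measuresD:
  assumes "\<mu> \<in> borel_prob_measures T"
  shows "prob_space \<mu>" "sets \<mu> = sets (borel_of T)" "space \<mu> = topspace T"
    "f \<in> bounded_continuous_functions T \<Longrightarrow> f \<in> borel_measurable \<mu>"
    "f \<in> bounded_continuous_functions T \<Longrightarrow> integrable \<mu> f"
proof -
  show 1: "prob_space \<mu>" and 2: "sets \<mu> = sets (borel_of T)"
    using assms by (auto simp: borel_prob_measures_def)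
  show 3: "space \<mu> = topspace T" using sets_eq_imp_space_eq[OF 2] by simp
  assume f: "f \<in> bounded_continuous_functions T"
  then show 4: "f \<in> borel_measurable \<mu>"
    using continuous_map_borel_measurable[of T f] measurable_cong_sets[OF 2 refl]
    by (auto simp: bounded_continuous_functions_iff)
  interpret prob_space \<mu> by fact
  obtain K where "K > 0" "\<And>x. x \<in> topspace T \<Longrightarrow> \<bar>f x\<bar> \<le> K" using BC_bound[OF f] by metis
  then show "integrable \<mu> f" using 4 3 by (intro integrable_const_bound[of _ K]) auto
qed

text \<open>A nonnegative number as the sum of its layers of unit height; used to compare an integral
  with the measures of level sets.\<close>

lemma sum_unit_layers:
  fixes y :: real
  assumes "y \<ge> 0"
  shows "(\<Sum>j<n. min (max (y - real j) 0) 1) = min y (real n)"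
  using assms by (induction n) (auto simp: min_def max_def)

text \<open>The truncated distance to the complement is positive exactly on the open set. Hence the Borel
  sets of a metrizable space are generated by the positivity sets of bounded continuous functions.\<close>

lemma metrizable_open_eq_positivity_set:
  assumes T: "metrizable_space T" and U: "openin T U"
  shows "\<exists>f \<in> bounded_continuous_functions T. (\<forall>x. 0 \<le> f x) \<and> U = {x \<in> topspace T. 0 < f x}"
proof -
  obtain S d where ms: "Metric_space S d" and TS: "T = Metric_space.mtopology S d"
    using T unfolding metrizable_space_def by blast
  interpret Metric_space S d by fact
  have US: "U \<subseteq> S" using openin_subset[OF U] TS by simp
  show ?thesis
  proof (cases "U = S")
    case True
    then show ?thesis using TS by (intro bexI[of _ "\<lambda>_. 1"] BC_const) auto
  next
    case False
    then have ne: "S - U \<noteq> {}" using US by blast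
    define r where "r x = (INF y\<in>S - U. d x y)" for x
    have bb: "bdd_below (d x ` (S - U))" for x by (auto intro!: bdd_belowI[of _ 0])
    have r0: "r x \<ge> 0" for x unfolding r_def using ne by (intro cINF_greatest) auto
    have lip: "r x \<le> d x z + r z" if "x \<in> S" "z \<in> S" for x z
    proof -
      have "r x - d x z \<le> r z" unfolding r_def[of z]
      proof (intro cINF_greatest ne)
        fix y assume y: "y \<in> S - U"
        have "r x \<le> d x y" unfolding r_def by (rule cINF_lower[OF bb y])
        also have "\<dots> \<le> d x z + d z y" using that y by (intro triangle) auto
        finally show "r x - d x z \<le> d z y" by simp
      qed
      then show ?thesis by simp
    qed
    have cont: "continuous_map mtopology euclideanreal r"
      unfolding mtopology_is_euclidean[symmetric] metric_continuous_map[OF Met_TC.Metric_space_axioms]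
    proof (intro conjI ballI allI impI)
      show "r ` S \<subseteq> UNIV" by simp
    next
      fix a :: 'a and e :: real assume a: "a \<in> S" and e: "0 < e"
      show "\<exists>\<delta>>0. \<forall>x. x \<in> S \<and> d a x < \<delta> \<longrightarrow> dist (r a) (r x) < e"
      proof (intro exI conjI allI impI)
        fix x assume x: "x \<in> S \<and> d a x < e"
        then show "dist (r a) (r x) < e"
          using lip[of a x] lip[of x a] a commute[of a x] by (auto simp: dist_real_def)
      qed fact
    qed
    have pos: "x \<in> U \<longleftrightarrow> 0 < r x" if x: "x \<in> S" for x
    proof
      assume xU: "x \<in> U"
      then obtain e where e: "e > 0" "mball x e \<subseteq> U" using U TS openin_mtopology by metis
      have "e \<le> r x" unfolding r_def
      proof (intro cINF_greatest ne)
        fix y assume "y \<in> S - U"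
        then have "y \<notin> mball x e" using e by blast
        then show "e \<le> d x y" using \<open>y \<in> S - U\<close> x by auto
      qed
      then show "0 < r x" using e by simp
    next
      assume "0 < r x"
      show "x \<in> U"
      proof (rule ccontr)
        assume "x \<notin> U"
        then have "r x \<le> d x x" unfolding r_def using x by (intro cINF_lower[OF bb]) auto
        then show False using \<open>0 < r x\<close> x by simp
      qed
    qed
    have "(\<lambda>x. min (r x) 1) \<in> bounded_continuous_functions T"
      unfolding bounded_continuous_functions_iff TS using r0
      by (auto intro!: continuous_intros cont exI[of _ 1])
    then show ?thesis using r0 pos US TS
      by (intro bexI[of _ "\<lambda>x. min (r x) 1"]) auto
  qed
qed

text \<open>Positive normalized linear functionals on the bounded continuous functions that are continuous
  along sequences decreasing pointwise to zero. The aim is to show that they are integrals. The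
  construction follows Kindler: instead of extending the functional through several function classes,
  it defines a premeasure on the regions between the graphs of two functions.\<close>

locale daniell_functional =
  fixes T :: "'c topology" and L :: "('c \<Rightarrow> real) \<Rightarrow> real"
  assumes metrizable: "metrizable_space T"
    and add: "\<And>f g. f \<in> bounded_continuous_functions T \<Longrightarrow> g \<in> bounded_continuous_functions T \<Longrightarrow>
          L (\<lambda>x. f x + g x) = L f + L g"
    and cmult: "\<And>f c. f \<in> bounded_continuous_functions T \<Longrightarrow> L (\<lambda>x. c * f x) = c * L f"
    and nonneg: "\<And>f. f \<in> bounded_continuous_functions T \<Longrightarrow> (\<And>x. x \<in> topspace T \<Longrightarrow> 0 \<le> f x) \<Longrightarrow> 0 \<le> L f"
    and one: "L (\<lambda>_. 1) = 1"
    and daniell: "\<And>h :: nat \<Rightarrow> 'c \<Rightarrow> real. (\<And>n. h n \<in> bounded_continuous_functions T) \<Longrightarrow>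
          (\<And>x. x \<in> topspace T \<Longrightarrow> decseq (\<lambda>n. h n x)) \<Longrightarrow>
          (\<And>x. x \<in> topspace T \<Longrightarrow> (\<lambda>n. h n x) \<longlonglongrightarrow> 0) \<Longrightarrow> (\<lambda>n. L (h n)) \<longlonglongrightarrow> 0"
begin

abbreviation "BC \<equiv> bounded_continuous_functions T"

lemma diff: "f \<in> BC \<Longrightarrow> g \<in> BC \<Longrightarrow> L (\<lambda>x. f x - g x) = L f - L g"
  using add[of f "\<lambda>x. - 1 * g x"] cmult[of g "-1"] BC_cmult[of g T "-1"] by simp

lemma mono: "f \<in> BC \<Longrightarrow> g \<in> BC \<Longrightarrow> (\<And>x. x \<in> topspace T \<Longrightarrow> f x \<le> g x) \<Longrightarrow> L f \<le> L g"
  using nonneg[of "\<lambda>x. g x - f x"] diff[of g f] BC_diff[of g T f] by auto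

lemma cong: "f \<in> BC \<Longrightarrow> (\<And>x. x \<in> topspace T \<Longrightarrow> f x = g x) \<Longrightarrow> L f = L g"
  using mono[of f g] mono[of g f] BC_cong[of f T g] by (intro antisym) auto

lemma sum: "(\<And>i. i \<in> A \<Longrightarrow> f i \<in> BC) \<Longrightarrow> L (\<lambda>x. \<Sum>i\<in>A. f i x) = (\<Sum>i\<in>A. L (f i))"
proof (induction A rule: infinite_finite_induct)
  case (insert i A)
  then show ?case using add[of "f i" "\<lambda>x. \<Sum>i\<in>A. f i x"] BC_sum[of A f T] by auto
qed (use cmult[of "\<lambda>_. 1" 0] BC_const in auto)

definition region :: "('c \<Rightarrow> real) \<Rightarrow> ('c \<Rightarrow> real) \<Rightarrow> ('c \<times> real) set" where
  "region f g = {(x, t). x \<in> topspace T \<and> f x \<le> t \<and> t < g x}"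

definition regions :: "('c \<times> real) set set" where
  "regions = {region f g | f g. f \<in> BC \<and> g \<in> BC}"

text \<open>The length of the vertical section of a set, as a function of the base point. Defining the
  value of a region as the functional applied to this function makes the value depend on the region
  alone, whichever functions bound it.\<close>

definition len :: "('c \<times> real) set \<Rightarrow> 'c \<Rightarrow> real" where
  "len A x = measure lborel (Pair x -` A)"

lemma vimage_region: "Pair x -` region f g = (if x \<in> topspace T then {f x..<g x} else {})"
  by (auto simp: region_def)

lemma len_region: "x \<in> topspace T \<Longrightarrow> len (region f g) x = max 0 (g x - f x)"
  by (auto simp: len_def vimage_region measure_def max_def)

lemma len_BC: "A \<in> regions \<Longrightarrow> len A \<in> BC"
proof -
  assume "A \<in> regions"
  then obtain f g where "A = region f g" "f \<in> BC" "g \<in> BC" by (auto simp: regions_def)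
  moreover from this have "(\<lambda>x. max 0 (g x - f x)) \<in> BC" by (intro BC_intros)
  ultimately show ?thesis using BC_cong[of "\<lambda>x. max 0 (g x - f x)" T] by (simp add: len_region)
qed

lemma regionsI: "f \<in> BC \<Longrightarrow> g \<in> BC \<Longrightarrow> region f g \<in> regions"
  by (auto simp: regions_def)

lemma regions_subset: "regions \<subseteq> Pow (topspace T \<times> UNIV)"
  by (auto simp: regions_def region_def)

lemma semiring_regions: "semiring_of_sets (topspace T \<times> UNIV) regions"
proof
  show "regions \<subseteq> Pow (topspace T \<times> UNIV)" by (rule regions_subset)
  have "region (\<lambda>_. 0) (\<lambda>_. 0) = {}" by (auto simp: region_def)
  then show "{} \<in> regions" using regionsI[OF BC_const BC_const] by metis
  fix A B assume "A \<in> regions" "B \<in> regions"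
  then obtain f g f' g' where A: "A = region f g" and B: "B = region f' g'"
    and bc: "f \<in> BC" "g \<in> BC" "f' \<in> BC" "g' \<in> BC"
    by (auto simp: regions_def)
  have "A \<inter> B = region (\<lambda>x. max (f x) (f' x)) (\<lambda>x. min (g x) (g' x))"
    by (auto simp: A B region_def)
  then show "A \<inter> B \<in> regions" by (auto intro!: regionsI BC_intros bc)
  let ?C = "region f (\<lambda>x. min (g x) (f' x))" and ?D = "region (\<lambda>x. max (f x) (max (g' x) (f' x))) g"
  have "A - B = \<Union>{?C, ?D}" by (auto simp: A B region_def)
  moreover have "?C \<inter> ?D = {}" by (auto simp: region_def)
  ultimately show "\<exists>C\<subseteq>regions. finite C \<and> disjoint C \<and> A - B = \<Union>C"
    by (intro exI[of _ "{?C, ?D}"]) (auto intro!: regionsI BC_intros bc simp: disjoint_def)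
qed

text \<open>Lengths of sections are countably additive, and the remainders of the resulting series of
  bounded continuous functions decrease to zero; so the Daniell property turns into
  countable additivity.\<close>

lemma countably_additive_len: "countably_additive regions (\<lambda>A. ennreal (L (len A)))"
proof (rule countably_additiveI)
  fix A :: "nat \<Rightarrow> ('c \<times> real) set"
  assume A: "range A \<subseteq> regions" "disjoint_family A" "(\<Union>i. A i) \<in> regions"
  define h where "h N x = len (\<Union>i. A i) x - (\<Sum>i<N. len (A i) x)" for N x
  have lenA: "len (A i) \<in> BC" for i using A by (auto intro: len_BC)
  have lenU: "len (\<Union>i. A i) \<in> BC" using A by (auto intro: len_BC)
  have lenA0: "len (A i) x \<ge> 0" for i x by (simp add: len_def)
  have "(\<lambda>N. L (h N)) \<longlonglongrightarrow> 0"
  proof (rule daniell)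
    show "h N \<in> BC" for N unfolding h_def by (intro BC_intros lenA lenU)
    fix x assume x: "x \<in> topspace T"
    show "decseq (\<lambda>n. h n x)" unfolding decseq_Suc_iff h_def using lenA0 by auto
    have "(\<lambda>i. measure lborel (Pair x -` A i)) sums measure lborel (\<Union>i. Pair x -` A i)"
    proof (rule measure_UNION)
      have "Pair x -` A i \<in> sets lborel" for i
      proof -
        have "A i \<in> regions" using A by auto
        then show ?thesis using x by (auto simp: regions_def vimage_region)
      qed
      then show "range (\<lambda>i. Pair x -` A i) \<subseteq> sets lborel" by auto
      show "disjoint_family (\<lambda>i. Pair x -` A i)"
        using A(2) by (auto simp: disjoint_family_on_def)
      obtain f g where "(\<Union>i. A i) = region f g" using A(3) by (auto simp: regions_def)
      then have "(\<Union>i. Pair x -` A i) = {f x..<g x}" using x vimage_region[of x f g] by (simp add: vimage_UN[symmetric])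
      then show "emeasure lborel (\<Union>i. Pair x -` A i) \<noteq> \<infinity>"
        by (cases "f x \<le> g x") auto
    qed
    then have "(\<lambda>i. len (A i) x) sums len (\<Union>i. A i) x" by (simp add: len_def vimage_UN)
    then have "(\<lambda>N. len (\<Union>i. A i) x - (\<Sum>i<N. len (A i) x)) \<longlonglongrightarrow> len (\<Union>i. A i) x - len (\<Union>i. A i) x"
      unfolding sums_def by (intro tendsto_intros)
    then show "(\<lambda>N. h N x) \<longlonglongrightarrow> 0" by (simp add: h_def)
  qed
  moreover have "L (h N) = L (len (\<Union>i. A i)) - (\<Sum>i<N. L (len (A i)))" for N
    unfolding h_def using lenA lenU by (subst diff) (auto simp: sum intro: BC_sum)
  ultimately have "(\<lambda>N. L (len (\<Union>i. A i)) - (L (len (\<Union>i. A i)) - (\<Sum>i<N. L (len (A i))))) \<longlonglongrightarrow> L (len (\<Union>i. A i)) - 0"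
    by (intro tendsto_diff tendsto_const) simp
  then have "(\<lambda>i. L (len (A i))) sums L (len (\<Union>i. A i))" by (simp add: sums_def)
  moreover have "L (len (A i)) \<ge> 0" for i using lenA lenA0 by (auto intro: nonneg)
  ultimately show "(\<Sum>i. ennreal (L (len (A i)))) = ennreal (L (len (\<Union>i. A i)))"
    by (intro suminf_ennreal_eq) auto
qed

lemma len_measure_extension:
  "\<exists>N. space N = topspace T \<times> UNIV \<and> regions \<subseteq> sets N \<and> (\<forall>A\<in>regions. emeasure N A = ennreal (L (len A)))"
proof -
  interpret semiring_of_sets "topspace T \<times> UNIV" regions by (rule semiring_regions)
  have "L (len {}) = 0" using cmult[of "\<lambda>_. 1" 0] BC_const by (auto simp: len_def[abs_def])
  then have "positive regions (\<lambda>A. ennreal (L (len A)))" by (simp add: positive_def)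
  from caratheodory[OF this countably_additive_len] obtain \<nu> where \<nu>: "\<forall>A\<in>regions. \<nu> A = ennreal (L (len A))"
    and ms: "measure_space (topspace T \<times> UNIV) (sigma_sets (topspace T \<times> UNIV) regions) \<nu>" by blast
  let ?N = "measure_of (topspace T \<times> UNIV) regions \<nu>"
  have "emeasure ?N A = \<nu> A" if "A \<in> regions" for A
    using that ms by (subst emeasure_measure_of_conv) auto
  then show ?thesis using \<nu> regions_subset
    by (intro exI[of _ ?N]) (auto simp: space_measure_of sets_measure_of)
qed

text \<open>The representing measure of a set \<open>U\<close> is the value of the cylinder over \<open>U\<close> of height one.
  The region below the graph of \<open>g\<close>, whose value is \<open>L g\<close>, lies between the cylinders over
  \<open>{g \<ge> 1}\<close> and \<open>{g > 0}\<close>.\<close>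

lemma sandwich_measure:
  "\<exists>\<mu>\<in>borel_prob_measures T. \<forall>g\<in>BC. (\<forall>x\<in>topspace T. 0 \<le> g x \<and> g x \<le> 1) \<longrightarrow>
     measure \<mu> {x\<in>topspace T. 1 \<le> g x} \<le> L g \<and> L g \<le> measure \<mu> {x\<in>topspace T. 0 < g x}"
proof -
  obtain N where spN: "space N = topspace T \<times> UNIV" and rN: "regions \<subseteq> sets N"
    and eN: "\<And>A. A \<in> regions \<Longrightarrow> emeasure N A = ennreal (L (len A))"
    using len_measure_extension by auto
  let ?R = "region (\<lambda>_. 0) (\<lambda>_. 1)"
  have R: "?R \<in> regions" by (intro regionsI BC_const)
  then have RN: "?R \<in> sets N" using rN by auto
  have fst: "fst \<in> measurable N (borel_of T)"
    unfolding borel_of_def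
  proof (rule measurable_measure_of)
    fix U assume "U \<in> {U. openin T U}"
    then obtain f where f: "f \<in> BC" "\<And>x. 0 \<le> f x" "U = {x \<in> topspace T. 0 < f x}"
      using metrizable_open_eq_positivity_set[OF metrizable, of U] by auto
    have "fst -` U \<inter> space N = (\<Union>m::nat. region (\<lambda>x. (- real m) * f x) (\<lambda>x. real m * f x))"
    proof (intro set_eqI iffI)
      fix z assume "z \<in> fst -` U \<inter> space N"
      then obtain x t where z: "z = (x, t)" "x \<in> topspace T" "0 < f x" using f spN by (cases z) auto
      obtain m where m: "\<bar>t\<bar> / f x < real m" using reals_Archimedean2 by blast
      then have "\<bar>t\<bar> < real m * f x" using z by (simp add: pos_divide_less_eq)
      then show "z \<in> (\<Union>m::nat. region (\<lambda>x. (- real m) * f x) (\<lambda>x. real m * f x))"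
        using z by (intro UN_I[of m]) (auto simp: region_def)
    next
      fix z assume "z \<in> (\<Union>m::nat. region (\<lambda>x. (- real m) * f x) (\<lambda>x. real m * f x))"
      then obtain m :: nat and x t where z: "z = (x, t)" "x \<in> topspace T" "- real m * f x \<le> t" "t < real m * f x"
        by (auto simp: region_def)
      then have "0 < f x" using f(2)[of x] by (cases "f x = 0") auto
      then show "z \<in> fst -` U \<inter> space N" using z f spN by auto
    qed
    also have "\<dots> \<in> sets N"
    proof (intro sets.countable_UN image_subsetI subsetD[OF rN] regionsI)
      show "(\<lambda>x. (- real m) * f x) \<in> BC" "(\<lambda>x. real m * f x) \<in> BC" for m
        by (intro BC_cmult f(1))+
    qed
    finally show "fst -` U \<inter> space N \<in> sets N" .
  qed (auto simp: spN dest: openin_subset)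
  define \<mu> where "\<mu> = distr (density N (indicator ?R)) (borel_of T) fst"
  have e\<mu>: "emeasure \<mu> B = emeasure N ((fst -` B \<inter> space N) \<inter> ?R)" if B: "B \<in> sets (borel_of T)" for B
  proof -
    have fB: "fst -` B \<inter> space N \<in> sets N" using measurable_sets[OF fst B] .
    have "emeasure \<mu> B = emeasure (density N (indicator ?R)) (fst -` B \<inter> space N)"
      unfolding \<mu>_def using B fst by (subst emeasure_distr) auto
    also have "\<dots> = (\<integral>\<^sup>+x. indicator ?R x * indicator (fst -` B \<inter> space N) x \<partial>N)"
      using fB RN by (subst emeasure_density) auto
    also have "\<dots> = (\<integral>\<^sup>+x. indicator ((fst -` B \<inter> space N) \<inter> ?R) x \<partial>N)"
      by (intro nn_integral_cong) (auto simp: indicator_def)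
    also have "\<dots> = emeasure N ((fst -` B \<inter> space N) \<inter> ?R)" using fB RN by simp
    finally show ?thesis .
  qed
  have sets\<mu>: "sets \<mu> = sets (borel_of T)" by (simp add: \<mu>_def)
  have "emeasure \<mu> (topspace T) = emeasure N ?R"
    by (subst e\<mu>) (auto simp: spN region_def intro!: arg_cong[of _ _ "emeasure N"])
  also have "\<dots> = 1"
    unfolding eN[OF R] by (subst cong[of "\<lambda>_. 1", symmetric]) (auto simp: len_region one intro: BC_const)
  finally have prob: "prob_space \<mu>" by (intro prob_spaceI) (simp add: \<mu>_def)
  interpret \<mu>: prob_space \<mu> by (rule prob)
  show ?thesis
  proof (intro bexI[of _ \<mu>] ballI impI)
    show "\<mu> \<in> borel_prob_measures T" using prob sets\<mu> by (simp add: borel_prob_measures_def)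
    fix g assume g: "g \<in> BC" and g01: "\<forall>x\<in>topspace T. 0 \<le> g x \<and> g x \<le> 1"
    have gm: "g \<in> borel_measurable (borel_of T)"
      using g by (intro continuous_map_borel_measurable) (simp add: bounded_continuous_functions_iff)
    have s1: "{x\<in>topspace T. 1 \<le> g x} \<in> sets (borel_of T)" "{x\<in>topspace T. 0 < g x} \<in> sets (borel_of T)"
      using gm by (simp_all flip: space_borel_of)
    let ?G = "region (\<lambda>_. 0) g"
    have G: "?G \<in> regions" by (intro regionsI BC_const g)
    have Lg: "L (len ?G) = L g" using g g01 by (intro cong[symmetric]) (auto simp: len_region)
    have Lg0: "0 \<le> L g" using g g01 by (intro nonneg) auto
    have "emeasure \<mu> {x\<in>topspace T. 1 \<le> g x} \<le> emeasure N ?G"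
      using G rN s1(1) by (subst e\<mu>) (auto intro!: emeasure_mono simp: region_def)
    then show "measure \<mu> {x\<in>topspace T. 1 \<le> g x} \<le> L g \<and> L g \<le> measure \<mu> {x\<in>topspace T. 0 < g x}"
    proof (intro conjI)
      assume "emeasure \<mu> {x\<in>topspace T. 1 \<le> g x} \<le> emeasure N ?G"
      then show "measure \<mu> {x\<in>topspace T. 1 \<le> g x} \<le> L g"
        using Lg0 by (simp add: eN[OF G] Lg \<mu>.emeasure_eq_measure)
      have "emeasure N ?G \<le> emeasure \<mu> {x\<in>topspace T. 0 < g x}"
      proof (subst e\<mu>[OF s1(2)], rule emeasure_mono)
        show "?G \<subseteq> (fst -` {x\<in>topspace T. 0 < g x} \<inter> space N) \<inter> ?R"
          using g01 by (force simp: region_def spN)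
      qed (use RN measurable_sets[OF fst s1(2)] in auto)
      then show "L g \<le> measure \<mu> {x\<in>topspace T. 0 < g x}"
        using Lg0 by (simp add: eN[OF G] Lg \<mu>.emeasure_eq_measure)
    qed
  qed
qed

text \<open>The sandwich applied to the layers of \<open>n f\<close>, for \<open>f\<close> with values in the unit interval: the errors
  telescope to at most \<open>1\<close>, so functional and integral differ by at most \<open>1 / n\<close> on \<open>f\<close>.\<close>

theorem representation: "\<exists>\<mu>\<in>borel_prob_measures T. \<forall>f\<in>BC. (\<integral>x. f x \<partial>\<mu>) = L f"
proof -
  obtain \<mu> where \<mu>: "\<mu> \<in> borel_prob_measures T"
    and sw: "\<And>g. g \<in> BC \<Longrightarrow> (\<And>x. x \<in> topspace T \<Longrightarrow> 0 \<le> g x \<and> g x \<le> 1) \<Longrightarrow>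
      measure \<mu> {x\<in>topspace T. 1 \<le> g x} \<le> L g \<and> L g \<le> measure \<mu> {x\<in>topspace T. 0 < g x}"
    using sandwich_measure by blast
  interpret prob_space \<mu> by (rule borel_prob_measuresD[OF \<mu>])
  note sp = borel_prob_measuresD(3)[OF \<mu>]
  note int = borel_prob_measuresD(5)[OF \<mu>]
  note meas = borel_prob_measuresD(4)[OF \<mu>]
  have unit: "(\<integral>x. f x \<partial>\<mu>) = L f" if f: "f \<in> BC" and f01: "\<And>x. x \<in> topspace T \<Longrightarrow> 0 \<le> f x \<and> f x \<le> 1" for f
  proof -
    have bound: "real n * \<bar>L f - (\<integral>x. f x \<partial>\<mu>)\<bar> \<le> 1" for n :: nat
    proof -
      define g where "g j x = min (max (real n * f x - real j) 0) 1" for j :: nat and x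
      define e where "e j = measure \<mu> {x\<in>topspace T. real j \<le> real n * f x}" for j :: nat
      have gBC: "g j \<in> BC" for j unfolding g_def by (intro BC_intros f)
      have g01: "0 \<le> g j x \<and> g j x \<le> 1" for j x by (auto simp: g_def)
      have [measurable]: "f \<in> borel_measurable \<mu>" by (rule meas[OF f])
      have gsum: "(\<Sum>j<n. g j x) = real n * f x" if "x \<in> topspace T" for x
        unfolding g_def using f01[OF that] mult_left_le[of "f x" "real n"]
          by (subst sum_unit_layers) (auto simp: mult_le_cancel_left1 min_def)
      have m1: "{x\<in>topspace T. real j \<le> real n * f x} \<in> sets \<mu>" for j unfolding sp[symmetric] by measurable
      have m2: "{x\<in>topspace T. 0 < g j x} \<in> sets \<mu>" for j unfolding sp[symmetric] g_def by measurable
      have up: "measure \<mu> {x\<in>topspace T. 0 < g j x} \<le> e j" for j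
        unfolding e_def by (rule finite_measure_mono) (auto simp: g_def m1)
      have lo: "measure \<mu> {x\<in>topspace T. 1 \<le> g j x} = e (Suc j)" for j
        unfolding e_def by (rule arg_cong[of _ _ "measure \<mu>"]) (auto simp: g_def)
      have I: "integrable \<mu> (indicator A :: 'c \<Rightarrow> real)" if "A \<in> sets \<mu>" for A
        using that emeasure_finite by (intro integrable_real_indicator) (auto simp: less_top[symmetric])
      have d: "\<bar>L (g j) - (\<integral>x. g j x \<partial>\<mu>)\<bar> \<le> e j - e (Suc j)" for j
      proof -
        have "e (Suc j) \<le> L (g j)" "L (g j) \<le> e j"
          using sw[OF gBC g01, of j] up[of j] lo[of j] by auto
        moreover have "e (Suc j) \<le> (\<integral>x. g j x \<partial>\<mu>)"
        proof -
          have "e (Suc j) = (\<integral>x. indicator {x\<in>topspace T. real (Suc j) \<le> real n * f x} x \<partial>\<mu>)"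
            unfolding e_def using m1[of "Suc j"] by simp
          also have "\<dots> \<le> (\<integral>x. g j x \<partial>\<mu>)"
            by (rule integral_mono[OF I[OF m1] int[OF gBC]]) (auto simp: g_def indicator_def)
          finally show ?thesis .
        qed
        moreover have "(\<integral>x. g j x \<partial>\<mu>) \<le> e j"
        proof -
          have "(\<integral>x. g j x \<partial>\<mu>) \<le> (\<integral>x. indicator {x\<in>topspace T. 0 < g j x} x \<partial>\<mu>)"
            using g01 sp by (intro integral_mono[OF int[OF gBC] I[OF m2]]) (auto simp: indicator_def not_less)
          also have "\<dots> = measure \<mu> {x\<in>topspace T. 0 < g j x}" using m2[of j] by simp
          finally show ?thesis using up[of j] by simp
        qed
        ultimately show ?thesis by linarith
      qed
      have "real n * L f = L (\<lambda>x. real n * f x)" using cmult[OF f] by simp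
      also have "\<dots> = L (\<lambda>x. \<Sum>j<n. g j x)" by (rule cong[symmetric]) (use gsum gBC in \<open>auto intro!: BC_sum\<close>)
      also have "\<dots> = (\<Sum>j<n. L (g j))" using gBC by (intro sum) auto
      finally have a: "real n * L f = (\<Sum>j<n. L (g j))" .
      have "real n * (\<integral>x. f x \<partial>\<mu>) = (\<integral>x. (\<Sum>j<n. g j x) \<partial>\<mu>)"
        using gsum sp by (subst integral_mult_right_zero[symmetric], intro Bochner_Integration.integral_cong) auto
      also have "\<dots> = (\<Sum>j<n. \<integral>x. g j x \<partial>\<mu>)" using int[OF gBC] by (intro Bochner_Integration.integral_sum)
      finally have b: "real n * (\<integral>x. f x \<partial>\<mu>) = (\<Sum>j<n. \<integral>x. g j x \<partial>\<mu>)" .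
      have "real n * \<bar>L f - (\<integral>x. f x \<partial>\<mu>)\<bar> = \<bar>real n * L f - real n * (\<integral>x. f x \<partial>\<mu>)\<bar>"
        by (simp add: abs_mult flip: right_diff_distrib)
      also have "\<dots> = \<bar>\<Sum>j<n. L (g j) - (\<integral>x. g j x \<partial>\<mu>)\<bar>"
        unfolding a b by (simp add: sum_subtractf)
      also have "\<dots> \<le> (\<Sum>j<n. e j - e (Suc j))" by (rule order_trans[OF sum_abs sum_mono[OF d]])
      also have "\<dots> = e 0 - e n" by (rule sum_lessThan_telescope')
      also have "\<dots> \<le> 1" using prob_le_1 by (simp add: e_def)
           (metis (no_types, lifting) diff_ge_0_iff_ge diff_left_mono diff_zero dual_order.trans measure_nonneg prob_le_1)
      finally show ?thesis .
    qed
    have "L f - (\<integral>x. f x \<partial>\<mu>) = 0"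
    proof (rule ccontr)
      assume "L f - (\<integral>x. f x \<partial>\<mu>) \<noteq> 0"
      then have "0 < \<bar>L f - (\<integral>x. f x \<partial>\<mu>)\<bar>" by simp
      from reals_Archimedean3[OF this, rule_format, of 1] bound show False by (meson not_less)
    qed
    then show ?thesis by simp
  qed
  show ?thesis
  proof (intro bexI[OF _ \<mu>] ballI)
    fix f assume f: "f \<in> BC"
    obtain K where K: "K > 0" "\<And>x. x \<in> topspace T \<Longrightarrow> \<bar>f x\<bar> \<le> K" using BC_bound[OF f] by metis
    define h where "h x = (1 / (2 * K)) * f x + 1 / 2" for x
    have hBC: "h \<in> BC" unfolding h_def by (intro BC_intros f)
    have "0 \<le> h x \<and> h x \<le> 1" if "x \<in> topspace T" for x
      using K(1) K(2)[OF that] by (auto simp: h_def field_simps abs_le_iff)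
    then have "(\<integral>x. h x \<partial>\<mu>) = L h" using hBC by (intro unit) auto
    moreover have "(\<integral>x. h x \<partial>\<mu>) = (1 / (2 * K)) * (\<integral>x. f x \<partial>\<mu>) + 1 / 2"
      unfolding h_def using int[OF f] by (subst Bochner_Integration.integral_add) (auto simp: prob_space)
    moreover have "L h = (1 / (2 * K)) * L f + 1 / 2"
      unfolding h_def using add[OF BC_cmult[OF f] BC_const, of "1 / (2 * K)" "1 / 2"]
          cmult[OF f, of "1 / (2 * K)"] cmult[OF BC_const[of 1], of "1 / 2"] one by simp
    ultimately show "(\<integral>x. f x \<partial>\<mu>) = L f" using K by simp
  qed
qed

end

section \<open>Tightness and relative compactness\<close>

text \<open>A point of the closure in a product space is approximated by the family on finitely many
  coordinates at a time; every closed condition involving finitely many test functions is inherited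
  in this way.\<close>

lemma closure_evaluations_approx:
  assumes L: "L \<in> (product_topology (\<lambda>_. euclideanreal) I) closure_of (\<Phi> ` S)"
    and F: "finite F" "F \<subseteq> I" and e: "e > 0"
  shows "\<exists>\<mu>\<in>S. \<forall>f\<in>F. \<bar>\<Phi> \<mu> f - L f\<bar> < e"
proof -
  let ?V = "PiE I (\<lambda>f. if f \<in> F then ball (L f) e else UNIV)"
  have "L \<in> topspace (product_topology (\<lambda>_. euclideanreal) I)"
    using L by (simp add: in_closure_of)
  then have "L \<in> ?V" using e by (auto simp: PiE_iff)
  moreover have "openin (product_topology (\<lambda>_. euclideanreal) I) ?V"
    using F by (intro product_topology_basis) (auto intro: finite_subset[of _ F])
  ultimately obtain \<mu> where "\<mu> \<in> S" "\<Phi> \<mu> \<in> ?V" using L unfolding in_closure_of by blast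
  have "\<bar>\<Phi> \<mu> f - L f\<bar> < e" if "f \<in> F" for f
    using PiE_mem[OF \<open>\<Phi> \<mu> \<in> ?V\<close>, of f] F that by (auto simp: dist_real_def abs_minus_commute)
  then show ?thesis using \<open>\<mu> \<in> S\<close> by blast
qed

lemma dini_compactin:
  fixes h :: "nat \<Rightarrow> 'c \<Rightarrow> real"
  assumes K: "compactin T K" and h: "\<And>n. continuous_map T euclideanreal (h n)"
    and dec: "\<And>x. x \<in> K \<Longrightarrow> decseq (\<lambda>n. h n x)" and lim: "\<And>x. x \<in> K \<Longrightarrow> (\<lambda>n. h n x) \<longlonglongrightarrow> 0" and e: "e > 0"
  shows "\<exists>N. \<forall>n\<ge>N. \<forall>x\<in>K. h n x < e"
proof -
  define U where "U n = {x \<in> topspace T. h n x \<in> {..<e}}" for n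
  have "openin T (U n)" for n unfolding U_def using h by (intro openin_continuous_map_preimage) auto
  moreover have "K \<subseteq> \<Union>(range U)"
  proof
    fix x assume x: "x \<in> K"
    then have "eventually (\<lambda>n. h n x < e) sequentially" using order_tendstoD(2)[OF lim e] by simp
    then obtain n where "h n x < e" by (auto simp: eventually_sequentially)
    then show "x \<in> \<Union>(range U)" using x compactin_subset_topspace[OF K] by (auto simp: U_def)
  qed
  ultimately obtain \<F> where \<F>: "finite \<F>" "\<F> \<subseteq> range U" "K \<subseteq> \<Union>\<F>"
    using compactinD[OF K, of "range U"] by blast
  then obtain J where J: "finite J" "\<F> = U ` J" by (meson finite_subset_image)
  have "h n x < e" if n: "n \<ge> Max (insert 0 J)" and x: "x \<in> K" for n x
  proof -
    obtain j where j: "j \<in> J" "x \<in> U j" using \<F> J x by auto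
    then have "j \<le> n" using n J by auto
    then have "h n x \<le> h j x" using dec[OF x] by (simp add: decseq_def)
    then show ?thesis using j by (simp add: U_def)
  qed
  then show ?thesis by blast
qed

text \<open>The direct half of Prokhorov's theorem. Compactness is needed for arbitrary coverings and not only
  for sequences, so it is drawn from Tychonoff's theorem and no metrizability of the weak topology
  is involved.\<close>

theorem tight_imp_weakly_compact:
  assumes metr: "metrizable_space T" and S: "S \<subseteq> borel_prob_measures T"
    and tight: "\<And>e. e > 0 \<Longrightarrow> \<exists>K. compactin T K \<and> (\<forall>\<mu>\<in>S. measure \<mu> (topspace T - K) \<le> e)"
  shows "weakly_compact T S"
proof -
  let ?BC = "bounded_continuous_functions T" and ?P = "borel_prob_measures T"
  let ?\<Pi> = "product_topology (\<lambda>_. euclideanreal) ?BC"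
  let ?W = "weak_convergence_topology T"
  define \<Phi> where "\<Phi> \<mu> = (\<lambda>f\<in>?BC. \<integral>c. f c \<partial>\<mu>)" for \<mu> :: "'a measure"
  have W: "?W = pullback_topology ?P \<Phi> ?\<Pi>" by (simp add: weak_convergence_topology_def \<Phi>_def[abs_def])
  have openW: "openin ?W U \<longleftrightarrow> (\<exists>V. openin ?\<Pi> V \<and> U = \<Phi> -` V \<inter> ?P)" for U
    unfolding W openin_pullback_topology ..
  have \<Phi>top: "\<Phi> \<mu> \<in> topspace ?\<Pi>" for \<mu> by (simp add: \<Phi>_def)
  have topW: "topspace ?W = ?P" unfolding W topspace_pullback_topology using \<Phi>top by auto
  define C where "C = ?\<Pi> closure_of (\<Phi> ` S)"
  have SP: "\<mu> \<in> ?P" if "\<mu> \<in> S" for \<mu> using S that by auto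
  have C: "compactin ?\<Pi> C"
  proof -
    have "\<forall>f\<in>?BC. \<exists>K>0. \<forall>x\<in>topspace T. \<bar>f x\<bar> \<le> K" by (simp add: bounded_continuous_functions_iff)
    then obtain b where b: "\<And>f. f \<in> ?BC \<Longrightarrow> b f > 0 \<and> (\<forall>x\<in>topspace T. \<bar>f x\<bar> \<le> b f)" by metis
    let ?B = "PiE ?BC (\<lambda>f. {- b f..b f})"
    have "\<Phi> \<mu> \<in> ?B" if "\<mu> \<in> S" for \<mu>
    proof -
      note \<mu> = borel_prob_measuresD[OF SP[OF that]]
      interpret prob_space \<mu> by (rule \<mu>)
      have "\<bar>\<integral>c. f c \<partial>\<mu>\<bar> \<le> b f" if f: "f \<in> ?BC" for f
      proof -
        have "\<bar>\<integral>c. f c \<partial>\<mu>\<bar> \<le> (\<integral>c. \<bar>f c\<bar> \<partial>\<mu>)" by (rule integral_abs_bound)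
        also have "\<dots> \<le> (\<integral>c. b f \<partial>\<mu>)"
          using b[OF f] \<mu>(3) \<mu>(5)[OF f] by (intro integral_mono) auto
        also have "\<dots> = b f" by (simp add: prob_space)
        finally show ?thesis .
      qed
      then show ?thesis by (fastforce simp: \<Phi>_def abs_le_iff)
    qed
    then have "\<Phi> ` S \<subseteq> ?B" by blast
    moreover have "compactin ?\<Pi> ?B" by (simp add: compactin_PiE)
    moreover have "closedin ?\<Pi> ?B" by (simp add: closedin_product_topology)
    ultimately show ?thesis unfolding C_def
      using closed_compactin[OF _ closure_of_minimal closedin_closure_of] by blast
  qed
  have rep: "\<exists>\<mu>\<in>?P. \<Phi> \<mu> = L" if LC: "L \<in> C" for L
  proof -
    have apx: "\<exists>\<mu>\<in>S. \<forall>f\<in>F. \<bar>(\<integral>c. f c \<partial>\<mu>) - L f\<bar> < e" if "finite F" "F \<subseteq> ?BC" "e > 0" for F and e :: real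
    proof -
      have "\<exists>\<mu>\<in>S. \<forall>f\<in>F. \<bar>\<Phi> \<mu> f - L f\<bar> < e"
        using LC that unfolding C_def by (intro closure_evaluations_approx)
      moreover have "\<Phi> \<mu> f = (\<integral>c. f c \<partial>\<mu>)" if "f \<in> F" for \<mu> f
        using that \<open>F \<subseteq> ?BC\<close> by (auto simp: \<Phi>_def)
      ultimately show ?thesis by auto
    qed
    have small: "r = 0" if "\<And>e. e > 0 \<Longrightarrow> \<bar>r\<bar> \<le> 3 * e" for r :: real
    proof (rule ccontr)
      assume "r \<noteq> 0"
      then show False using that[of "\<bar>r\<bar> / 6"] by simp
    qed
    interpret daniell_functional T L
    proof
      show "metrizable_space T" by fact
    next
      fix f g assume f: "f \<in> ?BC" and g: "g \<in> ?BC"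
      have "\<bar>L (\<lambda>x. f x + g x) - (L f + L g)\<bar> \<le> 3 * e" if e: "e > 0" for e
      proof -
        obtain \<mu> where \<mu>: "\<mu> \<in> S" "\<forall>h\<in>{f, g, \<lambda>x. f x + g x}. \<bar>(\<integral>c. h c \<partial>\<mu>) - L h\<bar> < e"
          using apx[of "{f, g, \<lambda>x. f x + g x}" e] e f g BC_add[OF f g] by auto
        have "(\<integral>c. f c + g c \<partial>\<mu>) = (\<integral>c. f c \<partial>\<mu>) + (\<integral>c. g c \<partial>\<mu>)"
          using borel_prob_measuresD(5)[OF SP[OF \<mu>(1)]] f g by (intro Bochner_Integration.integral_add) auto
        then show ?thesis using \<mu>(2) by (simp add: abs_le_iff abs_less_iff)
      qed
      then show "L (\<lambda>x. f x + g x) = L f + L g" using small[of "L (\<lambda>x. f x + g x) - (L f + L g)"] by simp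
    next
      fix f and c :: real assume f: "f \<in> ?BC"
      have "\<bar>L (\<lambda>x. c * f x) - c * L f\<bar> \<le> 3 * e" if e: "e > 0" for e
      proof -
        define e' where "e' = e / (1 + \<bar>c\<bar>)"
        have e': "e' > 0" "e' * (1 + \<bar>c\<bar>) = e" using e by (auto simp: e'_def)
        obtain \<mu> where \<mu>: "\<mu> \<in> S" "\<forall>h\<in>{f, \<lambda>x. c * f x}. \<bar>(\<integral>c. h c \<partial>\<mu>) - L h\<bar> < e'"
          using apx[of "{f, \<lambda>x. c * f x}" e'] e' f BC_cmult[OF f] by auto
        have "\<bar>L (\<lambda>x. c * f x) - c * (\<integral>x. f x \<partial>\<mu>)\<bar> < e'"
          using \<mu>(2) by (simp add: abs_minus_commute)
        moreover have "\<bar>c * (\<integral>x. f x \<partial>\<mu>) - c * L f\<bar> \<le> \<bar>c\<bar> * e'"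
          using \<mu>(2) by (simp add: abs_mult mult_left_mono flip: right_diff_distrib)
        ultimately have "\<bar>L (\<lambda>x. c * f x) - c * L f\<bar> \<le> e' * (1 + \<bar>c\<bar>)" by (simp add: distrib_left mult.commute)
        then show ?thesis using e' e by simp
      qed
      then show "L (\<lambda>x. c * f x) = c * L f" using small[of "L (\<lambda>x. c * f x) - c * L f"] by simp
    next
      fix f assume f: "f \<in> ?BC" and f0: "\<And>x. x \<in> topspace T \<Longrightarrow> 0 \<le> f x"
      show "0 \<le> L f"
      proof (rule ccontr)
        assume "\<not> 0 \<le> L f"
        then obtain \<mu> where \<mu>: "\<mu> \<in> S" "\<bar>(\<integral>c. f c \<partial>\<mu>) - L f\<bar> < - L f" using apx[of "{f}" "- L f"] f by auto
        have "0 \<le> (\<integral>c. f c \<partial>\<mu>)"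
          using f0 borel_prob_measuresD(3)[OF SP[OF \<mu>(1)]] by (intro integral_nonneg_AE) auto
        then show False using \<mu>(2) by linarith
      qed
    next
      have "\<bar>L (\<lambda>_. 1) - 1\<bar> \<le> 3 * e" if e: "e > 0" for e
      proof -
        obtain \<mu> where \<mu>: "\<mu> \<in> S" "\<bar>(\<integral>c. 1 \<partial>\<mu>) - L (\<lambda>_. 1)\<bar> < e"
          using apx[of "{\<lambda>_. 1}" e] e BC_const by auto
        interpret prob_space \<mu> by (rule borel_prob_measuresD[OF SP[OF \<mu>(1)]])
        show ?thesis using \<mu>(2) e by (simp add: prob_space abs_le_iff abs_less_iff)
      qed
      then show "L (\<lambda>_. 1) = 1" using small[of "L (\<lambda>_. 1) - 1"] by simp
    next
      fix h :: "nat \<Rightarrow> 'a \<Rightarrow> real"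
      assume h: "\<And>n. h n \<in> ?BC" and dec: "\<And>x. x \<in> topspace T \<Longrightarrow> decseq (\<lambda>n. h n x)"
        and lim: "\<And>x. x \<in> topspace T \<Longrightarrow> (\<lambda>n. h n x) \<longlonglongrightarrow> 0"
      obtain b where b: "b > 0" "\<And>x. x \<in> topspace T \<Longrightarrow> \<bar>h 0 x\<bar> \<le> b" using BC_bound[OF h] by metis
      have h0: "0 \<le> h n x" if "x \<in> topspace T" for n x using decseq_ge[OF dec lim] that by auto
      have hb: "h n x \<le> b" if "x \<in> topspace T" for n x
        using b(2)[OF that] decseqD[OF dec[OF that], of 0 n] by auto
      show "(\<lambda>n. L (h n)) \<longlonglongrightarrow> 0"
      proof (rule LIMSEQ_I)
        fix r :: real assume r: "0 < r"
        define e where "e = r / (4 * (1 + b))"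
        have e: "e > 0" "2 * e + b * e < r" using r b by (auto simp: e_def field_simps add_pos_pos)
        obtain K where K: "compactin T K" "\<And>\<mu>. \<mu> \<in> S \<Longrightarrow> measure \<mu> (topspace T - K) \<le> e" using tight[OF e(1)] by blast
        have KT: "K \<subseteq> topspace T" by (rule compactin_subset_topspace[OF K(1)])
        have "\<exists>N. \<forall>n\<ge>N. \<forall>x\<in>K. h n x < e"
        proof (rule dini_compactin[OF K(1) _ _ _ e(1)])
          show "continuous_map T euclideanreal (h n)" for n
            using h[of n] by (simp add: bounded_continuous_functions_iff)
        qed (use dec lim KT in blast)+
        then obtain N where N: "\<And>n x. n \<ge> N \<Longrightarrow> x \<in> K \<Longrightarrow> h n x < e" by blast
        have clK: "closedin T K"
          using metrizable_imp_Hausdorff_space[OF metr] K(1) by (rule compactin_imp_closedin)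
        have "\<bar>L (h n)\<bar> < r" if n: "n \<ge> N" for n
        proof -
          have ub: "(\<integral>x. h n x \<partial>\<mu>) \<le> e + b * e" if \<mu>S: "\<mu> \<in> S" for \<mu>
          proof -
            note \<mu> = borel_prob_measuresD[OF SP[OF \<mu>S]]
            interpret prob_space \<mu> by (rule \<mu>)
            have Km: "topspace T - K \<in> sets \<mu>" using clK \<mu>(2) by (auto simp: closedin_def)
            have ind: "integrable \<mu> (\<lambda>x. b * indicator (topspace T - K) x)"
              using Km emeasure_finite
              by (intro integrable_mult_right integrable_real_indicator) (auto simp: less_top[symmetric])
            have "(\<integral>x. h n x \<partial>\<mu>) \<le> (\<integral>x. e + b * indicator (topspace T - K) x \<partial>\<mu>)"
            proof (rule integral_mono[OF \<mu>(5)[OF h]])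
              fix x assume "x \<in> space \<mu>"
              then show "h n x \<le> e + b * indicator (topspace T - K) x"
                using N[OF n, of x] hb[of x n] \<mu>(3) e(1) by (cases "x \<in> K") auto
            qed (use ind in simp)
            also have "\<dots> = e + b * measure \<mu> (topspace T - K)"
              using ind Km by (subst Bochner_Integration.integral_add) (auto simp: prob_space)
            also have "\<dots> \<le> e + b * e" using K(2)[OF \<mu>S] b(1) by simp
            finally show ?thesis .
          qed
          obtain \<mu> where \<mu>: "\<mu> \<in> S" "\<bar>(\<integral>c. h n c \<partial>\<mu>) - L (h n)\<bar> < e" using apx[of "{h n}" e] h e by auto
          have "0 \<le> (\<integral>c. h n c \<partial>\<mu>)"
            using h0 borel_prob_measuresD(3)[OF SP[OF \<mu>(1)]] by (intro integral_nonneg_AE) auto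
          then show ?thesis using ub[OF \<mu>(1)] \<mu>(2) e mult_pos_pos[OF b(1) e(1)] by (simp add: abs_less_iff)
        qed
        then show "\<exists>no. \<forall>n\<ge>no. norm (L (h n) - 0) < r" by auto
      qed
    qed
    obtain \<mu> where \<mu>: "\<mu> \<in> ?P" "\<And>f. f \<in> ?BC \<Longrightarrow> (\<integral>x. f x \<partial>\<mu>) = L f" using representation by blast
    have "L \<in> topspace ?\<Pi>" using LC by (simp add: C_def in_closure_of)
    then have "\<Phi> \<mu> = L" using \<mu> by (intro extensionalityI[of _ ?BC]) (auto simp: \<Phi>_def PiE_iff)
    then show ?thesis using \<mu>(1) by blast
  qed
  let ?D = "\<Phi> -` C \<inter> ?P"
  have "compactin ?W ?D"
    unfolding compactin_def
  proof (intro conjI allI impI)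
    show "?D \<subseteq> topspace ?W" by (simp add: topW)
    fix \<U> assume \<U>: "Ball \<U> (openin ?W) \<and> ?D \<subseteq> \<Union>\<U>"
    then have "\<forall>U\<in>\<U>. \<exists>V. openin ?\<Pi> V \<and> U = \<Phi> -` V \<inter> ?P" by (simp add: openW)
    then obtain V where V: "\<And>U. U \<in> \<U> \<Longrightarrow> openin ?\<Pi> (V U) \<and> U = \<Phi> -` V U \<inter> ?P" by metis
    have "C \<subseteq> \<Union>(V ` \<U>)"
    proof
      fix L assume "L \<in> C"
      then obtain \<mu> where "\<mu> \<in> ?P" "\<Phi> \<mu> = L" using rep by blast
      moreover from this \<open>L \<in> C\<close> obtain U where "U \<in> \<U>" "\<mu> \<in> U" using \<U> by blast
      ultimately show "L \<in> \<Union>(V ` \<U>)" using V[of U] by blast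
    qed
    then obtain \<F> where \<F>: "finite \<F>" "\<F> \<subseteq> V ` \<U>" "C \<subseteq> \<Union>\<F>"
      using compactinD[OF C, of "V ` \<U>"] V by blast
    obtain \<U>' where \<U>': "finite \<U>'" "\<U>' \<subseteq> \<U>" "\<F> = V ` \<U>'"
      using finite_subset_image[OF \<F>(1,2)] by metis
    have "?D \<subseteq> \<Union>\<U>'"
    proof
      fix \<mu> assume "\<mu> \<in> ?D"
      then obtain U where "U \<in> \<U>'" "\<Phi> \<mu> \<in> V U" "\<mu> \<in> ?P" using \<F>(3) \<U>'(3) by blast
      then show "\<mu> \<in> \<Union>\<U>'" using V[of U] \<U>' by blast
    qed
    then show "\<exists>\<F>. finite \<F> \<and> \<F> \<subseteq> \<U> \<and> ?D \<subseteq> \<Union>\<F>" using \<U>' by blast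
  qed
  moreover have "closedin ?W ?D"
  proof -
    have "openin ?\<Pi> (topspace ?\<Pi> - C)" unfolding C_def by (intro openin_diff openin_topspace closedin_closure_of)
    then have "openin ?W (\<Phi> -` (topspace ?\<Pi> - C) \<inter> ?P)" using openW by blast
    moreover have "\<Phi> -` (topspace ?\<Pi> - C) \<inter> ?P = topspace ?W - ?D" using \<Phi>top by (auto simp: topW)
    ultimately show ?thesis by (simp add: closedin_def topW)
  qed
  moreover have "S \<subseteq> ?D"
    using S \<Phi>top closure_of_subset[of "\<Phi> ` S" ?\<Pi>] unfolding C_def by blast
  ultimately have "compactin ?W (?W closure_of S)"
    using closed_compactin[OF _ closure_of_minimal closedin_closure_of] by blast
  then show ?thesis using S by (simp add: weakly_compact_def relatively_compact_in_def topW)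
qed

section \<open>Continuous functions on a compact semi-metric space\<close>

text \<open>Keeps the carrier of the space of continuous functions folded, so that the facts about abstract
  metric spaces apply to it.\<close>

declare mspace_cfunspace [simp del]

text \<open>Points at distance zero need not coincide, so the facts on compact metric spaces are derived
  here directly from the topology of the semi-distance.\<close>

locale compact_semidist =
  fixes X :: "'x set" and d :: "'x \<Rightarrow> 'x \<Rightarrow> real"
  assumes ne: "X \<noteq> {}"
    and d_nonneg: "\<And>x y. x \<in> X \<Longrightarrow> y \<in> X \<Longrightarrow> 0 \<le> d x y"
    and d_refl: "\<And>x. x \<in> X \<Longrightarrow> d x x = 0"
    and d_sym: "\<And>x y. x \<in> X \<Longrightarrow> y \<in> X \<Longrightarrow> d x y = d y x"
    and d_triangle: "\<And>x y z. x \<in> X \<Longrightarrow> y \<in> X \<Longrightarrow> z \<in> X \<Longrightarrow> d x z \<le> d x y + d y z"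
    and compact: "compact_space (semidist_topology X d)"
begin

abbreviation "T \<equiv> semidist_topology X d"
abbreviation "CX \<equiv> cfunspace T (euclidean_metric :: real metric)"

lemma openin_semidist_ball:
  assumes "x \<in> X" shows "openin T {y \<in> X. d x y < r}"
  unfolding openin_semidist_topology
proof (intro conjI ballI)
  fix y assume y: "y \<in> {y \<in> X. d x y < r}"
  show "\<exists>s>0. \<forall>z\<in>X. d y z < s \<longrightarrow> z \<in> {y \<in> X. d x y < r}"
  proof (intro exI conjI ballI impI)
    show "0 < r - d x y" using y by simp
    fix z assume z: "z \<in> X" "d y z < r - d x y"
    then show "z \<in> {y \<in> X. d x y < r}" using d_triangle[of x y z] y assms by auto
  qed
qed auto

lemma finite_ball_subcover:
  assumes r: "\<And>x. x \<in> X \<Longrightarrow> r x > 0"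
  obtains J where "finite J" "J \<subseteq> X" "\<And>x. x \<in> X \<Longrightarrow> \<exists>c\<in>J. d c x < r c"
proof -
  have "X \<subseteq> (\<Union>x\<in>X. {y \<in> X. d x y < r x})"
  proof
    fix x assume "x \<in> X"
    then show "x \<in> (\<Union>x\<in>X. {y \<in> X. d x y < r x})" using r[of x] d_refl[of x] by (intro UN_I[of x]) auto
  qed
  moreover have "compactin T X" using compact by (simp add: compact_space_def)
  ultimately obtain \<F> where \<F>: "finite \<F>" "\<F> \<subseteq> (\<lambda>x. {y \<in> X. d x y < r x}) ` X" "X \<subseteq> \<Union>\<F>"
    using compactinD[of T X "(\<lambda>x. {y \<in> X. d x y < r x}) ` X"] openin_semidist_ball by blast
  obtain J where "finite J" "J \<subseteq> X" "\<F> = (\<lambda>x. {y \<in> X. d x y < r x}) ` J"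
    using finite_subset_image[OF \<F>(1,2)] by metis
  then show ?thesis using \<F>(3) by (intro that[of J]) auto
qed

lemma finite_net:
  assumes "e > 0" obtains A where "finite A" "A \<subseteq> X" "\<And>x. x \<in> X \<Longrightarrow> \<exists>c\<in>A. d c x < e"
  using finite_ball_subcover[of "\<lambda>_. e"] assms by metis

lemma countable_dense:
  obtains D where "countable D" "D \<subseteq> X" "\<And>x e. x \<in> X \<Longrightarrow> e > 0 \<Longrightarrow> \<exists>c\<in>D. d c x < e"
proof -
  have "\<forall>n::nat. \<exists>A. finite A \<and> A \<subseteq> X \<and> (\<forall>x\<in>X. \<exists>c\<in>A. d c x < 1 / real (Suc n))"
    using finite_net[of "1 / real (Suc n)" for n] by (metis divide_pos_pos of_nat_0_less_iff zero_less_Suc zero_less_one)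
  then obtain A where A: "\<And>n::nat. finite (A n) \<and> A n \<subseteq> X \<and> (\<forall>x\<in>X. \<exists>c\<in>A n. d c x < 1 / real (Suc n))" by metis
  show ?thesis
  proof (rule that[of "\<Union>n. A n"])
    show "countable (\<Union>n. A n)" using A by (auto intro: countable_finite)
    fix x e assume x: "x \<in> X" and e: "e > (0::real)"
    obtain n where "1 / real (Suc n) < e" using nat_approx_posE[OF e] by metis
    then show "\<exists>c\<in>\<Union>n. A n. d c x < e" using A[of n] x by (meson UN_I UNIV_I less_trans)
  qed (use A in auto)
qed

lemma uniformly_continuous:
  assumes f: "continuous_map T euclideanreal f" and e: "e > 0"
  obtains \<delta> where "\<delta> > 0" "\<And>x y. x \<in> X \<Longrightarrow> y \<in> X \<Longrightarrow> d x y < \<delta> \<Longrightarrow> \<bar>f x - f y\<bar> < e"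
proof -
  have "\<exists>r>0. \<forall>y\<in>X. d x y < r \<longrightarrow> \<bar>f x - f y\<bar> < e / 2" if x: "x \<in> X" for x
  proof -
    have "openin T {y \<in> topspace T. f y \<in> ball (f x) (e / 2)}"
      by (intro openin_continuous_map_preimage[OF f]) auto
    moreover have "x \<in> {y \<in> topspace T. f y \<in> ball (f x) (e / 2)}" using x e by simp
    ultimately obtain r where "r > 0" "\<forall>y\<in>X. d x y < r \<longrightarrow> y \<in> {y \<in> topspace T. f y \<in> ball (f x) (e / 2)}"
      unfolding openin_semidist_topology by blast
    then show ?thesis by (intro exI[of _ r]) (auto simp: dist_real_def)
  qed
  then obtain r where r: "\<And>x. x \<in> X \<Longrightarrow> r x > 0 \<and> (\<forall>y\<in>X. d x y < r x \<longrightarrow> \<bar>f x - f y\<bar> < e / 2)" by metis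
  obtain J where J: "finite J" "J \<subseteq> X" "\<And>x. x \<in> X \<Longrightarrow> \<exists>c\<in>J. d c x < r c / 2"
    using finite_ball_subcover[of "\<lambda>x. r x / 2"] r by auto
  have Jne: "J \<noteq> {}" using J(3) ne by blast
  show ?thesis
  proof (rule that[of "Min ((\<lambda>x. r x / 2) ` J)"])
    show "0 < Min ((\<lambda>x. r x / 2) ` J)" using J Jne r by (subst Min_gr_iff) auto
    fix x y assume xy: "x \<in> X" "y \<in> X" "d x y < Min ((\<lambda>x. r x / 2) ` J)"
    obtain c where c: "c \<in> J" "d c x < r c / 2" using J(3) xy by blast
    have "d x y < r c / 2" using xy(3) c J Min_le[of "(\<lambda>x. r x / 2) ` J" "r c / 2"] by auto
    then have "d c y < r c" using d_triangle[of c x y] c J xy by auto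
    moreover have "d c x < r c" using c r[of c] J by auto
    ultimately have "\<bar>f c - f x\<bar> < e / 2" "\<bar>f c - f y\<bar> < e / 2" using r[of c] c J xy by auto
    then show "\<bar>f x - f y\<bar> < e" by linarith
  qed
qed

lemma continuous_mapI:
  assumes "\<And>e. e > 0 \<Longrightarrow> \<exists>\<delta>>0. \<forall>x\<in>X. \<forall>y\<in>X. d x y < \<delta> \<longrightarrow> \<bar>f x - f y\<bar> \<le> e"
  shows "continuous_map T euclideanreal f"
  unfolding continuous_map_def
proof (intro conjI allI impI)
  fix U :: "real set" assume "openin euclideanreal U"
  then have U: "open U" by simp
  show "openin T {x \<in> topspace T. f x \<in> U}"
    unfolding openin_semidist_topology
  proof (intro conjI ballI)
    fix x assume x: "x \<in> {x \<in> topspace T. f x \<in> U}"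
    obtain e where e: "e > 0" "cball (f x) e \<subseteq> U" using U x by (auto simp: open_contains_cball)
    obtain \<delta> where "\<delta> > 0" "\<forall>x\<in>X. \<forall>y\<in>X. d x y < \<delta> \<longrightarrow> \<bar>f x - f y\<bar> \<le> e" using assms[OF e(1)] by blast
    then show "\<exists>r>0. \<forall>y\<in>X. d x y < r \<longrightarrow> y \<in> {x \<in> topspace T. f x \<in> U}"
      using e x by (intro exI[of _ \<delta>]) (auto simp: subset_iff dist_real_def)
  qed auto
qed auto

lemma le_on_dense:
  assumes D: "D \<subseteq> X" "\<And>x e. x \<in> X \<Longrightarrow> e > 0 \<Longrightarrow> \<exists>c\<in>D. d c x < e"
    and f: "continuous_map T euclideanreal f" and le: "\<And>x. x \<in> D \<Longrightarrow> \<bar>f x\<bar> \<le> r" and x: "x \<in> X"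
  shows "\<bar>f x\<bar> \<le> r"
proof (rule field_le_epsilon)
  fix e :: real assume "e > 0"
  from uniformly_continuous[OF f this] obtain \<delta> where \<delta>: "\<delta> > 0" "\<And>x y. x \<in> X \<Longrightarrow> y \<in> X \<Longrightarrow> d x y < \<delta> \<Longrightarrow> \<bar>f x - f y\<bar> < e" by metis
  obtain c where "c \<in> D" "d c x < \<delta>" using D x \<delta> by blast
  then show "\<bar>f x\<bar> \<le> r + e" using \<delta>(2)[of c x] le[of c] D x by auto
qed

lemma mspace_CX: "mspace CX = {f. f \<in> extensional X \<and> continuous_map T euclideanreal f}"
  using compactin_mspace_cfunspace[of T euclidean_metric] compact
  by (simp add: compact_space_def mtopology_of_euclidean)

lemma mdist_CX_le_iff:
  "f \<in> mspace CX \<Longrightarrow> g \<in> mspace CX \<Longrightarrow> mdist CX f g \<le> a \<longleftrightarrow> (\<forall>x\<in>X. \<bar>f x - g x\<bar> \<le> a)"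
  using cfunspace_mdist_le[of f T euclidean_metric g a] ne by (simp add: dist_real_def)

lemma abs_diff_le_mdist: "f \<in> mspace CX \<Longrightarrow> g \<in> mspace CX \<Longrightarrow> x \<in> X \<Longrightarrow> \<bar>f x - g x\<bar> \<le> mdist CX f g"
  using mdist_CX_le_iff[of f g "mdist CX f g"] by simp

sublocale C: Metric_space "mspace CX" "mdist CX"
  by (rule Metric_space_mspace_mdist)

lemma C_space_eq: "C_space T = C.mtopology"
  by (simp add: C_space_def mtopology_of_def)

lemma mcomplete_CX: "C.mcomplete"
proof -
  have "mcomplete_of (cfunspace T (Met_TC.Self :: real metric))"
    by (rule Met_TC.mcomplete_cfunspace) (rule iffD2[OF mcomplete_iff_complete complete_UNIV])
  moreover have "Met_TC.Self = (euclidean_metric :: real metric)" by (simp add: Met_TC.Self_def euclidean_metric_def)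
  ultimately show ?thesis by (simp add: mcomplete_of_def)
qed

text \<open>The functions bounded by \<open>a\<close> that vary by at most \<open>e\<close> on the scale \<open>\<delta>\<close>, for one fixed scale.
  Compact sets are obtained by intersecting over a sequence of scales, while a single class suffices
  for separability.\<close>

definition equicont_class :: "real \<Rightarrow> real \<Rightarrow> real \<Rightarrow> ('x \<Rightarrow> real) set" where
  "equicont_class a \<delta> e = {f \<in> mspace CX. (\<forall>x\<in>X. \<bar>f x\<bar> \<le> a) \<and>
      (\<forall>x\<in>X. \<forall>y\<in>X. d x y < \<delta> \<longrightarrow> \<bar>f x - f y\<bar> \<le> e)}"

text \<open>A function of the class is determined up to \<open>3 e\<close> by the integer parts of its values, in units of
  \<open>e\<close>, on a finite net of radius \<open>\<delta>\<close>; there are finitely many such tables, and each one that occurs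
  is represented by a member of \<open>G\<close> itself.\<close>

lemma equicont_class_finite_net:
  assumes \<delta>: "\<delta> > 0" and e: "e > 0" and G: "G \<subseteq> equicont_class a \<delta> e"
  shows "\<exists>K. finite K \<and> K \<subseteq> G \<and> (\<forall>f\<in>G. \<exists>g\<in>K. mdist CX g f \<le> 3 * e)"
proof -
  obtain A where A: "finite A" "A \<subseteq> X" "\<And>x. x \<in> X \<Longrightarrow> \<exists>c\<in>A. d c x < \<delta>" using finite_net[OF \<delta>] by metis
  define s where "s f = (\<lambda>c\<in>A. \<lfloor>f c / e\<rfloor>)" for f :: "'x \<Rightarrow> real"
  define N where "N = \<lceil>\<bar>a\<bar> / e\<rceil> + 1"
  have "s f \<in> PiE A (\<lambda>_. {- N..N})" if f: "f \<in> G" for f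
  proof -
    have "\<lfloor>f c / e\<rfloor> \<in> {- N..N}" if "c \<in> A" for c
    proof -
      have "\<bar>f c\<bar> \<le> \<bar>a\<bar>" using f that A(2) G unfolding equicont_class_def by fastforce
      then have "\<bar>f c / e\<bar> \<le> \<bar>a\<bar> / e" using e by (simp add: divide_right_mono)
      then show ?thesis unfolding N_def atLeastAtMost_iff by linarith
    qed
    then show ?thesis by (auto simp: s_def)
  qed
  then have "finite (s ` G)" using A(1) by (intro finite_subset[OF _ finite_PiE[of A "\<lambda>_. {- N..N}"]]) auto
  define K where "K = inv_into G s ` (s ` G)"
  have "\<exists>g\<in>K. mdist CX g f \<le> 3 * e" if f: "f \<in> G" for f
  proof
    let ?g = "inv_into G s (s f)"
    show "?g \<in> K" using f by (simp add: K_def)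
    have g: "?g \<in> G" "s ?g = s f" using f by (auto intro: inv_into_into f_inv_into_f[of "s f" s G])
    have fg: "f \<in> equicont_class a \<delta> e" "?g \<in> equicont_class a \<delta> e" using f g G by auto
    show "mdist CX ?g f \<le> 3 * e"
    proof (subst mdist_CX_le_iff)
      show "?g \<in> mspace CX" "f \<in> mspace CX" using fg by (auto simp: equicont_class_def)
      show "\<forall>x\<in>X. \<bar>?g x - f x\<bar> \<le> 3 * e"
      proof
        fix x assume x: "x \<in> X"
        obtain c where c: "c \<in> A" "d c x < \<delta>" using A(3)[OF x] by blast
        have cX: "c \<in> X" using c A by auto
        have "\<lfloor>?g c / e\<rfloor> = \<lfloor>f c / e\<rfloor>" using fun_cong[OF g(2), of c] c by (simp add: s_def)
        then have "\<bar>?g c / e - f c / e\<bar> \<le> 1" by linarith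
        then have "\<bar>?g c - f c\<bar> \<le> e" using e by (simp flip: diff_divide_distrib)
        moreover have "\<bar>f c - f x\<bar> \<le> e" "\<bar>?g c - ?g x\<bar> \<le> e"
          using fg c x cX unfolding equicont_class_def by blast+
        ultimately show "\<bar>?g x - f x\<bar> \<le> 3 * e" by linarith
      qed
    qed
  qed
  moreover have "finite K" using \<open>finite (s ` G)\<close> by (simp add: K_def)
  moreover have "K \<subseteq> G" unfolding K_def by (auto intro: inv_into_into)
  ultimately show ?thesis by blast
qed

lemma closedin_equicont_class: "closedin C.mtopology (equicont_class a \<delta> e)"
  unfolding C.closedin_metric
proof (intro conjI allI impI)
  show "equicont_class a \<delta> e \<subseteq> mspace CX" by (auto simp: equicont_class_def)
  fix f assume f: "f \<in> mspace CX - equicont_class a \<delta> e"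
  consider x where "x \<in> X" "a < \<bar>f x\<bar>" | x y where "x \<in> X" "y \<in> X" "d x y < \<delta>" "e < \<bar>f x - f y\<bar>"
    using f unfolding equicont_class_def by force
  then show "\<exists>r>0. disjnt (equicont_class a \<delta> e) (C.mball f r)"
  proof cases
    case (1 x)
    have False if "g \<in> equicont_class a \<delta> e" "g \<in> C.mball f (\<bar>f x\<bar> - a)" for g
    proof -
      have "\<bar>f x - g x\<bar> \<le> mdist CX f g" "\<bar>g x\<bar> \<le> a"
        using that 1 f abs_diff_le_mdist[of f g x] by (auto simp: equicont_class_def)
      then show False using that(2) by (auto simp: C.in_mball)
    qed
    then show ?thesis using 1 by (intro exI[of _ "\<bar>f x\<bar> - a"]) (auto simp: disjnt_iff)
  next
    case (2 x y)
    have False if "g \<in> equicont_class a \<delta> e" "g \<in> C.mball f ((\<bar>f x - f y\<bar> - e) / 2)" for g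
    proof -
      have le: "\<bar>f x - g x\<bar> \<le> mdist CX f g" "\<bar>f y - g y\<bar> \<le> mdist CX f g" "\<bar>g x - g y\<bar> \<le> e"
        using that 2 f abs_diff_le_mdist[of f g x] abs_diff_le_mdist[of f g y] by (auto simp: equicont_class_def)
      have "\<bar>f x - f y\<bar> \<le> \<bar>f x - g x\<bar> + \<bar>g x - g y\<bar> + \<bar>f y - g y\<bar>" by linarith
      also have "\<dots> \<le> mdist CX f g + e + mdist CX f g" using le by (intro add_mono)
      also have "\<dots> < \<bar>f x - f y\<bar>" using that(2) by (simp add: C.in_mball field_simps)
      finally show False by simp
    qed
    then show ?thesis using 2 by (intro exI[of _ "(\<bar>f x - f y\<bar> - e) / 2"]) (auto simp: disjnt_iff)
  qed
qed

text \<open>The sufficient half of the Arzela-Ascoli theorem: the set is closed and totally bounded in a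
  complete space.\<close>

lemma compactin_equicontinuous:
  assumes \<delta>: "\<And>j::nat. \<delta> j > 0" and e: "\<And>j. e j > 0" "e \<longlonglongrightarrow> 0"
  shows "compactin (C_space T) (\<Inter>j. equicont_class a (\<delta> j) (e j))"
proof -
  let ?K = "\<Inter>j. equicont_class a (\<delta> j) (e j)"
  have "C.mtotally_bounded ?K"
    unfolding C.mtotally_bounded_def
  proof (intro allI impI)
    fix r :: real assume r: "r > 0"
    then have "eventually (\<lambda>j. e j < r / 4) sequentially" by (intro order_tendstoD(2)[OF e(2)]) simp
    then obtain j where j: "e j < r / 4" by (auto simp: eventually_sequentially)
    have "?K \<subseteq> equicont_class a (\<delta> j) (e j)" by blast
    from equicont_class_finite_net[OF \<delta> e(1) this]
    obtain K where K: "finite K" "K \<subseteq> ?K" "\<forall>f\<in>?K. \<exists>g\<in>K. mdist CX g f \<le> 3 * e j" by (elim exE conjE)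
    have "?K \<subseteq> (\<Union>g\<in>K. C.mball g r)"
    proof
      fix f assume f: "f \<in> ?K"
      obtain g where g: "g \<in> K" "mdist CX g f \<le> 3 * e j" using bspec[OF K(3) f] by blast
      have "f \<in> mspace CX" "g \<in> mspace CX" using f g K(2) by (auto simp: equicont_class_def)
      then show "f \<in> (\<Union>g\<in>K. C.mball g r)" using g j r by (intro UN_I[of g]) (auto simp: C.in_mball)
    qed
    then show "\<exists>K. finite K \<and> K \<subseteq> ?K \<and> ?K \<subseteq> (\<Union>x\<in>K. C.mball x r)" using K by blast
  qed
  moreover have "closedin C.mtopology ?K"
    by (intro closedin_INT closedin_equicont_class) simp
  ultimately show ?thesis
    using C.mtotally_bounded_eq_compact_closure_of[OF mcomplete_CX, of ?K]
    by (simp add: C_space_eq closure_of_closedin)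
qed

lemma separable_CX:
  obtains Q where "countable Q" "Q \<subseteq> mspace CX" "\<And>f e. f \<in> mspace CX \<Longrightarrow> e > 0 \<Longrightarrow> \<exists>g\<in>Q. mdist CX g f < e"
proof -
  define G where "G = (\<lambda>(m::nat, k::nat, l::nat). equicont_class (real m) (1 / real (Suc k)) (1 / real (Suc l)))"
  have "\<forall>z. \<exists>K. finite K \<and> K \<subseteq> G z \<and> (\<forall>f\<in>G z. \<exists>g\<in>K. mdist CX g f \<le> 3 * (1 / real (Suc (snd (snd z)))))"
    unfolding G_def split_beta by (intro allI equicont_class_finite_net) auto
  then obtain K where K: "\<And>z. finite (K z) \<and> K z \<subseteq> G z \<and> (\<forall>f\<in>G z. \<exists>g\<in>K z. mdist CX g f \<le> 3 * (1 / real (Suc (snd (snd z)))))" by metis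
  show ?thesis
  proof (rule that[of "\<Union>z. K z"])
    have "countable (K z)" for z using K by (intro countable_finite) auto
    then show "countable (\<Union>z. K z)" by (intro countable_UN) auto
    show "(\<Union>z. K z) \<subseteq> mspace CX" using K by (fastforce simp: G_def equicont_class_def)
    fix f e assume f: "f \<in> mspace CX" and e: "e > (0::real)"
    have fc: "continuous_map T euclideanreal f" using f by (simp add: mspace_CX)
    obtain l where l: "1 / real (Suc l) < e / 3" using nat_approx_posE[of "e / 3"] e by auto
    obtain \<delta> where \<delta>: "\<delta> > 0" "\<And>x y. x \<in> X \<Longrightarrow> y \<in> X \<Longrightarrow> d x y < \<delta> \<Longrightarrow> \<bar>f x - f y\<bar> < 1 / real (Suc l)"
      using uniformly_continuous[OF fc, of "1 / real (Suc l)"] by auto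
    obtain k where k: "1 / real (Suc k) < \<delta>" using nat_approx_posE[OF \<delta>(1)] by metis
    have "compactin euclideanreal (f ` X)" using image_compactin[OF _ fc, of X] compact by (simp add: compact_space_def)
    then have "bounded (f ` X)" by (simp add: compact_imp_bounded)
    then obtain b where b: "\<And>x. x \<in> X \<Longrightarrow> \<bar>f x\<bar> \<le> b" by (auto simp: bounded_iff)
    obtain m where "b \<le> real m" using real_arch_simple by blast
    then have "\<bar>f x\<bar> \<le> real m" if "x \<in> X" for x using b[OF that] by simp
    moreover have "\<bar>f x - f y\<bar> \<le> 1 / real (Suc l)" if "x \<in> X" "y \<in> X" "d x y < 1 / real (Suc k)" for x y
      using \<delta>(2)[OF that(1,2)] that(3) k by simp
    ultimately have "f \<in> G (m, k, l)" using f by (simp add: G_def equicont_class_def)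
    then obtain g where "g \<in> K (m, k, l)" "mdist CX g f \<le> 3 * (1 / real (Suc l))" using K[of "(m, k, l)"] by auto
    then show "\<exists>g\<in>\<Union>z. K z. mdist CX g f < e" using l by (intro bexI[of _ g]) auto
  qed
qed

text \<open>By separability an open set is a countable union of closed balls, and membership of a continuous
  function in a closed ball is decided by its values on a countable dense set.\<close>

lemma measurable_C_space:
  assumes Z: "\<And>\<omega>. \<omega> \<in> space M \<Longrightarrow> Z \<omega> \<in> mspace CX" and Zm: "\<And>x. x \<in> X \<Longrightarrow> (\<lambda>\<omega>. Z \<omega> x) \<in> borel_measurable M"
  shows "Z \<in> measurable M (borel_of (C_space T))"
  unfolding borel_of_def
proof (rule measurable_measure_of)
  show "Z \<in> space M \<rightarrow> topspace (C_space T)" using Z by (simp add: C_space_eq)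
  fix U assume "U \<in> {U. openin (C_space T) U}"
  then have U: "openin C.mtopology U" by (simp add: C_space_eq)
  obtain D where D: "countable D" "D \<subseteq> X" "\<And>x e. x \<in> X \<Longrightarrow> e > 0 \<Longrightarrow> \<exists>c\<in>D. d c x < e"
    using countable_dense by metis
  obtain Q where Q: "countable Q" "Q \<subseteq> mspace CX" "\<And>f e. f \<in> mspace CX \<Longrightarrow> e > 0 \<Longrightarrow> \<exists>g\<in>Q. mdist CX g f < e"
    using separable_CX by metis
  define I where "I = {(q, k::nat). q \<in> Q \<and> C.mcball q (1 / real (Suc k)) \<subseteq> U}"
  have "countable (Q \<times> (UNIV :: nat set))" using Q(1) by simp
  then have I: "countable I" by (rule countable_subset[rotated]) (auto simp: I_def)
  have "Z -` U \<inter> space M = (\<Union>(q, k)\<in>I. {\<omega> \<in> space M. \<forall>x\<in>D. \<bar>q x - Z \<omega> x\<bar> \<le> 1 / real (Suc k)})"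
  proof (intro set_eqI iffI)
    fix \<omega> assume \<omega>: "\<omega> \<in> Z -` U \<inter> space M"
    then have ZM: "Z \<omega> \<in> mspace CX" using Z by auto
    obtain r where r: "r > 0" "C.mball (Z \<omega>) r \<subseteq> U" using U \<omega> by (auto simp: C.openin_mtopology)
    obtain k where k: "1 / real (Suc k) < r / 2" using nat_approx_posE[of "r / 2"] r by auto
    obtain q where q: "q \<in> Q" "mdist CX q (Z \<omega>) < 1 / real (Suc k)" using Q(3)[OF ZM, of "1 / real (Suc k)"] by auto
    have qM: "q \<in> mspace CX" using q Q by auto
    have "C.mcball q (1 / real (Suc k)) \<subseteq> C.mball (Z \<omega>) r"
    proof
      fix g assume g: "g \<in> C.mcball q (1 / real (Suc k))"
      then have "mdist CX (Z \<omega>) g \<le> mdist CX (Z \<omega>) q + mdist CX q g" using ZM qM by (intro C.triangle) auto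
      then show "g \<in> C.mball (Z \<omega>) r" using g q k ZM by (auto simp: C.commute)
    qed
    then have "(q, k) \<in> I" using q r by (auto simp: I_def)
    moreover have "\<forall>x\<in>D. \<bar>q x - Z \<omega> x\<bar> \<le> 1 / real (Suc k)"
      using abs_diff_le_mdist[OF qM ZM] q(2) D(2) by fastforce
    ultimately show "\<omega> \<in> (\<Union>(q, k)\<in>I. {\<omega> \<in> space M. \<forall>x\<in>D. \<bar>q x - Z \<omega> x\<bar> \<le> 1 / real (Suc k)})"
      using \<omega> by auto
  next
    fix \<omega> assume "\<omega> \<in> (\<Union>(q, k)\<in>I. {\<omega> \<in> space M. \<forall>x\<in>D. \<bar>q x - Z \<omega> x\<bar> \<le> 1 / real (Suc k)})"
    then obtain q k where qk: "(q, k) \<in> I" "\<omega> \<in> space M" "\<And>x. x \<in> D \<Longrightarrow> \<bar>q x - Z \<omega> x\<bar> \<le> 1 / real (Suc k)" by auto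
    have ZM: "Z \<omega> \<in> mspace CX" and qM: "q \<in> mspace CX" using Z qk Q by (auto simp: I_def)
    have cqz: "continuous_map T euclideanreal (\<lambda>x. q x - Z \<omega> x)"
      using ZM qM by (intro continuous_map_diff) (auto simp: mspace_CX)
    have "\<bar>q x - Z \<omega> x\<bar> \<le> 1 / real (Suc k)" if "x \<in> X" for x
      by (rule le_on_dense[where D = D and f = "\<lambda>x. q x - Z \<omega> x"]) (use cqz D qk that in auto)
    then have "Z \<omega> \<in> C.mcball q (1 / real (Suc k))" using ZM qM by (simp add: mdist_CX_le_iff)
    then show "\<omega> \<in> Z -` U \<inter> space M" using qk by (auto simp: I_def)
  qed
  also have "\<dots> \<in> sets M"
  proof (intro sets.countable_UN'[OF I] ballI, clarify)
    fix q k assume "(q, k) \<in> I"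
    have [measurable]: "(\<lambda>\<omega>. Z \<omega> x) \<in> borel_measurable M" if "x \<in> D" for x using Zm D(2) that by auto
    show "{\<omega> \<in> space M. \<forall>x\<in>D. \<bar>q x - Z \<omega> x\<bar> \<le> 1 / real (Suc k)} \<in> sets M"
      using D(1) by (intro sets.sets_Collect_countable_All') measurable
  qed
  finally show "Z -` U \<inter> space M \<in> sets M" .
qed (auto dest: openin_subset)

end

section \<open>The entropy integral and the maximal inequality\<close>

lemma real_between_2_and:
  fixes B :: ereal
  assumes "2 < B" shows "\<exists>p. 2 < p \<and> ereal p < B"
proof -
  obtain z where z: "2 < ereal z" "ereal z < B" using ereal_dense2[OF assms] by blast
  then have "2 < z" by (metis ereal_less_eq(3) not_less numeral_eq_ereal)
  then show ?thesis using z by blast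
qed

text \<open>A compact semi-metric space whose entropy integral, built from a gauge \<open>\<phi>\<close> for the growth of
  moments, converges.\<close>

locale entropy_space = compact_semidist X d
  for X :: "'x set" and d :: "'x \<Rightarrow> 'x \<Rightarrow> real" +
  fixes B :: ereal and \<phi> :: "real \<Rightarrow> ennreal"
  assumes B2: "2 < B"
    and phi_finite: "\<And>p. 2 < p \<Longrightarrow> ereal p < B \<Longrightarrow> \<phi> p < \<infinity>"
    and phi_bounded_below: "\<exists>c>0. \<forall>p. 2 < p \<longrightarrow> ereal p < B \<longrightarrow> ennreal c \<le> \<phi> p"
    and entropy_integral: "(\<integral>\<^sup>+\<epsilon>\<in>{0<..semidist_diameter X d}.
            ennreal (exp (lower_transform B \<phi> (ln 2 + metric_entropy X d \<epsilon>))) \<partial>lborel) < \<infinity>"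
begin

definition R :: "real \<Rightarrow> real" where "R p = enn2real (\<phi> p)"

definition h :: "real \<Rightarrow> real" where
  "h \<epsilon> = exp (lower_transform B \<phi> (ln 2 + metric_entropy X d \<epsilon>))"

abbreviation "D \<equiv> semidist_diameter X d"

definition eps :: "nat \<Rightarrow> real" where "eps k = D / 2 ^ k"

text \<open>The only property of a random field that the chaining argument uses.\<close>

definition Lp_increments :: "'a measure \<Rightarrow> ('x \<Rightarrow> 'a \<Rightarrow> real) \<Rightarrow> real \<Rightarrow> bool" where
  "Lp_increments M Y C \<longleftrightarrow> (\<forall>x\<in>X. Y x \<in> borel_measurable M) \<and>
     (\<forall>p. 2 < p \<longrightarrow> ereal p < B \<longrightarrow> (\<forall>x\<in>X. \<forall>y\<in>X.
        Lp_norm M p (\<lambda>\<omega>. Y x \<omega> - Y y \<omega>) \<le> ennreal (C * R p * d x y)))"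

lemma R_nonneg: "R p \<ge> 0" by (simp add: R_def)

lemma R_lower: obtains c where "c > 0" "\<And>p. 2 < p \<Longrightarrow> ereal p < B \<Longrightarrow> c \<le> R p"
proof -
  obtain c where c: "c > 0" "\<And>p. 2 < p \<Longrightarrow> ereal p < B \<Longrightarrow> ennreal c \<le> \<phi> p" using phi_bounded_below by blast
  have "c \<le> R p" if "2 < p" "ereal p < B" for p
    using enn2real_mono[OF c(2)[OF that]] phi_finite[OF that] c(1) by (simp add: R_def)
  then show ?thesis using c(1) that by blast
qed

lemma exponent: obtains p where "2 < p" "ereal p < B"
  using real_between_2_and[OF B2] by blast

abbreviation "J \<equiv> {y. 0 < y \<and> y < 1 \<and> 2 < 1 / y \<and> ereal (1 / y) < B}"

lemma J_nonempty: "J \<noteq> {}"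
proof -
  obtain p where "2 < p" "ereal p < B" by (rule exponent)
  then have "1 / p \<in> J" by simp
  then show ?thesis by blast
qed

lemma lower_transform_eq: "lower_transform B \<phi> x = (INF y\<in>J. x * y + ln (R (1 / y)))"
  by (simp add: lower_transform_def R_def)

lemma bdd_below_transform: "0 \<le> x \<Longrightarrow> bdd_below ((\<lambda>y. x * y + ln (R (1 / y))) ` J)"
proof -
  assume x: "0 \<le> x"
  obtain c where c: "c > 0" "\<And>p. 2 < p \<Longrightarrow> ereal p < B \<Longrightarrow> c \<le> R p" using R_lower by blast
  show ?thesis
  proof (rule bdd_belowI2[of _ "ln c"])
    fix y assume y: "y \<in> J"
    then have "c \<le> R (1 / y)" using c(2)[of "1 / y"] by simp
    then have "ln c \<le> ln (R (1 / y))" using c(1) by (subst ln_le_cancel_iff) auto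
    moreover have "0 \<le> x * y" using x y by auto
    ultimately show "ln c \<le> x * y + ln (R (1 / y))" by linarith
  qed
qed

lemma lower_transform_mono: "0 \<le> x \<Longrightarrow> x \<le> x' \<Longrightarrow> lower_transform B \<phi> x \<le> lower_transform B \<phi> x'"
  unfolding lower_transform_eq
  by (rule cINF_mono[OF J_nonempty bdd_below_transform]) (auto intro!: mult_right_mono)

text \<open>The transform is an infimum in the variable \<open>1 / p\<close>, approached by admissible exponents.\<close>

lemma lower_transform_attained:
  assumes "e > 0"
  obtains p where "2 < p" "ereal p < B" "x / p + ln (R p) < lower_transform B \<phi> x + e"
proof -
  have "(INF y\<in>J. x * y + ln (R (1 / y))) < lower_transform B \<phi> x + e"
    using assms by (simp add: lower_transform_eq)
  then obtain y where y: "y \<in> J" "x * y + ln (R (1 / y)) < lower_transform B \<phi> x + e"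
    using cInf_lessD[of "(\<lambda>y. x * y + ln (R (1 / y))) ` J"] J_nonempty by auto
  then show ?thesis using that[of "1 / y"] by simp
qed

lemma diameter: "x \<in> X \<Longrightarrow> y \<in> X \<Longrightarrow> d x y \<le> D" and D_nonneg: "0 \<le> D"
proof -
  obtain A where A: "finite A" "A \<subseteq> X" "\<And>x. x \<in> X \<Longrightarrow> \<exists>c\<in>A. d c x < 1" using finite_net[of 1] by auto
  define b where "b = (\<Sum>c\<in>A. \<Sum>c'\<in>A. d c c') + 2"
  have b: "d x y \<le> b" if xy: "x \<in> X" "y \<in> X" for x y
  proof -
    obtain c where c1: "c \<in> A" "d c x < 1" using A(3)[OF xy(1)] by blast
    obtain c' where c2: "c' \<in> A" "d c' y < 1" using A(3)[OF xy(2)] by blast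
    note c = c1 c2
    have "d c c' \<le> (\<Sum>c'\<in>A. d c c')" using A c by (intro member_le_sum) (auto intro: d_nonneg)
    also have "\<dots> \<le> (\<Sum>c\<in>A. \<Sum>c'\<in>A. d c c')"
      using A c by (intro member_le_sum[of c A "\<lambda>c. \<Sum>c'\<in>A. d c c'"]) (auto intro!: d_nonneg sum_nonneg dest: subsetD)
    finally have "d c c' \<le> b - 2" by (simp add: b_def)
    moreover have "d x y \<le> d x c + d c y" "d c y \<le> d c c' + d c' y" "d x c = d c x"
      using A(2) c xy d_triangle[of x c y] d_triangle[of c c' y] d_sym[of x c] by auto
    ultimately show ?thesis using c by linarith
  qed
  have bdd: "bdd_above ((\<lambda>(x, y). d x y) ` (X \<times> X))" using b by (auto intro!: bdd_aboveI[of _ b])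
  have *: "d x y \<le> D" if "x \<in> X" "y \<in> X" for x y
    unfolding semidist_diameter_def using that cSUP_upper[OF _ bdd, of "(x, y)"] by auto
  then show "x \<in> X \<Longrightarrow> y \<in> X \<Longrightarrow> d x y \<le> D" .
  obtain x where "x \<in> X" using ne by blast
  then show "0 \<le> D" using *[of x x] d_refl[of x] by simp
qed

lemma eps_nonneg: "0 \<le> eps k" and eps_Suc: "eps (Suc k) = eps k / 2" and eps_tendsto: "eps \<longlonglongrightarrow> 0"
proof -
  show "0 \<le> eps k" using D_nonneg by (simp add: eps_def)
  show "eps (Suc k) = eps k / 2" by (simp add: eps_def)
  have "(\<lambda>k. D * (1 / 2) ^ k) \<longlonglongrightarrow> D * 0" by (intro tendsto_intros) auto
  then show "eps \<longlonglongrightarrow> 0" by (simp add: eps_def[abs_def] power_divide)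
qed

definition nets :: "real \<Rightarrow> 'x set set" where
  "nets \<epsilon> = {A. finite A \<and> A \<subseteq> X \<and> X \<subseteq> (\<Union>c\<in>A. {x\<in>X. d c x \<le> \<epsilon>})}"

lemma nets_iff: "A \<in> nets \<epsilon> \<longleftrightarrow> finite A \<and> A \<subseteq> X \<and> (\<forall>x\<in>X. \<exists>c\<in>A. d c x \<le> \<epsilon>)"
  unfolding nets_def by blast

lemma covering_number_eq: "covering_number X d \<epsilon> = Inf (card ` nets \<epsilon>)"
  unfolding covering_number_def nets_def by (rule arg_cong[where f = Inf]) auto

text \<open>The radii \<open>eps k\<close> are positive except when the diameter vanishes; then one point is a net of
  radius \<open>0\<close>, and both cases can be treated together.\<close>

lemma nets_nonempty:
  assumes "\<epsilon> > 0 \<or> \<epsilon> = eps k" shows "nets \<epsilon> \<noteq> {}"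
proof (cases "\<epsilon> > 0")
  case True
  then obtain A where A: "finite A" "A \<subseteq> X" "\<And>x. x \<in> X \<Longrightarrow> \<exists>c\<in>A. d c x < \<epsilon>" using finite_net by metis
  then have "A \<in> nets \<epsilon>" unfolding nets_iff by (meson less_imp_le)
  then show ?thesis by blast
next
  case False
  then have "eps k = 0" "\<epsilon> = 0" using assms eps_nonneg[of k] by auto
  then have "D = 0" by (simp add: eps_def)
  obtain x where x: "x \<in> X" using ne by blast
  have "{x} \<in> nets \<epsilon>" unfolding nets_def using diameter[OF x] x \<open>D = 0\<close> \<open>\<epsilon> = 0\<close> by auto
  then show ?thesis by blast
qed

lemma minimal_net:
  assumes "\<epsilon> > 0 \<or> \<epsilon> = eps k"
  obtains A where "A \<in> nets \<epsilon>" "card A = covering_number X d \<epsilon>"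
proof -
  have "card ` nets \<epsilon> \<noteq> {}" using nets_nonempty[OF assms] by simp
  from Inf_nat_def1[OF this] show ?thesis using that by (auto simp: covering_number_eq)
qed

lemma covering_number_ge_1:
  assumes "\<epsilon> > 0 \<or> \<epsilon> = eps k" shows "1 \<le> covering_number X d \<epsilon>"
proof -
  obtain A where "A \<in> nets \<epsilon>" "card A = covering_number X d \<epsilon>" using minimal_net[OF assms] .
  moreover from this have "A \<noteq> {}" "finite A" using ne by (auto simp: nets_def)
  then have "card A > 0" by (simp add: card_gt_0_iff)
  ultimately show ?thesis by simp
qed

lemma covering_number_antimono:
  assumes "0 < \<epsilon>" "\<epsilon> \<le> \<epsilon>'" shows "covering_number X d \<epsilon>' \<le> covering_number X d \<epsilon>"
proof -
  obtain A where A: "A \<in> nets \<epsilon>" "card A = covering_number X d \<epsilon>" using minimal_net[OF disjI1[OF assms(1)]] .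
  then have "A \<in> nets \<epsilon>'" using assms(2) unfolding nets_iff by (meson order_trans)
  then have "Inf (card ` nets \<epsilon>') \<le> card A" by (intro cInf_lower) auto
  then show ?thesis using A by (simp add: covering_number_eq)
qed

lemma h_antimono:
  assumes "0 < \<epsilon>" "\<epsilon> \<le> \<epsilon>'" shows "h \<epsilon>' \<le> h \<epsilon>"
proof -
  have "0 \<le> ln (real (covering_number X d \<epsilon>'))" using covering_number_ge_1[of \<epsilon>'] assms by simp
  moreover have "ln (real (covering_number X d \<epsilon>')) \<le> ln (real (covering_number X d \<epsilon>))"
    using covering_number_ge_1[of \<epsilon>'] covering_number_antimono[OF assms] assms by (subst ln_le_cancel_iff) auto
  ultimately show ?thesis unfolding h_def metric_entropy_def by (auto intro!: lower_transform_mono)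
qed

text \<open>Comparison of series and integral: the integrand decreases, so it is at least \<open>h (eps k)\<close> on the interval
  from \<open>eps k / 2\<close> to \<open>eps k\<close>. The comparison uses step functions below the integrand, whose
  integrals are computed without knowing that the integrand itself is measurable.\<close>

lemma summable_entropy: "summable (\<lambda>k. eps k * h (eps k))"
proof -
  let ?I = "\<integral>\<^sup>+\<epsilon>\<in>{0<..D}. ennreal (h \<epsilon>) \<partial>lborel"
  have I: "?I < \<infinity>" using entropy_integral by (simp add: h_def)
  have h0: "h \<epsilon> > 0" for \<epsilon> by (simp add: h_def)
  define s where "s n x = (\<Sum>k<n. ennreal (h (eps k)) * indicator {eps (Suc k)<..eps k} x)" for n and x :: real
  have sle: "s n x \<le> ennreal (h x) * indicator {eps n<..D} x" for n x
  proof (induction n)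
    case (Suc n)
    have le: "eps (Suc n) \<le> eps n" using eps_nonneg[of n] by (simp add: eps_Suc)
    have eD: "eps n \<le> D" using D_nonneg mult_left_mono[of 1 "2 ^ n" D] by (simp add: eps_def divide_le_eq)
    show ?case
    proof (cases "x \<in> {eps (Suc n)<..eps n}")
      case True
      then have "x \<notin> {eps n<..D}" by auto
      then have "s n x = 0" using Suc.IH by simp
      moreover have "h (eps n) \<le> h x" using True eps_nonneg[of "Suc n"] by (intro h_antimono) auto
      ultimately show ?thesis using True eD by (auto simp: s_def ennreal_leI)
    next
      case False
      then have "s (Suc n) x = s n x" by (simp add: s_def)
      also have "\<dots> \<le> ennreal (h x) * indicator {eps n<..D} x" by (rule Suc.IH)
      also have "\<dots> \<le> ennreal (h x) * indicator {eps (Suc n)<..D} x"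
        using le by (intro mult_left_mono) (auto simp: indicator_def)
      finally show ?thesis .
    qed
  qed (simp add: s_def)
  have bound: "(\<Sum>k<n. eps k * h (eps k)) \<le> 2 * enn2real ?I" for n
  proof -
    have "ennreal (\<Sum>k<n. h (eps k) * (eps k / 2)) = (\<Sum>k<n. ennreal (h (eps k)) * ennreal (eps k / 2))"
    proof -
      have "ennreal (h (eps k) * (eps k / 2)) = ennreal (h (eps k)) * ennreal (eps k / 2)" for k
        using h0[of "eps k"] eps_nonneg[of k] by (intro ennreal_mult) auto
      moreover have "0 \<le> h (eps k) * (eps k / 2)" for k using h0[of "eps k"] eps_nonneg[of k] by simp
      ultimately show ?thesis by (simp only: sum_ennreal[symmetric])
    qed
    also have "\<dots> = (\<Sum>k<n. ennreal (h (eps k)) * emeasure lborel {eps (Suc k)<..eps k})"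
      using eps_nonneg by (intro sum.cong) (auto simp: eps_Suc)
    also have "\<dots> = (\<integral>\<^sup>+x. s n x \<partial>lborel)"
      unfolding s_def by (subst nn_integral_sum) (auto simp: nn_integral_cmult)
    also have "\<dots> \<le> ?I"
    proof (intro nn_integral_mono order_trans[OF sle] mult_left_mono)
      show "indicator {eps n<..D} x \<le> (indicator {0<..D} x :: ennreal)" for x
        using eps_nonneg[of n] by (auto simp: indicator_def)
    qed auto
    finally have "(\<Sum>k<n. h (eps k) * (eps k / 2)) \<le> enn2real ?I"
      using I enn2real_mono[of "ennreal (\<Sum>k<n. h (eps k) * (eps k / 2))" ?I] h0 eps_nonneg
      by (simp add: sum_nonneg less_imp_le)
    then show ?thesis by (simp add: sum_distrib_left mult.commute flip: sum_divide_distrib)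
  qed
  show ?thesis
    by (rule summableI_nonneg_bounded[OF _ bound]) (use h0 eps_nonneg in \<open>auto simp: less_imp_le\<close>)
qed

text \<open>A maximum over at most \<open>N\<close> pairs costs \<open>N\<^sup>1\<^sup>/\<^sup>p R p\<close> for each admissible \<open>p\<close>; the infimum over \<open>p\<close> is
  the exponential of the transform at \<open>ln N\<close>, which is below its value at \<open>ln (2 N)\<close>.\<close>

lemma maximal_inequality:
  fixes M :: "'a measure"
  assumes M: "prob_space M" and Y: "Lp_increments M Y C" and C: "C \<ge> 0"
    and I: "finite I" "I \<subseteq> X \<times> X" "card I \<le> covering_number X d \<epsilon>"
    and \<epsilon>: "\<epsilon> > 0 \<or> \<epsilon> = eps k" and r: "\<And>s t. (s, t) \<in> I \<Longrightarrow> d s t \<le> r" "r \<ge> 0"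
  shows "(\<integral>\<^sup>+\<omega>. (SUP z\<in>I. ennreal \<bar>Y (fst z) \<omega> - Y (snd z) \<omega>\<bar>) \<partial>M) \<le> ennreal (C * r * h \<epsilon>)"
proof -
  interpret prob_space M by fact
  let ?N = "covering_number X d \<epsilon>"
  let ?L = "\<integral>\<^sup>+\<omega>. (SUP z\<in>I. ennreal \<bar>Y (fst z) \<omega> - Y (snd z) \<omega>\<bar>) \<partial>M"
  have N: "1 \<le> ?N" by (rule covering_number_ge_1[OF \<epsilon>])
  have bound: "?L \<le> ennreal (C * r * h \<epsilon> * exp e)" if e: "e > 0" for e
  proof -
    let ?x = "ln 2 + metric_entropy X d \<epsilon>"
    obtain p where p: "2 < p" "ereal p < B" "?x / p + ln (R p) < lower_transform B \<phi> ?x + e"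
      using lower_transform_attained[OF e] .
    obtain c where "c > 0" "c \<le> R p" using R_lower p by metis
    then have Rp: "R p > 0" by simp
    have "?L \<le> ennreal (real ?N powr (1 / p) * (C * R p * r))"
    proof (rule nn_integral_Max_le[where Z = "\<lambda>z \<omega>. Y (fst z) \<omega> - Y (snd z) \<omega>"])
      fix z assume z: "z \<in> I"
      obtain s t where st: "z = (s, t)" "s \<in> X" "t \<in> X" using z I(2) by auto
      show "(\<lambda>\<omega>. Y (fst z) \<omega> - Y (snd z) \<omega>) \<in> borel_measurable M"
        using Y st by (auto simp: Lp_increments_def intro!: borel_measurable_diff)
      have "Lp_norm M p (\<lambda>\<omega>. Y s \<omega> - Y t \<omega>) \<le> ennreal (C * R p * d s t)"
        using Y p st by (auto simp: Lp_increments_def)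
      also have "\<dots> \<le> ennreal (C * R p * r)"
        using r(1)[of s t] z st C Rp by (intro ennreal_leI mult_left_mono) auto
      finally show "Lp_norm M p (\<lambda>\<omega>. Y (fst z) \<omega> - Y (snd z) \<omega>) \<le> ennreal (C * R p * r)"
        using st by simp
    qed (use I p C Rp r in auto)
    also have "\<dots> \<le> ennreal (C * r * h \<epsilon> * exp e)"
    proof (intro ennreal_leI)
      have "real ?N powr (1 / p) * R p = exp (ln (real ?N) / p + ln (R p))"
        using N Rp by (simp add: powr_def exp_add)
      also have "\<dots> \<le> exp (?x / p + ln (R p))"
        using p by (simp add: metric_entropy_def divide_right_mono)
      also have "\<dots> \<le> h \<epsilon> * exp e" using p(3) by (simp add: h_def flip: exp_add)
      finally have "(C * r) * (real ?N powr (1 / p) * R p) \<le> (C * r) * (h \<epsilon> * exp e)"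
        using C r by (intro mult_left_mono) auto
      then show "real ?N powr (1 / p) * (C * R p * r) \<le> C * r * h \<epsilon> * exp e" by (simp add: mult_ac)
    qed
    finally show ?thesis .
  qed
  have "((\<lambda>e. ennreal (C * r * h \<epsilon> * exp e)) \<longlongrightarrow> ennreal (C * r * h \<epsilon> * exp 0)) (at_right 0)"
    by (intro tendsto_ennrealI tendsto_intros)
  moreover have "\<forall>\<^sub>F e in at_right 0. ?L \<le> ennreal (C * r * h \<epsilon> * exp e)"
    using eventually_at_right_less[of 0] by (rule eventually_mono) (rule bound)
  ultimately have "?L \<le> ennreal (C * r * h \<epsilon> * exp 0)"
    by (rule tendsto_lowerbound) simp
  then show ?thesis by simp
qed

end

section \<open>Chaining\<close>

context entropy_space begin

definition net :: "nat \<Rightarrow> 'x set" where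
  "net k = (SOME A. A \<in> nets (eps k) \<and> card A = covering_number X d (eps k))"

definition proj :: "nat \<Rightarrow> 'x \<Rightarrow> 'x" where
  "proj k t = (SOME c. c \<in> net k \<and> d c t \<le> eps k)"

text \<open>The union of all nets from level \<open>K\<close> on. Minimal nets are not nested, so a point of a coarser net
  cannot be chained down to level \<open>K\<close>; leaving those nets out keeps the set countable and dense and
  makes every one of its points the start of a chain.\<close>

definition skeleton :: "nat \<Rightarrow> 'x set" where
  "skeleton K = (\<Union>m\<in>{K..}. net m)"

lemma net: "finite (net k)" "net k \<subseteq> X" "card (net k) = covering_number X d (eps k)"
  and proj: "t \<in> X \<Longrightarrow> proj k t \<in> net k" "t \<in> X \<Longrightarrow> d (proj k t) t \<le> eps k"
proof -
  obtain A where "A \<in> nets (eps k)" "card A = covering_number X d (eps k)"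
    using minimal_net[OF disjI2[OF refl]] .
  then have "\<exists>A. A \<in> nets (eps k) \<and> card A = covering_number X d (eps k)" by blast
  from someI_ex[OF this] have N: "net k \<in> nets (eps k) \<and> card (net k) = covering_number X d (eps k)"
    by (simp only: net_def)
  from N show "finite (net k)" "net k \<subseteq> X" "card (net k) = covering_number X d (eps k)"
    by (simp_all add: nets_iff)
  assume "t \<in> X"
  then have "\<exists>c. c \<in> net k \<and> d c t \<le> eps k"
    using N unfolding nets_iff by blast
  from someI_ex[OF this] show "proj k t \<in> net k" "d (proj k t) t \<le> eps k"
    by (simp_all only: proj_def)
qed

lemma skeleton: "countable (skeleton K)" "skeleton K \<subseteq> X" "K \<le> k \<Longrightarrow> skeleton k \<subseteq> skeleton K"
proof -
  show "countable (skeleton K)" unfolding skeleton_def using net by (auto intro: countable_finite)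
  show "skeleton K \<subseteq> X" unfolding skeleton_def using net by auto
  show "skeleton k \<subseteq> skeleton K" if "K \<le> k" unfolding skeleton_def using that by (intro UN_mono) auto
qed

lemma skeleton_dense:
  assumes "x \<in> X" "e > 0" shows "\<exists>c\<in>skeleton K. d c x < e"
proof -
  have "eventually (\<lambda>k. eps k < e) sequentially" using eps_tendsto assms(2) by (rule order_tendstoD)
  then obtain N where "\<And>k. k \<ge> N \<Longrightarrow> eps k < e" by (auto simp: eventually_sequentially)
  then have "eps (max N K) < e" by simp
  moreover have "proj (max N K) x \<in> skeleton K"
    unfolding skeleton_def using proj(1)[OF assms(1)] by (intro UN_I[of "max N K"]) auto
  ultimately show ?thesis using proj(2)[OF assms(1), of "max N K"] by (intro bexI[of _ "proj (max N K) x"]) auto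
qed

text \<open>Each point of a net is linked to one point of the preceding net, so a level has no
  more links than its net has points, rather than pairs of points.\<close>

definition links :: "nat \<Rightarrow> ('x \<times> 'x) set" where
  "links k = (\<lambda>t. (t, proj k t)) ` net (Suc k)"

text \<open>The end point of the chain depends on \<open>t\<close> only and serves all functions \<open>Y\<close>; in particular it does
  not depend on chance.\<close>

lemma chaining:
  assumes "K \<le> m" "t \<in> net m"
  shows "\<exists>u\<in>net K. \<forall>Y :: 'x \<Rightarrow> real. ennreal \<bar>Y t - Y u\<bar> \<le> (\<Sum>k\<in>{K..<m}. SUP z\<in>links k. ennreal \<bar>Y (fst z) - Y (snd z)\<bar>)"
  using assms
proof (induction m arbitrary: t rule: dec_induct)
  case base
  then show ?case by auto
next
  case (step m)
  have tX: "t \<in> X" using step.prems net by auto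
  have pt: "proj m t \<in> net m" by (rule proj(1)[OF tX])
  obtain u where u: "u \<in> net K" and le: "\<And>Y :: 'x \<Rightarrow> real. ennreal \<bar>Y (proj m t) - Y u\<bar> \<le> (\<Sum>k\<in>{K..<m}. SUP z\<in>links k. ennreal \<bar>Y (fst z) - Y (snd z)\<bar>)"
    using step.IH[OF pt] by blast
  have "ennreal \<bar>Y t - Y u\<bar> \<le> (\<Sum>k\<in>{K..<Suc m}. SUP z\<in>links k. ennreal \<bar>Y (fst z) - Y (snd z)\<bar>)" for Y :: "'x \<Rightarrow> real"
  proof -
    have "(t, proj m t) \<in> links m" using step.prems by (auto simp: links_def)
    then have "ennreal \<bar>Y t - Y (proj m t)\<bar> \<le> (SUP z\<in>links m. ennreal \<bar>Y (fst z) - Y (snd z)\<bar>)"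
      by (intro SUP_upper2[of "(t, proj m t)"]) auto
    moreover have "ennreal \<bar>Y t - Y u\<bar> \<le> ennreal (\<bar>Y (proj m t) - Y u\<bar> + \<bar>Y t - Y (proj m t)\<bar>)"
      by (intro ennreal_leI) linarith
    ultimately show ?thesis using le[of Y] step.hyps
      by (simp add: add_mono order_trans)
  qed
  then show ?case using u by blast
qed

lemma abs_diff_le_four:
  fixes a a' b b' u u' :: real and v :: ennreal
  assumes "ennreal \<bar>a - u\<bar> \<le> v" "ennreal \<bar>a' - u'\<bar> \<le> v" "ennreal \<bar>b - u\<bar> \<le> v" "ennreal \<bar>b' - u'\<bar> \<le> v"
  shows "ennreal \<bar>a - a'\<bar> \<le> 4 * v + ennreal \<bar>b - b'\<bar>"
proof -
  have "ennreal \<bar>a - a'\<bar> \<le> ennreal (\<bar>a - u\<bar> + \<bar>a' - u'\<bar> + (\<bar>b - u\<bar> + \<bar>b' - u'\<bar>) + \<bar>b - b'\<bar>)"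
    by (intro ennreal_leI) linarith
  also have "\<dots> = ennreal \<bar>a - u\<bar> + ennreal \<bar>a' - u'\<bar> + (ennreal \<bar>b - u\<bar> + ennreal \<bar>b' - u'\<bar>) + ennreal \<bar>b - b'\<bar>"
    by simp
  also have "\<dots> \<le> v + v + (v + v) + ennreal \<bar>b - b'\<bar>" using assms by (intro add_mono) auto
  also have "v + v + (v + v) = 4 * v" by (simp flip: mult_2 add: mult.assoc[symmetric])
  finally show ?thesis .
qed

text \<open>The oscillation over a countable set, which is therefore measurable.\<close>

definition osc :: "('x \<Rightarrow> real) \<Rightarrow> nat \<Rightarrow> real \<Rightarrow> ennreal" where
  "osc f K \<delta> = (SUP z\<in>{z \<in> skeleton K \<times> skeleton K. d (fst z) (snd z) < \<delta>}. ennreal \<bar>f (fst z) - f (snd z)\<bar>)"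

lemma measurable_osc:
  assumes "\<And>x. x \<in> X \<Longrightarrow> Y x \<in> borel_measurable M"
  shows "(\<lambda>\<omega>. osc (\<lambda>x. Y x \<omega>) K \<delta>) \<in> borel_measurable M"
  unfolding osc_def
proof (rule borel_measurable_SUP)
  show "countable {z \<in> skeleton K \<times> skeleton K. d (fst z) (snd z) < \<delta>}"
    by (rule countable_subset[of _ "skeleton K \<times> skeleton K"]) (auto simp: skeleton)
  fix z assume "z \<in> {z \<in> skeleton K \<times> skeleton K. d (fst z) (snd z) < \<delta>}"
  then have [measurable]: "Y (fst z) \<in> borel_measurable M" "Y (snd z) \<in> borel_measurable M"
    using assms skeleton(2)[of K] by auto
  show "(\<lambda>\<omega>. ennreal \<bar>Y (fst z) \<omega> - Y (snd z) \<omega>\<bar>) \<in> borel_measurable M" by measurable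
qed

text \<open>Two nearby points are chained down to the finite net of level \<open>K\<close>. The chains contribute a tail
  of the entropy series. For every pair of end points that occurs, one pair of nearby starting points is
  selected, and the difference of the end points is compared with that of the selected pair: it is a
  maximum over a finite family whose size is fixed with \<open>K\<close>, over distances below \<open>\<delta>\<close>, so it is
  controlled by \<open>\<delta>\<close> through any one exponent. Neither \<open>K\<close> nor \<open>\<delta>\<close> depends on the field.\<close>

theorem expected_oscillation:
  assumes e: "e > 0"
  shows "\<exists>K \<delta>. \<delta> > 0 \<and> (\<forall>(M :: 'a measure) Y C. prob_space M \<longrightarrow> Lp_increments M Y C \<longrightarrow> 0 \<le> C \<longrightarrow>
           (\<integral>\<^sup>+\<omega>. osc (\<lambda>x. Y x \<omega>) K \<delta> \<partial>M) \<le> ennreal (C * e))"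
proof -
  define g where "g k = eps k * h (eps k)" for k
  have g0: "g k \<ge> 0" for k using eps_nonneg[of k] by (simp add: g_def h_def)
  have sg: "summable g" using summable_entropy by (simp add: g_def[abs_def])
  \<comment> \<open>\<open>1/16\<close>: the four chain segments contribute \<open>4 \<cdot> 2 \<cdot> C\<close> times the tail, the \<open>2\<close> coming from \<open>eps k = 2 * eps (Suc k)\<close>\<close>
  obtain K where "\<forall>n\<ge>K. norm (\<Sum>i. g (i + n)) < e / 16"
    using suminf_exist_split[OF _ sg, of "e / 16"] e by auto
  from this[rule_format, of "Suc K"] have K: "\<bar>\<Sum>i. g (i + Suc K)\<bar> < e / 16" by simp
  obtain p where p: "2 < p" "ereal p < B" by (rule exponent)
  define n where "n = (card (net K))\<^sup>2"
  define a where "a = real n powr (1 / p) * R p"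
  have a0: "a \<ge> 0" using R_nonneg by (simp add: a_def)
  define \<delta> where "\<delta> = e / (2 * (1 + a))"
  have \<delta>: "\<delta> > 0" "a * \<delta> \<le> e / 2" using e a0 by (auto simp: \<delta>_def field_simps)
  define P where "P = {z \<in> skeleton K \<times> skeleton K. d (fst z) (snd z) < \<delta>}"
  have "\<forall>t\<in>skeleton K. \<exists>u. u \<in> net K \<and> (\<exists>m. \<forall>Y :: 'x \<Rightarrow> real.
      ennreal \<bar>Y t - Y u\<bar> \<le> (\<Sum>k\<in>{K..<m}. SUP z\<in>links k. ennreal \<bar>Y (fst z) - Y (snd z)\<bar>))"
  proof
    fix t assume "t \<in> skeleton K"
    then obtain m where "K \<le> m" "t \<in> net m" by (auto simp: skeleton_def)
    from chaining[OF this] obtain u where "u \<in> net K" "\<forall>Y :: 'x \<Rightarrow> real.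
        ennreal \<bar>Y t - Y u\<bar> \<le> (\<Sum>k\<in>{K..<m}. SUP z\<in>links k. ennreal \<bar>Y (fst z) - Y (snd z)\<bar>)" by (rule bexE)
    then show "\<exists>u. u \<in> net K \<and> (\<exists>m. \<forall>Y :: 'x \<Rightarrow> real.
        ennreal \<bar>Y t - Y u\<bar> \<le> (\<Sum>k\<in>{K..<m}. SUP z\<in>links k. ennreal \<bar>Y (fst z) - Y (snd z)\<bar>))"
      by (intro exI[of _ u] conjI exI[of _ m])
  qed
  from bchoice[OF this] obtain \<rho> where \<rho>1: "\<forall>t\<in>skeleton K. \<rho> t \<in> net K \<and> (\<exists>m. \<forall>Y :: 'x \<Rightarrow> real.
      ennreal \<bar>Y t - Y (\<rho> t)\<bar> \<le> (\<Sum>k\<in>{K..<m}. SUP z\<in>links k. ennreal \<bar>Y (fst z) - Y (snd z)\<bar>))"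
    by (elim exE)
  have \<rho>: "\<rho> t \<in> net K" if "t \<in> skeleton K" for t using \<rho>1 that by simp
  define q where "q z = (\<rho> (fst z), \<rho> (snd z))" for z
  have qP: "q ` P \<subseteq> net K \<times> net K" using \<rho> by (auto simp: P_def q_def)
  have finq: "finite (q ` P)" by (rule finite_subset[OF qP]) (simp add: net)
  \<comment> \<open>one pair of nearby points for each pair of end points\<close>
  define I where "I = inv_into P q ` (q ` P)"
  have IP: "I \<subseteq> P" unfolding I_def by (rule image_subsetI) (rule inv_into_into)
  have cardI: "card I \<le> n"
  proof -
    have "card I \<le> card (q ` P)" unfolding I_def by (rule card_image_le[OF finq])
    also have "\<dots> \<le> card (net K \<times> net K)" by (rule card_mono[OF _ qP]) (simp add: net)
    finally show ?thesis by (simp add: n_def power2_eq_square card_cartesian_product)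
  qed
  have finI: "finite I" using finq by (simp add: I_def)
  have PX: "P \<subseteq> X \<times> X" using skeleton(2)[of K] by (auto simp: P_def)
  have "(\<integral>\<^sup>+\<omega>. osc (\<lambda>x. Y x \<omega>) K \<delta> \<partial>M) \<le> ennreal (C * e)"
    if M: "prob_space M" and Y: "Lp_increments M Y C" and C: "0 \<le> C" for M :: "'a measure" and Y C
  proof -
    interpret prob_space M by fact
    have Ym: "Y x \<in> borel_measurable M" if "x \<in> X" for x using Y that by (simp add: Lp_increments_def)
    have dm: "(\<lambda>\<omega>. ennreal \<bar>Y (fst z) \<omega> - Y (snd z) \<omega>\<bar>) \<in> borel_measurable M" if "z \<in> X \<times> X" for z
    proof -
      have [measurable]: "Y (fst z) \<in> borel_measurable M" "Y (snd z) \<in> borel_measurable M" using Ym that by auto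
      show ?thesis by measurable
    qed
    define W where "W k \<omega> = (SUP z\<in>links k. ennreal \<bar>Y (fst z) \<omega> - Y (snd z) \<omega>\<bar>)" for k \<omega>
    have lX: "links k \<subseteq> X \<times> X" "finite (links k)" "card (links k) \<le> covering_number X d (eps (Suc k))" for k
    proof -
      show "links k \<subseteq> X \<times> X"
        using net(2) proj(1) by (fastforce simp: links_def dest: subsetD)
      show "finite (links k)" by (simp add: links_def net)
      show "card (links k) \<le> covering_number X d (eps (Suc k))"
        unfolding links_def net(3)[symmetric] by (rule card_image_le) (simp add: net)
    qed
    have Wm[measurable]: "W k \<in> borel_measurable M" for k
      unfolding W_def using lX[of k] by (intro borel_measurable_SUP countable_finite dm) auto
    have Wint: "(\<integral>\<^sup>+\<omega>. W k \<omega> \<partial>M) \<le> ennreal (2 * C * g (Suc k))" for k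
    proof -
      have "(\<integral>\<^sup>+\<omega>. W k \<omega> \<partial>M) \<le> ennreal (C * eps k * h (eps (Suc k)))"
        unfolding W_def
      proof (rule maximal_inequality[OF M Y C])
        fix s t assume st: "(s, t) \<in> links k"
        then have "s \<in> X" "t = proj k s" using net(2) by (auto simp: links_def dest: subsetD)
        moreover from this have "t \<in> X" using proj(1) net(2) by blast
        ultimately show "d s t \<le> eps k" using proj(2)[of s k] d_sym[of s t] by simp
      qed (use lX eps_nonneg in auto)
      also have "C * eps k * h (eps (Suc k)) = 2 * C * g (Suc k)" by (simp add: g_def eps_Suc)
      finally show ?thesis .
    qed
    define V where "V \<omega> = (\<Sum>i. W (i + K) \<omega>)" for \<omega>
    have Vm[measurable]: "V \<in> borel_measurable M" unfolding V_def by measurable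
    have Vint: "(\<integral>\<^sup>+\<omega>. V \<omega> \<partial>M) \<le> ennreal (C * e / 8)"
    proof -
      have sg': "summable (\<lambda>i. g (i + Suc K))" using sg by (subst summable_iff_shift)
      have "(\<integral>\<^sup>+\<omega>. V \<omega> \<partial>M) = (\<Sum>i. \<integral>\<^sup>+\<omega>. W (i + K) \<omega> \<partial>M)"
        unfolding V_def by (rule nn_integral_suminf) measurable
      also have "\<dots> \<le> (\<Sum>i. ennreal (2 * C * g (i + Suc K)))"
        by (intro suminf_le summableI) (use Wint in auto)
      also have "\<dots> = ennreal (\<Sum>i. 2 * C * g (i + Suc K))"
        using C g0 sg' by (intro suminf_ennreal2 summable_mult) auto
      also have "(\<Sum>i. 2 * C * g (i + Suc K)) = 2 * C * (\<Sum>i. g (i + Suc K))"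
        by (rule suminf_mult[OF sg'])
      also have "ennreal \<dots> \<le> ennreal (2 * C * (e / 16))"
        using K C by (intro ennreal_leI mult_left_mono) auto
      finally show ?thesis by simp
    qed
    have Vle: "ennreal \<bar>Y t \<omega> - Y (\<rho> t) \<omega>\<bar> \<le> V \<omega>" if t: "t \<in> skeleton K" for t \<omega>
    proof -
      from \<rho>1 t obtain m where "\<forall>Y :: 'x \<Rightarrow> real.
          ennreal \<bar>Y t - Y (\<rho> t)\<bar> \<le> (\<Sum>k\<in>{K..<m}. SUP z\<in>links k. ennreal \<bar>Y (fst z) - Y (snd z)\<bar>)" by fast
      from this[rule_format, of "\<lambda>x. Y x \<omega>"]
      have "ennreal \<bar>Y t \<omega> - Y (\<rho> t) \<omega>\<bar> \<le> (\<Sum>k\<in>{K..<m}. W k \<omega>)"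
        by (simp add: W_def)
      also have "\<dots> = (\<Sum>i<m - K. W (i + K) \<omega>)"
        by (rule sum.reindex_bij_witness[of _ "\<lambda>i. i + K" "\<lambda>k. k - K"]) auto
      also have "\<dots> \<le> V \<omega>" unfolding V_def by (rule sum_le_suminf) auto
      finally show ?thesis .
    qed
    let ?U = "\<lambda>\<omega>. SUP z\<in>I. ennreal \<bar>Y (fst z) \<omega> - Y (snd z) \<omega>\<bar>"
    have "(\<integral>\<^sup>+\<omega>. osc (\<lambda>x. Y x \<omega>) K \<delta> \<partial>M) \<le> (\<integral>\<^sup>+\<omega>. 4 * V \<omega> + ?U \<omega> \<partial>M)"
      unfolding osc_def P_def[symmetric]
    proof (intro nn_integral_mono SUP_least)
      fix \<omega> z assume z: "z \<in> P"
      define z' where "z' = inv_into P q (q z)"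
      have z': "z' \<in> P" "q z' = q z" "z' \<in> I"
        unfolding z'_def I_def
        by (rule inv_into_into[OF imageI[OF z]], rule f_inv_into_f[OF imageI[OF z]], intro imageI z)
      have sk: "fst z \<in> skeleton K" "snd z \<in> skeleton K" "fst z' \<in> skeleton K" "snd z' \<in> skeleton K"
        using z z'(1) by (auto simp: P_def)
      have eq: "\<rho> (fst z') = \<rho> (fst z)" "\<rho> (snd z') = \<rho> (snd z)" using z'(2) by (auto simp: q_def)
      have "ennreal \<bar>Y (fst z) \<omega> - Y (snd z) \<omega>\<bar> \<le> 4 * V \<omega> + ennreal \<bar>Y (fst z') \<omega> - Y (snd z') \<omega>\<bar>"
        using Vle[OF sk(1), of \<omega>] Vle[OF sk(2), of \<omega>] Vle[OF sk(3), of \<omega>] Vle[OF sk(4), of \<omega>]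
        unfolding eq by (rule abs_diff_le_four)
      also have "\<dots> \<le> 4 * V \<omega> + ?U \<omega>" using z' by (intro add_left_mono SUP_upper)
      finally show "ennreal \<bar>Y (fst z) \<omega> - Y (snd z) \<omega>\<bar> \<le> 4 * V \<omega> + ?U \<omega>" .
    qed
    also have "\<dots> = 4 * (\<integral>\<^sup>+\<omega>. V \<omega> \<partial>M) + (\<integral>\<^sup>+\<omega>. ?U \<omega> \<partial>M)"
    proof (subst nn_integral_add)
      show "?U \<in> borel_measurable M"
        using finI IP PX by (intro borel_measurable_SUP countable_finite dm) auto
    qed (simp_all add: nn_integral_cmult)
    also have "\<dots> \<le> 4 * ennreal (C * e / 8) + ennreal (real n powr (1 / p) * (C * R p * \<delta>))"
    proof (intro add_mono mult_left_mono Vint nn_integral_Max_le[OF _ finI cardI, where Z = "\<lambda>z \<omega>. Y (fst z) \<omega> - Y (snd z) \<omega>"])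
      fix z assume "z \<in> I"
      then have "z \<in> P" using IP by (rule rev_subsetD)
      then have "z \<in> X \<times> X" using PX by (rule rev_subsetD)
      with \<open>z \<in> P\<close> have z: "fst z \<in> X" "snd z \<in> X" "d (fst z) (snd z) < \<delta>"
        by (auto simp: P_def mem_Times_iff)
      show "(\<lambda>\<omega>. Y (fst z) \<omega> - Y (snd z) \<omega>) \<in> borel_measurable M"
        using Ym z by (intro borel_measurable_diff) auto
      have "Lp_norm M p (\<lambda>\<omega>. Y (fst z) \<omega> - Y (snd z) \<omega>) \<le> ennreal (C * R p * d (fst z) (snd z))"
        using Y p z by (auto simp: Lp_increments_def)
      also have "\<dots> \<le> ennreal (C * R p * \<delta>)"
        using z C R_nonneg by (intro ennreal_leI mult_left_mono) auto
      finally show "Lp_norm M p (\<lambda>\<omega>. Y (fst z) \<omega> - Y (snd z) \<omega>) \<le> ennreal (C * R p * \<delta>)" .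
    qed (use p C R_nonneg \<delta> in auto)
    also have "\<dots> = ennreal (C * e / 2 + C * (a * \<delta>))"
    proof -
      have "4 * ennreal (C * e / 8) = ennreal (C * e / 2)"
        using ennreal_mult[of 4 "C * e / 8"] C e by simp
      moreover have "real n powr (1 / p) * (C * R p * \<delta>) = C * (a * \<delta>)" by (simp add: a_def)
      moreover have "ennreal (C * e / 2 + C * (a * \<delta>)) = ennreal (C * e / 2) + ennreal (C * (a * \<delta>))"
        using C e a0 \<delta> by (intro ennreal_plus) auto
      ultimately show ?thesis by (simp only:)
    qed
    also have "\<dots> \<le> ennreal (C * e)"
    proof (intro ennreal_leI)
      have "C * (a * \<delta>) \<le> C * (e / 2)" using C \<delta>(2) by (intro mult_left_mono)
      then show "C * e / 2 + C * (a * \<delta>) \<le> C * e" by simp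
    qed
    finally show ?thesis .
  qed
  then show ?thesis using \<delta>(1) by blast
qed

end

section \<open>Continuous modifications\<close>

lemma emeasure_gt_le:
  assumes f[measurable]: "f \<in> borel_measurable M" and le: "(\<integral>\<^sup>+\<omega>. f \<omega> \<partial>M) \<le> ennreal c"
    and r: "r > 0" and c: "c \<ge> 0"
  shows "emeasure M {\<omega> \<in> space M. \<not> f \<omega> \<le> ennreal r} \<le> ennreal (c / r)"
proof -
  have "emeasure M {\<omega> \<in> space M. \<not> f \<omega> \<le> ennreal r} \<le> emeasure M {\<omega> \<in> space M. 1 \<le> ennreal (1 / r) * f \<omega>}"
  proof (intro emeasure_mono Collect_mono impI)
    fix \<omega> assume *: "\<omega> \<in> space M \<and> \<not> f \<omega> \<le> ennreal r"
    then have "ennreal (1 / r) * ennreal r \<le> ennreal (1 / r) * f \<omega>" by (intro mult_left_mono) auto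
    moreover have "ennreal (1 / r) * ennreal r = 1" using r by (simp flip: ennreal_mult)
    ultimately show "\<omega> \<in> space M \<and> 1 \<le> ennreal (1 / r) * f \<omega>" using * by simp
  qed measurable
  also have "\<dots> \<le> ennreal (1 / r) * (\<integral>\<^sup>+\<omega>. f \<omega> * indicator (space M) \<omega> \<partial>M)"
    using nn_integral_Markov_inequality[of f "space M" M "ennreal (1 / r)"] by (simp add: Int_def conj_commute)
  also have "(\<integral>\<^sup>+\<omega>. f \<omega> * indicator (space M) \<omega> \<partial>M) = (\<integral>\<^sup>+\<omega>. f \<omega> \<partial>M)"
    by (intro nn_integral_cong) auto
  also have "ennreal (1 / r) * \<dots> \<le> ennreal (1 / r) * ennreal c" using le by (rule mult_left_mono) simp
  also have "\<dots> = ennreal (c / r)" using r c by (simp flip: ennreal_mult)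
  finally show ?thesis .
qed

context entropy_space begin

lemma osc_le_iff:
  "osc f K \<delta> \<le> ennreal r \<longleftrightarrow> (\<forall>s\<in>skeleton K. \<forall>t\<in>skeleton K. d s t < \<delta> \<longrightarrow> \<bar>f s - f t\<bar> \<le> r)" if "r \<ge> 0"
  using that by (auto simp: osc_def SUP_le_iff)

lemma osc_mono: "\<delta> \<le> \<delta>' \<Longrightarrow> osc f K \<delta> \<le> osc f K \<delta>'"
  unfolding osc_def by (intro SUP_subset_mono) auto

text \<open>For a continuous function the oscillation over the skeleton controls the whole space, by density.\<close>

lemma osc_continuous:
  assumes f: "continuous_map T euclideanreal f" and osc: "osc f K \<delta> \<le> ennreal r" and r: "r \<ge> 0"
    and xy: "x \<in> X" "y \<in> X" "d x y < \<delta>"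
  shows "\<bar>f x - f y\<bar> \<le> r"
proof (rule field_le_epsilon)
  fix e :: real assume e: "e > 0"
  then have "e / 2 > 0" by simp
  from uniformly_continuous[OF f this] obtain \<eta> where \<eta>: "\<eta> > 0" "\<And>x y. x \<in> X \<Longrightarrow> y \<in> X \<Longrightarrow> d x y < \<eta> \<Longrightarrow> \<bar>f x - f y\<bar> < e / 2"
    by metis
  define \<tau> where "\<tau> = min \<eta> ((\<delta> - d x y) / 2)"
  have \<tau>: "\<tau> > 0" using \<eta>(1) xy by (simp add: \<tau>_def)
  obtain s where s: "s \<in> skeleton K" "d s x < \<tau>" using skeleton_dense[OF xy(1) \<tau>] by blast
  obtain t where t: "t \<in> skeleton K" "d t y < \<tau>" using skeleton_dense[OF xy(2) \<tau>] by blast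
  have sX: "s \<in> X" "t \<in> X" using s t skeleton(2)[of K] by auto
  have "d s t \<le> d s x + d x t" "d x t \<le> d x y + d y t" "d y t = d t y"
    using d_triangle[of s x t] d_triangle[of x y t] d_sym[of y t] xy sX by auto
  then have "d s t < \<delta>" using s t by (simp add: \<tau>_def)
  then have "\<bar>f s - f t\<bar> \<le> r" using osc s t by (simp add: osc_le_iff[OF r])
  moreover have "\<bar>f s - f x\<bar> < e / 2" "\<bar>f t - f y\<bar> < e / 2"
    using \<eta>(2)[of s x] \<eta>(2)[of t y] s t sX xy by (auto simp: \<tau>_def)
  ultimately show "\<bar>f x - f y\<bar> \<le> r + e" by linarith
qed

lemma prob_osc_gt:
  fixes M :: "'a measure"
  assumes e: "e > 0" and r: "r > 0" and C: "0 \<le> C"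
  shows "\<exists>K \<delta>. \<delta> > 0 \<and> (\<forall>(M :: 'a measure) Y. prob_space M \<longrightarrow> Lp_increments M Y C \<longrightarrow>
           emeasure M {\<omega> \<in> space M. \<not> osc (\<lambda>x. Y x \<omega>) K \<delta> \<le> ennreal r} \<le> ennreal e)"
proof -
  define e' where "e' = r * e / (1 + C)"
  have e': "e' > 0" using e r C by (simp add: e'_def)
  from expected_oscillation[OF this, where 'a = 'a] obtain K \<delta> where \<delta>: "\<delta> > 0"
    and osc: "\<forall>(M :: 'a measure) Y C. prob_space M \<longrightarrow> Lp_increments M Y C \<longrightarrow> 0 \<le> C \<longrightarrow>
           (\<integral>\<^sup>+\<omega>. osc (\<lambda>x. Y x \<omega>) K \<delta> \<partial>M) \<le> ennreal (C * e')"
    by (elim exE conjE)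
  have "emeasure M {\<omega> \<in> space M. \<not> osc (\<lambda>x. Y x \<omega>) K \<delta> \<le> ennreal r} \<le> ennreal e"
    if M: "prob_space M" and Y: "Lp_increments M Y C" for M :: "'a measure" and Y
  proof -
    have [measurable]: "(\<lambda>\<omega>. osc (\<lambda>x. Y x \<omega>) K \<delta>) \<in> borel_measurable M"
      using Y by (intro measurable_osc) (simp add: Lp_increments_def)
    have "(\<integral>\<^sup>+\<omega>. osc (\<lambda>x. Y x \<omega>) K \<delta> \<partial>M) \<le> ennreal (C * e')" using osc M Y C by blast
    then have "emeasure M {\<omega> \<in> space M. \<not> osc (\<lambda>x. Y x \<omega>) K \<delta> \<le> ennreal r} \<le> ennreal (C * e' / r)"
      using r C e' by (intro emeasure_gt_le) auto
    also have "\<dots> \<le> ennreal e"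
    proof (intro ennreal_leI)
      have "C * e' / r = e * (C / (1 + C))" using r by (simp add: e'_def)
      also have "\<dots> \<le> e * 1" using C e by (intro mult_left_mono) auto
      finally show "C * e' / r \<le> e" by simp
    qed
    finally show ?thesis .
  qed
  then show ?thesis using \<delta> by blast
qed

text \<open>Almost surely the field is uniformly continuous along the skeletons, hence converges along
  approximating sequences \<open>\<rho> k x\<close>; the modification is the limit there and \<open>0\<close> on the exceptional
  set. It agrees with \<open>Y x\<close> almost surely for each \<open>x\<close> because the approximations also converge to
  \<open>Y x\<close> in mean, by Fatou's lemma.\<close>

theorem continuous_modification_exists:
  fixes M :: "'a measure"
  assumes M: "prob_space M" and Y: "Lp_increments M Y C" and C: "0 \<le> C"
  shows "\<exists>\<zeta>. (\<forall>x\<in>X. \<zeta> x \<in> borel_measurable M \<and> (AE \<omega> in M. \<zeta> x \<omega> = Y x \<omega>)) \<and>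
    (\<forall>\<omega>\<in>space M. continuous_map T euclideanreal (\<lambda>x. \<zeta> x \<omega>))"
proof -
  interpret prob_space M by fact
  have Ym: "Y x \<in> borel_measurable M" if "x \<in> X" for x using Y that by (simp add: Lp_increments_def)
  have om[measurable]: "(\<lambda>\<omega>. osc (\<lambda>x. Y x \<omega>) K \<delta>) \<in> borel_measurable M" for K \<delta>
    using Ym by (rule measurable_osc)
  define good where "good \<omega> \<longleftrightarrow> (\<forall>j::nat. \<exists>K. \<exists>l::nat. osc (\<lambda>x. Y x \<omega>) K (1 / real (Suc l)) \<le> ennreal (1 / real (Suc j)))" for \<omega>
  have gm[measurable]: "Measurable.pred M good" unfolding good_def by measurable
  have "AE \<omega> in M. good \<omega>" unfolding good_def
  proof (subst AE_all_countable, intro allI)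
    fix j :: nat
    define N where "N = {\<omega> \<in> space M. \<not> (\<exists>K. \<exists>l::nat. osc (\<lambda>x. Y x \<omega>) K (1 / real (Suc l)) \<le> ennreal (1 / real (Suc j)))}"
    have Nm: "N \<in> sets M" unfolding N_def by measurable
    have small: "emeasure M N \<le> ennreal e" if e: "e > 0" for e
    proof -
      have "1 / real (Suc j) > 0" by simp
      from prob_osc_gt[OF e this C, where 'a = 'a]
      obtain K \<delta> where \<delta>: "\<delta> > 0" and all: "\<forall>(M :: 'a measure) Y. prob_space M \<longrightarrow> Lp_increments M Y C \<longrightarrow>
          emeasure M {\<omega> \<in> space M. \<not> osc (\<lambda>x. Y x \<omega>) K \<delta> \<le> ennreal (1 / real (Suc j))} \<le> ennreal e"
        by (elim exE conjE)
      have le: "emeasure M {\<omega> \<in> space M. \<not> osc (\<lambda>x. Y x \<omega>) K \<delta> \<le> ennreal (1 / real (Suc j))} \<le> ennreal e"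
        by (rule all[rule_format, OF M Y])
      obtain l where "1 / real (Suc l) < \<delta>" using nat_approx_posE[OF \<delta>] by metis
      then have "osc f K (1 / real (Suc l)) \<le> osc f K \<delta>" for f by (intro osc_mono) simp
      then have "N \<subseteq> {\<omega> \<in> space M. \<not> osc (\<lambda>x. Y x \<omega>) K \<delta> \<le> ennreal (1 / real (Suc j))}"
        unfolding N_def by (auto intro: order_trans)
      then show ?thesis by (rule order_trans[OF emeasure_mono le]) measurable
    qed
    have "emeasure M N \<le> 0" by (rule ennreal_le_epsilon) (use small in simp)
    then have "N \<in> null_sets M" using Nm by auto
    then show "AE \<omega> in M. \<exists>K. \<exists>l::nat. osc (\<lambda>x. Y x \<omega>) K (1 / real (Suc l)) \<le> ennreal (1 / real (Suc j))"
      unfolding N_def by (rule AE_I') auto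
  qed
  define \<rho> where "\<rho> k x = (SOME c. c \<in> skeleton k \<and> d c x < 1 / real (Suc k))" for k x
  have \<rho>: "\<rho> k x \<in> skeleton k" "d (\<rho> k x) x < 1 / real (Suc k)" if x: "x \<in> X" for x k
  proof -
    have "\<exists>c. c \<in> skeleton k \<and> d c x < 1 / real (Suc k)"
      using skeleton_dense[OF x, of "1 / real (Suc k)" k] by auto
    from someI_ex[OF this] show "\<rho> k x \<in> skeleton k" "d (\<rho> k x) x < 1 / real (Suc k)"
      by (simp_all only: \<rho>_def)
  qed
  have \<rho>X: "\<rho> k x \<in> X" if "x \<in> X" for k x using \<rho>(1)[OF that] skeleton(2) by blast
  define \<zeta> where "\<zeta> x \<omega> = (if good \<omega> then lim (\<lambda>k. Y (\<rho> k x) \<omega>) else 0)" for x \<omega>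
  have key: "\<exists>\<delta>>0. \<forall>x\<in>X. \<forall>y\<in>X. d x y < \<delta> \<longrightarrow> (\<exists>n. \<forall>k\<ge>n. \<forall>l\<ge>n. \<bar>Y (\<rho> k x) \<omega> - Y (\<rho> l y) \<omega>\<bar> \<le> e)"
    if g: "good \<omega>" and e: "e > 0" for \<omega> and e :: real
  proof -
    obtain j where j: "1 / real (Suc j) < e" using nat_approx_posE[OF e] by metis
    obtain K l where "osc (\<lambda>x. Y x \<omega>) K (1 / real (Suc l)) \<le> ennreal (1 / real (Suc j))"
      using g unfolding good_def by blast
    then have o: "\<And>s t. s \<in> skeleton K \<Longrightarrow> t \<in> skeleton K \<Longrightarrow> d s t < 1 / real (Suc l) \<Longrightarrow> \<bar>Y s \<omega> - Y t \<omega>\<bar> \<le> 1 / real (Suc j)"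
      by (subst (asm) osc_le_iff) auto
    define \<delta> where "\<delta> = 1 / real (Suc l) / 3"
    have \<delta>: "\<delta> > 0" by (simp add: \<delta>_def)
    obtain n where n: "1 / real (Suc n) < \<delta>" using nat_approx_posE[OF \<delta>] by metis
    have "\<bar>Y (\<rho> k x) \<omega> - Y (\<rho> m y) \<omega>\<bar> \<le> e"
      if xy: "x \<in> X" "y \<in> X" "d x y < \<delta>" and km: "max n K \<le> k" "max n K \<le> m" for x y k m
    proof -
      have "1 / real (Suc k) \<le> 1 / real (Suc n)" "1 / real (Suc m) \<le> 1 / real (Suc n)"
        using km by (auto simp: field_simps)
      then have "d (\<rho> k x) x < \<delta>" "d (\<rho> m y) y < \<delta>" using \<rho>(2)[OF xy(1), of k] \<rho>(2)[OF xy(2), of m] n by linarith+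
      moreover have "d (\<rho> k x) (\<rho> m y) \<le> d (\<rho> k x) x + d x (\<rho> m y)" "d x (\<rho> m y) \<le> d x y + d y (\<rho> m y)" "d y (\<rho> m y) = d (\<rho> m y) y"
        using xy \<rho>X d_triangle[of "\<rho> k x" x "\<rho> m y"] d_triangle[of x y "\<rho> m y"] d_sym[of y "\<rho> m y"] by auto
      ultimately have "d (\<rho> k x) (\<rho> m y) < 3 * \<delta>" using xy by linarith
      moreover have "3 * (r / 3) = r" for r :: real by simp
      ultimately have "d (\<rho> k x) (\<rho> m y) < 1 / real (Suc l)" by (simp only: \<delta>_def)
      moreover have "\<rho> k x \<in> skeleton K" "\<rho> m y \<in> skeleton K"
        using \<rho>(1)[OF xy(1), of k] \<rho>(1)[OF xy(2), of m] skeleton(3)[of K k] skeleton(3)[of K m] km by auto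
      ultimately show ?thesis using o j by fastforce
    qed
    then show ?thesis using \<delta> by blast
  qed
  have conv: "(\<lambda>k. Y (\<rho> k x) \<omega>) \<longlonglongrightarrow> \<zeta> x \<omega>" if g: "good \<omega>" and x: "x \<in> X" for x \<omega>
  proof -
    have "Cauchy (\<lambda>k. Y (\<rho> k x) \<omega>)"
    proof (rule metric_CauchyI)
      fix e :: real assume "e > 0"
      then have "e / 2 > 0" by simp
      from key[OF g this] obtain \<delta> where "\<delta> > 0" "\<forall>x\<in>X. \<forall>y\<in>X. d x y < \<delta> \<longrightarrow> (\<exists>n. \<forall>k\<ge>n. \<forall>l\<ge>n. \<bar>Y (\<rho> k x) \<omega> - Y (\<rho> l y) \<omega>\<bar> \<le> e / 2)"
        by blast
      moreover have "d x x = 0" using d_refl[OF x] .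
      ultimately obtain n where "\<forall>k\<ge>n. \<forall>l\<ge>n. \<bar>Y (\<rho> k x) \<omega> - Y (\<rho> l x) \<omega>\<bar> \<le> e / 2" using x by force
      then show "\<exists>n. \<forall>k\<ge>n. \<forall>l\<ge>n. dist (Y (\<rho> k x) \<omega>) (Y (\<rho> l x) \<omega>) < e"
        using \<open>e > 0\<close> by (intro exI[of _ n]) (fastforce simp: dist_real_def)
    qed
    then have "convergent (\<lambda>k. Y (\<rho> k x) \<omega>)" by (rule Cauchy_convergent)
    then show ?thesis using g by (simp add: \<zeta>_def convergent_LIMSEQ_iff)
  qed
  have \<zeta>m: "\<zeta> x \<in> borel_measurable M" if x: "x \<in> X" for x
  proof -
    have [measurable]: "Y (\<rho> k x) \<in> borel_measurable M" for k using Ym \<rho>X[OF x] by blast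
    show ?thesis unfolding \<zeta>_def by measurable
  qed
  show ?thesis
  proof (intro exI[of _ \<zeta>] conjI ballI)
    fix x assume x: "x \<in> X"
    show "\<zeta> x \<in> borel_measurable M" by (rule \<zeta>m[OF x])
    have [measurable]: "\<zeta> x \<in> borel_measurable M" "Y x \<in> borel_measurable M" "\<And>k. Y (\<rho> k x) \<in> borel_measurable M"
      using \<zeta>m[OF x] Ym[OF x] Ym[OF \<rho>X[OF x]] by auto
    obtain p where p: "2 < p" "ereal p < B" by (rule exponent)
    have "(\<integral>\<^sup>+\<omega>. ennreal \<bar>\<zeta> x \<omega> - Y x \<omega>\<bar> \<partial>M) = (\<integral>\<^sup>+\<omega>. liminf (\<lambda>k. ennreal \<bar>Y (\<rho> k x) \<omega> - Y x \<omega>\<bar>) \<partial>M)"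
    proof (rule nn_integral_cong_AE)
      show "AE \<omega> in M. ennreal \<bar>\<zeta> x \<omega> - Y x \<omega>\<bar> = liminf (\<lambda>k. ennreal \<bar>Y (\<rho> k x) \<omega> - Y x \<omega>\<bar>)"
        using \<open>AE \<omega> in M. good \<omega>\<close>
      proof (rule eventually_mono)
        fix \<omega> assume "good \<omega>"
        then have "(\<lambda>k. ennreal \<bar>Y (\<rho> k x) \<omega> - Y x \<omega>\<bar>) \<longlonglongrightarrow> ennreal \<bar>\<zeta> x \<omega> - Y x \<omega>\<bar>"
          using conv[OF _ x] by (intro tendsto_ennrealI tendsto_intros) auto
        then show "ennreal \<bar>\<zeta> x \<omega> - Y x \<omega>\<bar> = liminf (\<lambda>k. ennreal \<bar>Y (\<rho> k x) \<omega> - Y x \<omega>\<bar>)"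
          by (intro lim_imp_Liminf[symmetric]) auto
      qed
    qed
    also have "\<dots> \<le> liminf (\<lambda>k. \<integral>\<^sup>+\<omega>. ennreal \<bar>Y (\<rho> k x) \<omega> - Y x \<omega>\<bar> \<partial>M)"
      by (rule nn_integral_liminf) measurable
    also have "\<dots> \<le> liminf (\<lambda>k. ennreal (C * R p * (1 / real (Suc k))))"
    proof (intro Liminf_mono always_eventually allI)
      fix k
      have "(\<integral>\<^sup>+\<omega>. ennreal \<bar>Y (\<rho> k x) \<omega> - Y x \<omega>\<bar> \<partial>M) \<le> Lp_norm M p (\<lambda>\<omega>. Y (\<rho> k x) \<omega> - Y x \<omega>)"
        using p by (intro nn_integral_abs_le_Lp_norm) auto
      also have "\<dots> \<le> ennreal (C * R p * d (\<rho> k x) x)" using Y p x \<rho>X[OF x] by (simp add: Lp_increments_def)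
      also have "\<dots> \<le> ennreal (C * R p * (1 / real (Suc k)))"
        using \<rho>(2)[OF x, of k] C R_nonneg by (intro ennreal_leI mult_left_mono) auto
      finally show "(\<integral>\<^sup>+\<omega>. ennreal \<bar>Y (\<rho> k x) \<omega> - Y x \<omega>\<bar> \<partial>M) \<le> ennreal (C * R p * (1 / real (Suc k)))" .
    qed
    also have "\<dots> = ennreal (C * R p * 0)"
      by (intro lim_imp_Liminf tendsto_ennrealI tendsto_mult tendsto_const LIMSEQ_Suc[OF lim_1_over_n]) auto
    finally have "(\<integral>\<^sup>+\<omega>. ennreal \<bar>\<zeta> x \<omega> - Y x \<omega>\<bar> \<partial>M) = 0" by simp
    then have "AE \<omega> in M. ennreal \<bar>\<zeta> x \<omega> - Y x \<omega>\<bar> = 0" by (subst (asm) nn_integral_0_iff_AE) auto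
    then show "AE \<omega> in M. \<zeta> x \<omega> = Y x \<omega>" by (rule eventually_mono) (simp add: ennreal_eq_0_iff)
  next
    fix \<omega> assume "\<omega> \<in> space M"
    show "continuous_map T euclideanreal (\<lambda>x. \<zeta> x \<omega>)"
    proof (cases "good \<omega>")
      case False
      then show ?thesis by (simp add: \<zeta>_def)
    next
      case True
      show ?thesis
      proof (rule continuous_mapI)
        fix e :: real assume "e > 0"
        from key[OF True this] obtain \<delta> where \<delta>: "\<delta> > 0" "\<forall>x\<in>X. \<forall>y\<in>X. d x y < \<delta> \<longrightarrow> (\<exists>n. \<forall>k\<ge>n. \<forall>l\<ge>n. \<bar>Y (\<rho> k x) \<omega> - Y (\<rho> l y) \<omega>\<bar> \<le> e)"
          by blast
        show "\<exists>\<delta>>0. \<forall>x\<in>X. \<forall>y\<in>X. d x y < \<delta> \<longrightarrow> \<bar>\<zeta> x \<omega> - \<zeta> y \<omega>\<bar> \<le> e"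
        proof (intro exI[of _ \<delta>] conjI ballI impI)
          fix x y assume xy: "x \<in> X" "y \<in> X" "d x y < \<delta>"
          obtain n where n: "\<forall>k\<ge>n. \<forall>l\<ge>n. \<bar>Y (\<rho> k x) \<omega> - Y (\<rho> l y) \<omega>\<bar> \<le> e" using \<delta>(2) xy by blast
          have "(\<lambda>k. \<bar>Y (\<rho> k x) \<omega> - Y (\<rho> k y) \<omega>\<bar>) \<longlonglongrightarrow> \<bar>\<zeta> x \<omega> - \<zeta> y \<omega>\<bar>"
            using conv[OF True] xy by (intro tendsto_intros) auto
          then show "\<bar>\<zeta> x \<omega> - \<zeta> y \<omega>\<bar> \<le> e"
            by (rule LIMSEQ_le_const2) (use n in blast)
        qed fact
      qed
    qed
  qed
qed

end

section \<open>Weak compactness of families of random fields\<close>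

context entropy_space begin

lemma sample_path_CX:
  assumes "continuous_map T euclideanreal (\<lambda>x. Y x \<omega>)"
  shows "sample_path X Y \<omega> \<in> mspace CX"
proof -
  have "continuous_map T euclideanreal (sample_path X Y \<omega>)"
    by (rule continuous_map_eq[OF assms]) (simp add: sample_path_def)
  then show ?thesis unfolding mspace_CX by (simp add: sample_path_def)
qed

lemma measurable_sample_path:
  assumes "\<And>x. x \<in> X \<Longrightarrow> Y x \<in> borel_measurable M"
    and "\<And>\<omega>. \<omega> \<in> space M \<Longrightarrow> continuous_map T euclideanreal (\<lambda>x. Y x \<omega>)"
  shows "sample_path X Y \<in> measurable M (borel_of (C_space T))"
proof (rule measurable_C_space)
  show "sample_path X Y \<omega> \<in> mspace CX" if "\<omega> \<in> space M" for \<omega>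
    using sample_path_CX assms(2)[OF that] .
  show "(\<lambda>\<omega>. sample_path X Y \<omega> x) \<in> borel_measurable M" if "x \<in> X" for x
    using assms(1)[OF that] that by (simp add: sample_path_def)
qed

text \<open>The compact sets are given by a modulus of continuity with one scale \<open>\<delta> j\<close> for each accuracy
  \<open>1 / (j + 1)\<close>, chosen so that the exceptional probabilities sum to \<open>e / 2\<close>. As \<open>X\<close> need not be
  connected, the modulus bounds a function only relative to its values on a finite net of radius
  \<open>\<delta> 0\<close>; these values are bounded with probability at least \<open>1 - e / 2\<close>.\<close>

theorem weakly_compact_distributions:
  fixes M :: "'a measure" and Z :: "nat \<Rightarrow> 'x \<Rightarrow> 'a \<Rightarrow> real"
  assumes M: "prob_space M" and C: "C \<ge> 0" and b: "b \<ge> 0"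
    and inc: "\<And>n. n \<ge> 1 \<Longrightarrow> Lp_increments M (Z n) C"
    and cont: "\<And>n \<omega>. n \<ge> 1 \<Longrightarrow> \<omega> \<in> space M \<Longrightarrow> continuous_map T euclideanreal (\<lambda>x. Z n x \<omega>)"
    and bnd: "\<And>n x. n \<ge> 1 \<Longrightarrow> x \<in> X \<Longrightarrow> (\<integral>\<^sup>+\<omega>. ennreal \<bar>Z n x \<omega>\<bar> \<partial>M) \<le> ennreal b"
  shows "weakly_compact (C_space T) ((\<lambda>n. field_distribution M T (Z n)) ` {1..})"
proof (rule tight_imp_weakly_compact)
  interpret prob_space M by fact
  have Zm: "Z n x \<in> borel_measurable M" if "n \<ge> 1" "x \<in> X" for n x
    using inc[OF that(1)] that by (simp add: Lp_increments_def)
  have pm: "sample_path X (Z n) \<in> measurable M (borel_of (C_space T))" if "n \<ge> 1" for n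
    using Zm cont that by (intro measurable_sample_path) auto
  have fd: "field_distribution M T (Z n) = distr M (borel_of (C_space T)) (sample_path X (Z n))" for n
    by (simp add: field_distribution_def)
  show "metrizable_space (C_space T)" unfolding C_space_eq by (rule C.metrizable_space_mtopology)
  show "(\<lambda>n. field_distribution M T (Z n)) ` {1..} \<subseteq> borel_prob_measures (C_space T)"
    using pm by (auto simp: fd borel_prob_measures_def intro!: prob_space_distr)
  fix e :: real assume e: "e > 0"
  define Q where "Q j K \<delta> \<longleftrightarrow> \<delta> > 0 \<and> (\<forall>(M :: 'a measure) Y. prob_space M \<longrightarrow> Lp_increments M Y C \<longrightarrow>
      emeasure M {\<omega> \<in> space M. \<not> osc (\<lambda>x. Y x \<omega>) K \<delta> \<le> ennreal (1 / real (Suc j))} \<le> ennreal (e / 4 * (1 / 2) ^ j))"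
    for j :: nat and K \<delta>
  have "\<forall>j. \<exists>K \<delta>. Q j K \<delta>"
    unfolding Q_def using e C by (intro allI prob_osc_gt) auto
  then obtain K \<delta> where Q: "\<And>j. Q j (K j) (\<delta> j)" by metis
  have \<delta>: "\<delta> j > 0" for j using Q[of j] by (simp add: Q_def)
  have osc: "emeasure M {\<omega> \<in> space M. \<not> osc (\<lambda>x. Y x \<omega>) (K j) (\<delta> j) \<le> ennreal (1 / real (Suc j))} \<le> ennreal (e / 4 * (1 / 2) ^ j)"
    if "prob_space M" "Lp_increments M Y C" for j and M :: "'a measure" and Y
    using Q[of j] that unfolding Q_def by blast
  obtain A where A: "finite A" "A \<subseteq> X" "\<And>x. x \<in> X \<Longrightarrow> \<exists>c\<in>A. d c x < \<delta> 0" using finite_net[OF \<delta>] by metis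
  define a where "a = 2 * (real (card A) * b) / e + 1"
  have a: "a > 0" "real (card A) * b / a \<le> e / 2"
  proof -
    have "0 \<le> 2 * (real (card A) * b) / e" using e b by simp
    then show "a > 0" by (simp add: a_def)
    moreover have "e / 2 * a = real (card A) * b + e / 2" using e by (simp add: a_def distrib_left)
    then have "real (card A) * b \<le> e / 2 * a" using e by linarith
    ultimately show "real (card A) * b / a \<le> e / 2" by (simp add: pos_divide_le_eq)
  qed
  define \<K> where "\<K> = (\<Inter>j. equicont_class (a + 1) (\<delta> j) (1 / real (Suc j)))"
  have comp: "compactin (C_space T) \<K>"
    unfolding \<K>_def by (intro compactin_equicontinuous \<delta> LIMSEQ_Suc[OF lim_1_over_n]) simp
  have "closedin (C_space T) \<K>"
    unfolding \<K>_def C_space_eq by (intro closedin_INT closedin_equicont_class) simp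
  then have op: "topspace (C_space T) - \<K> \<in> sets (borel_of (C_space T))" by (auto simp: closedin_def)
  have "measure (field_distribution M T (Z n)) (topspace (C_space T) - \<K>) \<le> e" if n: "n \<ge> 1" for n
  proof -
    define G where "G c = {\<omega> \<in> space M. \<not> ennreal \<bar>Z n c \<omega>\<bar> \<le> ennreal a}" for c
    define V where "V j = {\<omega> \<in> space M. \<not> osc (\<lambda>x. Z n x \<omega>) (K j) (\<delta> j) \<le> ennreal (1 / real (Suc j))}" for j
    have [measurable]: "(\<lambda>\<omega>. osc (\<lambda>x. Z n x \<omega>) K \<delta>) \<in> borel_measurable M" for K \<delta>
      using Zm n by (intro measurable_osc) auto
    have Om: "V j \<in> sets M" for j unfolding V_def by measurable
    have Gm: "G c \<in> sets M" if "c \<in> A" for c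
    proof -
      have [measurable]: "Z n c \<in> borel_measurable M" using Zm n A that by auto
      show ?thesis unfolding G_def by measurable
    qed
    have "sample_path X (Z n) -` (topspace (C_space T) - \<K>) \<inter> space M \<subseteq> (\<Union>c\<in>A. G c) \<union> (\<Union>j. V j)"
    proof (rule ccontr)
      assume "\<not> ?thesis"
      then obtain \<omega> where \<omega>: "\<omega> \<in> space M" "sample_path X (Z n) \<omega> \<notin> \<K>" "\<And>c. c \<in> A \<Longrightarrow> \<omega> \<notin> G c" "\<And>j. \<omega> \<notin> V j"
        by blast
      have cn: "continuous_map T euclideanreal (\<lambda>x. Z n x \<omega>)" by (rule cont[OF n \<omega>(1)])
      have md: "\<bar>Z n x \<omega> - Z n y \<omega>\<bar> \<le> 1 / real (Suc j)" if "x \<in> X" "y \<in> X" "d x y < \<delta> j" for x y j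
        by (rule osc_continuous[OF cn _ _ that, of "K j"]) (use \<omega>(1) \<omega>(4)[of j] in \<open>auto simp: V_def\<close>)
      have bd: "\<bar>Z n x \<omega>\<bar> \<le> a + 1" if x: "x \<in> X" for x
      proof -
        obtain c where c: "c \<in> A" "d c x < \<delta> 0" using A(3)[OF x] by blast
        then have "\<bar>Z n c \<omega> - Z n x \<omega>\<bar> \<le> 1" using md[of c x 0] A(2) x by auto
        moreover have "\<bar>Z n c \<omega>\<bar> \<le> a" using \<omega>(1) \<omega>(3)[OF c(1)] a(1) by (simp add: G_def)
        ultimately show ?thesis by linarith
      qed
      have "sample_path X (Z n) \<omega> \<in> \<K>"
        unfolding \<K>_def equicont_class_def using sample_path_CX[of "Z n", OF cn] bd md by (auto simp: sample_path_def)
      then show False using \<omega>(2) by simp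
    qed
    moreover have UG: "(\<Union>c\<in>A. G c) \<in> sets M" using A(1) Gm by (rule sets.finite_UN)
    moreover have UV: "(\<Union>j. V j) \<in> sets M" using Om by (intro sets.countable_UN) auto
    ultimately have "emeasure M (sample_path X (Z n) -` (topspace (C_space T) - \<K>) \<inter> space M) \<le> emeasure M ((\<Union>c\<in>A. G c) \<union> (\<Union>j. V j))"
      by (intro emeasure_mono sets.Un)
    also have "\<dots> \<le> emeasure M (\<Union>c\<in>A. G c) + emeasure M (\<Union>j. V j)"
      using UG UV by (rule emeasure_subadditive)
    also have "\<dots> \<le> (\<Sum>c\<in>A. emeasure M (G c)) + (\<Sum>j. emeasure M (V j))"
      using A(1) Gm Om by (intro add_mono emeasure_subadditive_finite emeasure_subadditive_countably) auto
    also have "\<dots> \<le> (\<Sum>c\<in>A. ennreal (b / a)) + (\<Sum>j. ennreal (e / 4 * (1 / 2) ^ j))"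
    proof (intro add_mono sum_mono suminf_le summableI)
      fix c assume "c \<in> A"
      then have "c \<in> X" using A by auto
      then show "emeasure M (G c) \<le> ennreal (b / a)"
        unfolding G_def using Zm[OF n] bnd[OF n] a b by (intro emeasure_gt_le) auto
    next
      show "emeasure M (V j) \<le> ennreal (e / 4 * (1 / 2) ^ j)" for j
        unfolding V_def by (rule osc[OF M inc[OF n]])
    qed
    also have "(\<Sum>c\<in>A. ennreal (b / a)) = ennreal (real (card A) * b / a)"
      using a b by (simp add: ennreal_of_nat_eq_real_of_nat flip: ennreal_mult)
    also have "(\<Sum>j. ennreal (e / 4 * (1 / 2) ^ j)) = ennreal (e / 2)"
    proof (rule suminf_ennreal_eq)
      have "(\<lambda>j. e / 4 * (1 / 2) ^ j) sums (e / 4 * (1 / (1 - 1 / 2)))"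
        by (intro sums_mult geometric_sums) simp
      then show "(\<lambda>j. e / 4 * (1 / 2) ^ j) sums (e / 2)" by simp
    qed (use e in auto)
    also have "ennreal (real (card A) * b / a) + ennreal (e / 2) \<le> ennreal (e / 2) + ennreal (e / 2)"
      using a by (intro add_right_mono ennreal_leI)
    also have "\<dots> = ennreal e" using e by (simp flip: ennreal_plus)
    finally show ?thesis
      unfolding fd using e by (subst measure_distr[OF pm[OF n] op]) (simp add: emeasure_eq_measure)
  qed
  then show "\<exists>K. compactin (C_space T) K \<and> (\<forall>\<mu>\<in>(\<lambda>n. field_distribution M T (Z n)) ` {1..}. measure \<mu> (topspace (C_space T) - K) \<le> e)"
    using comp by blast
qed

end

section \<open>The semi-distance of a martingale difference field\<close>

lemma Lp_norm_normalized_martingale_sum: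
  fixes Y :: "nat \<Rightarrow> 'a \<Rightarrow> real"
  assumes M: "prob_space M" and F: "filtration (space M) F" and sub: "\<And>i. subalgebra M (F i)" and p: "p > 2"
    and Y[measurable]: "\<And>i. i \<ge> 1 \<Longrightarrow> Y i \<in> borel_measurable M"
    and Y0: "\<And>i k. i \<ge> 1 \<Longrightarrow> k < i \<Longrightarrow> AE \<omega> in M. real_cond_exp M (F k) (Y i) \<omega> = 0"
    and YF: "\<And>i. i \<ge> 1 \<Longrightarrow> AE \<omega> in M. real_cond_exp M (F i) (Y i) \<omega> = Y i \<omega>"
    and b: "\<And>i. i \<ge> 1 \<Longrightarrow> b i \<ge> 0" and Yb: "\<And>i. i \<ge> 1 \<Longrightarrow> Lp_norm M p (Y i) \<le> ennreal (b i)"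
    and n: "n \<ge> 1" and \<beta>: "\<beta> \<ge> 0" "(\<Sum>i=1..n. (b i)\<^sup>2) \<le> real n * \<beta>\<^sup>2"
  shows "Lp_norm M p (\<lambda>\<omega>. (1 / sqrt (real n)) * (\<Sum>i=1..n. Y i \<omega>)) \<le> ennreal (3 * (p / ln p) * \<beta>)"
proof -
  have nn: "(\<Sum>i=1..n. (b i)\<^sup>2) \<ge> 0" by (intro sum_nonneg) auto
  have "Lp_norm M p (\<lambda>\<omega>. (1 / sqrt (real n)) * (\<Sum>i=1..n. Y i \<omega>))
      \<le> ennreal (\<bar>1 / sqrt (real n)\<bar> * sqrt (5 * p * (\<Sum>i=1..n. (b i)\<^sup>2)))"
  proof (rule Lp_norm_cmult)
    show "Lp_norm M p (\<lambda>\<omega>. \<Sum>i=1..n. Y i \<omega>) \<le> ennreal (sqrt (5 * p * (\<Sum>i=1..n. (b i)\<^sup>2)))"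
      by (rule Lp_norm_martingale_sum[OF M F sub p Y Y0 YF b Yb])
    show "(\<lambda>\<omega>. \<Sum>i=1..n. Y i \<omega>) \<in> borel_measurable M" by (rule borel_measurable_sum) (rule Y, simp)
  qed (use p nn in auto)
  also have "\<dots> \<le> ennreal (3 * (p / ln p) * \<beta>)"
  proof (rule ennreal_leI)
    have "sqrt (5 * p * (\<Sum>i=1..n. (b i)\<^sup>2)) \<le> sqrt (5 * p * (real n * \<beta>\<^sup>2))"
      using p \<beta> by (intro real_sqrt_le_mono mult_left_mono) auto
    also have "\<dots> = sqrt (real n) * (sqrt (5 * p) * \<beta>)" using \<beta> p by (simp add: real_sqrt_mult)
    finally have "\<bar>1 / sqrt (real n)\<bar> * sqrt (5 * p * (\<Sum>i=1..n. (b i)\<^sup>2)) \<le> sqrt (5 * p) * \<beta>"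
      using n by (simp add: field_simps)
    also have "\<dots> \<le> 3 * (p / ln p) * \<beta>" using sqrt_le_div_ln[OF p] \<beta> by (intro mult_right_mono) auto
    finally show "\<bar>1 / sqrt (real n)\<bar> * sqrt (5 * p * (\<Sum>i=1..n. (b i)\<^sup>2)) \<le> 3 * (p / ln p) * \<beta>" .
  qed
  finally show ?thesis .
qed

lemma Lp_norm_diff:
  assumes "p \<ge> 1" "a \<ge> 0" "b \<ge> 0" "f \<in> borel_measurable M" "g \<in> borel_measurable M" "k \<in> borel_measurable M"
    and "Lp_norm M p (\<lambda>\<omega>. f \<omega> - g \<omega>) \<le> ennreal a" "Lp_norm M p (\<lambda>\<omega>. g \<omega> - k \<omega>) \<le> ennreal b"
  shows "Lp_norm M p (\<lambda>\<omega>. f \<omega> - k \<omega>) \<le> ennreal (a + b)"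
proof -
  have "Lp_norm M p (\<lambda>\<omega>. f \<omega> - k \<omega>) \<le> Lp_norm M p (\<lambda>\<omega>. \<bar>f \<omega> - g \<omega>\<bar> + \<bar>g \<omega> - k \<omega>\<bar>)"
    using assms(1) by (intro Lp_norm_mono_AE AE_I2) linarith+
  also have "\<dots> \<le> ennreal (a + b)"
    using assms by (intro Lp_norm_triangle borel_measurable_diff) auto
  finally show ?thesis .
qed

text \<open>Random fields whose moments are uniformly bounded by a finite natural function that stays away
  from zero.\<close>

locale natural_field =
  fixes M :: "'a measure" and X :: "'x set" and B :: ereal and \<xi> :: "nat \<Rightarrow> 'x \<Rightarrow> 'a \<Rightarrow> real"
  assumes prob: "prob_space M"
    and meas: "\<And>i x. i \<ge> 1 \<Longrightarrow> x \<in> X \<Longrightarrow> \<xi> i x \<in> borel_measurable M"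
    and B2: "2 < B"
    and psi_finite: "\<And>p. 1 \<le> p \<Longrightarrow> ereal p < B \<Longrightarrow> natural_fun M X \<xi> p < \<infinity>"
    and psi_pos: "0 < (INF p\<in>{p. 2 < p \<and> ereal p < B}. natural_fun M X \<xi> p)"
begin

abbreviation "\<psi> \<equiv> natural_fun M X \<xi>"
abbreviation "dist_i \<equiv> d_inc M X B \<xi>"
abbreviation "dist_bar \<equiv> d_bar M X B \<xi>"

definition \<Psi> :: "real \<Rightarrow> real" where "\<Psi> p = enn2real (\<psi> p)"

lemma psi: "2 < p \<Longrightarrow> ereal p < B \<Longrightarrow> \<psi> p = ennreal (\<Psi> p)" "2 < p \<Longrightarrow> ereal p < B \<Longrightarrow> 0 < \<Psi> p"
proof -
  assume p: "2 < p" "ereal p < B"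
  have fin: "\<psi> p < top" using psi_finite[of p] p by simp
  show "\<psi> p = ennreal (\<Psi> p)" using fin by (simp add: \<Psi>_def)
  have "0 < \<psi> p" using psi_pos by (rule less_le_trans) (rule INF_lower, use p in simp)
  then show "0 < \<Psi> p" using fin by (simp add: \<Psi>_def enn2real_positive_iff)
qed

lemma psi_lower: "\<exists>c>0. \<forall>p. 2 < p \<longrightarrow> ereal p < B \<longrightarrow> ennreal c \<le> \<psi> p"
proof -
  let ?I = "INF p\<in>{p. 2 < p \<and> ereal p < B}. \<psi> p"
  obtain p where p: "2 < p" "ereal p < B" using real_between_2_and[OF B2] by blast
  have "?I \<le> \<psi> p" using p by (intro INF_lower) simp
  also have "\<dots> < top" using psi_finite[of p] p by simp
  finally have fin: "?I < top" .
  define c where "c = enn2real ?I"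
  have c: "0 < c" "ennreal c = ?I" using psi_pos fin by (auto simp: c_def enn2real_positive_iff)
  have "ennreal c \<le> \<psi> p" if "2 < p" "ereal p < B" for p
    unfolding c(2) using that by (intro INF_lower) simp
  then show ?thesis using c(1) by blast
qed

lemma Lp_norm_le_psi: "i \<ge> 1 \<Longrightarrow> x \<in> X \<Longrightarrow> Lp_norm M p (\<xi> i x) \<le> \<psi> p"
  unfolding natural_fun_def by (intro SUP_upper2[of i] SUP_upper2[of x]) auto

lemma integrable_field: "i \<ge> 1 \<Longrightarrow> x \<in> X \<Longrightarrow> integrable M (\<xi> i x)"
proof -
  assume ix: "i \<ge> 1" "x \<in> X"
  interpret prob_space M by (rule prob)
  obtain p where p: "2 < p" "ereal p < B" using real_between_2_and[OF B2] by blast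
  have "(\<integral>\<^sup>+\<omega>. ennreal \<bar>\<xi> i x \<omega>\<bar> \<partial>M) \<le> Lp_norm M p (\<xi> i x)"
    using p meas[OF ix] by (intro nn_integral_abs_le_Lp_norm) auto
  also have "\<dots> \<le> \<psi> p" by (rule Lp_norm_le_psi[OF ix])
  also have "\<dots> < \<infinity>" using psi_finite[of p] p by simp
  finally show ?thesis using meas[OF ix] by (simp add: integrable_iff_bounded)
qed

text \<open>With this the real numbers \<open>dist_i i x y\<close> become the least constants in families of moment
  bounds, and their properties follow from those of the \<open>L\<^sup>p\<close> norms.\<close>

lemma GLS_norm_le_iff:
  assumes c: "c \<ge> 0"
  shows "GLS_norm M B \<psi> f \<le> ennreal c \<longleftrightarrow> (\<forall>p. 2 < p \<longrightarrow> ereal p < B \<longrightarrow> Lp_norm M p f \<le> ennreal (c * \<Psi> p))"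
proof -
  have "Lp_norm M p f / \<psi> p \<le> ennreal c \<longleftrightarrow> Lp_norm M p f \<le> ennreal (c * \<Psi> p)" if p: "2 < p" "ereal p < B" for p
  proof
    note \<Psi> = psi[OF p]
    assume "Lp_norm M p f / \<psi> p \<le> ennreal c"
    then have "\<psi> p * (Lp_norm M p f / \<psi> p) \<le> \<psi> p * ennreal c" by (rule mult_left_mono) simp
    moreover have "\<psi> p * (Lp_norm M p f / \<psi> p) = Lp_norm M p f"
      using \<Psi> by (simp add: ennreal_times_divide mult.commute[of "ennreal _"] mult_divide_eq_ennreal)
    ultimately show "Lp_norm M p f \<le> ennreal (c * \<Psi> p)" using \<Psi> c by (simp add: ennreal_mult mult.commute)
  next
    note \<Psi> = psi[OF p]
    assume "Lp_norm M p f \<le> ennreal (c * \<Psi> p)"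
    then have "Lp_norm M p f / \<psi> p \<le> ennreal (c * \<Psi> p) / \<psi> p" by (rule divide_right_mono_ennreal)
    also have "\<dots> = ennreal c" using \<Psi> c by (simp add: divide_ennreal)
    finally show "Lp_norm M p f / \<psi> p \<le> ennreal c" .
  qed
  then show ?thesis by (auto simp: GLS_norm_def SUP_le_iff)
qed

lemma GLS_norm_increment_le_2:
  assumes ix: "i \<ge> 1" "x \<in> X" "y \<in> X"
  shows "GLS_norm M B \<psi> (\<lambda>\<omega>. \<xi> i x \<omega> - \<xi> i y \<omega>) \<le> ennreal 2"
proof (subst GLS_norm_le_iff, simp, intro allI impI)
  fix p :: real assume p: "2 < p" "ereal p < B"
  have "Lp_norm M p (\<lambda>\<omega>. \<xi> i x \<omega> - \<xi> i y \<omega>) \<le> Lp_norm M p (\<lambda>\<omega>. \<bar>\<xi> i x \<omega>\<bar> + \<bar>\<xi> i y \<omega>\<bar>)"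
    using p by (intro Lp_norm_mono_AE AE_I2) auto
  also have "\<dots> \<le> ennreal (\<Psi> p + \<Psi> p)"
    using p psi[OF p] ix meas Lp_norm_le_psi[of i _ p] by (intro Lp_norm_triangle) auto
  finally show "Lp_norm M p (\<lambda>\<omega>. \<xi> i x \<omega> - \<xi> i y \<omega>) \<le> ennreal (2 * \<Psi> p)" by simp
qed

lemma GLS_norm_increment:
  assumes "i \<ge> 1" "x \<in> X" "y \<in> X"
  shows "GLS_norm M B \<psi> (\<lambda>\<omega>. \<xi> i x \<omega> - \<xi> i y \<omega>) = ennreal (dist_i i x y)"
  using le_less_trans[OF GLS_norm_increment_le_2[OF assms]] by (simp add: d_inc_def)

lemma dist_i_nonneg: "0 \<le> dist_i i x y"
  by (simp add: d_inc_def)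

lemma dist_i_le_iff:
  assumes "i \<ge> 1" "x \<in> X" "y \<in> X" "c \<ge> 0"
  shows "dist_i i x y \<le> c \<longleftrightarrow>
    (\<forall>p. 2 < p \<longrightarrow> ereal p < B \<longrightarrow> Lp_norm M p (\<lambda>\<omega>. \<xi> i x \<omega> - \<xi> i y \<omega>) \<le> ennreal (c * \<Psi> p))"
  using GLS_norm_increment[OF assms(1-3)] GLS_norm_le_iff[OF assms(4), of "\<lambda>\<omega>. \<xi> i x \<omega> - \<xi> i y \<omega>"] assms(4)
  by simp

lemma Lp_norm_increment:
  "i \<ge> 1 \<Longrightarrow> x \<in> X \<Longrightarrow> y \<in> X \<Longrightarrow> 2 < p \<Longrightarrow> ereal p < B \<Longrightarrow>
    Lp_norm M p (\<lambda>\<omega>. \<xi> i x \<omega> - \<xi> i y \<omega>) \<le> ennreal (dist_i i x y * \<Psi> p)"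
  using dist_i_le_iff[of i x y "dist_i i x y"] dist_i_nonneg by auto

lemma dist_i_le_2: "i \<ge> 1 \<Longrightarrow> x \<in> X \<Longrightarrow> y \<in> X \<Longrightarrow> dist_i i x y \<le> 2"
  using GLS_norm_increment_le_2[of i x y] GLS_norm_increment[of i x y] by (metis ennreal_le_iff zero_le_numeral)

lemma dist_i_refl: "i \<ge> 1 \<Longrightarrow> x \<in> X \<Longrightarrow> dist_i i x x = 0"
  using dist_i_le_iff[of i x x 0] dist_i_nonneg[of i x x] by simp

lemma dist_i_sym: "dist_i i x y = dist_i i y x"
proof -
  have "Lp_norm M p (\<lambda>\<omega>. \<xi> i x \<omega> - \<xi> i y \<omega>) = Lp_norm M p (\<lambda>\<omega>. \<xi> i y \<omega> - \<xi> i x \<omega>)" for p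
    by (simp add: Lp_norm_def abs_minus_commute)
  then show ?thesis by (simp add: d_inc_def GLS_norm_def)
qed

lemma dist_i_triangle:
  assumes i: "i \<ge> 1" and x: "x \<in> X" "y \<in> X" "z \<in> X"
  shows "dist_i i x z \<le> dist_i i x y + dist_i i y z"
proof (subst dist_i_le_iff[OF i x(1,3)], intro add_nonneg_nonneg dist_i_nonneg, intro allI impI)
  fix p :: real assume p: "2 < p" "ereal p < B"
  have "Lp_norm M p (\<lambda>\<omega>. \<xi> i x \<omega> - \<xi> i z \<omega>) \<le> ennreal (dist_i i x y * \<Psi> p + dist_i i y z * \<Psi> p)"
    using Lp_norm_increment[OF i x(1,2) p] Lp_norm_increment[OF i x(2,3) p] p psi(2)[OF p] meas[OF i] x dist_i_nonneg
    by (intro Lp_norm_diff[of p _ _ "\<xi> i x" M "\<xi> i y"]) auto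
  then show "Lp_norm M p (\<lambda>\<omega>. \<xi> i x \<omega> - \<xi> i z \<omega>) \<le> ennreal ((dist_i i x y + dist_i i y z) * \<Psi> p)"
    by (simp add: distrib_right)
qed

definition mean_dist :: "nat \<Rightarrow> 'x \<Rightarrow> 'x \<Rightarrow> real" where
  "mean_dist n x y = sqrt ((1 / real n) * (\<Sum>i=1..n. (dist_i i x y)\<^sup>2))"

text \<open>The averaged distances are Euclidean norms up to a factor, which gives the triangle inequality.\<close>

lemma mean_dist_eq_L2: "mean_dist n x y = (1 / sqrt (real n)) * L2_set (\<lambda>i. dist_i i x y) {1..n}"
  unfolding mean_dist_def L2_set_def by (subst real_sqrt_mult) (simp add: real_sqrt_divide)

lemma dist_bar_eq: "dist_bar x y = (SUP n\<in>{1..}. mean_dist n x y)"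
  by (simp add: d_bar_def mean_dist_def)

lemma mean_dist_nonneg: "0 \<le> mean_dist n x y"
  unfolding mean_dist_def by (intro real_sqrt_ge_zero mult_nonneg_nonneg sum_nonneg) auto

lemma mean_dist_le_2:
  assumes "n \<ge> 1" "x \<in> X" "y \<in> X" shows "mean_dist n x y \<le> 2"
proof -
  have "(\<Sum>i=1..n. (dist_i i x y)\<^sup>2) \<le> (\<Sum>i=1..n. 2\<^sup>2)"
    using assms dist_i_nonneg dist_i_le_2 by (intro sum_mono power_mono) auto
  then have "(1 / real n) * (\<Sum>i=1..n. (dist_i i x y)\<^sup>2) \<le> 2\<^sup>2" using assms by (simp add: field_simps)
  then show ?thesis unfolding mean_dist_def by (rule real_le_lsqrt[rotated -1]) (auto intro!: mult_nonneg_nonneg sum_nonneg)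
qed

lemma mean_dist_le_dist_bar:
  assumes "n \<ge> 1" "x \<in> X" "y \<in> X" shows "mean_dist n x y \<le> dist_bar x y"
  unfolding dist_bar_eq
  using assms mean_dist_le_2 by (intro cSUP_upper bdd_aboveI2[of _ _ 2]) auto

lemma dist_bar_nonneg: "x \<in> X \<Longrightarrow> y \<in> X \<Longrightarrow> 0 \<le> dist_bar x y"
  using mean_dist_le_dist_bar[of 1 x y] mean_dist_nonneg[of 1 x y] by simp

lemma dist_bar_le: "(\<And>n. n \<ge> 1 \<Longrightarrow> mean_dist n x y \<le> c) \<Longrightarrow> dist_bar x y \<le> c"
  unfolding dist_bar_eq by (rule cSUP_least) auto

lemma dist_bar_refl: "x \<in> X \<Longrightarrow> dist_bar x x = 0"
proof -
  assume x: "x \<in> X"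
  have "dist_bar x x \<le> 0" by (rule dist_bar_le) (use x in \<open>simp add: mean_dist_def dist_i_refl\<close>)
  then show ?thesis using dist_bar_nonneg[OF x x] by simp
qed

lemma dist_bar_sym: "dist_bar x y = dist_bar y x"
  by (simp add: dist_bar_eq mean_dist_def dist_i_sym[of _ x y])

lemma dist_bar_triangle:
  assumes x: "x \<in> X" "y \<in> X" "z \<in> X"
  shows "dist_bar x z \<le> dist_bar x y + dist_bar y z"
proof (rule dist_bar_le)
  fix n :: nat assume n: "n \<ge> 1"
  have "L2_set (\<lambda>i. dist_i i x z) {1..n} \<le> L2_set (\<lambda>i. dist_i i x y + dist_i i y z) {1..n}"
    using x by (intro L2_set_mono dist_i_triangle dist_i_nonneg) auto
  also have "\<dots> \<le> L2_set (\<lambda>i. dist_i i x y) {1..n} + L2_set (\<lambda>i. dist_i i y z) {1..n}"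
    by (rule L2_set_triangle_ineq)
  finally have "mean_dist n x z \<le> mean_dist n x y + mean_dist n y z"
    unfolding mean_dist_eq_L2 by (simp add: divide_right_mono flip: add_divide_distrib)
  then show "mean_dist n x z \<le> dist_bar x y + dist_bar y z"
    using mean_dist_le_dist_bar[OF n x(1,2)] mean_dist_le_dist_bar[OF n x(2,3)] by linarith
qed

lemma sum_dist_i_le:
  assumes n: "n \<ge> 1" and x: "x \<in> X" "y \<in> X"
  shows "(\<Sum>i=1..n. (dist_i i x y)\<^sup>2) \<le> real n * (dist_bar x y)\<^sup>2"
proof -
  have "(mean_dist n x y)\<^sup>2 \<le> (dist_bar x y)\<^sup>2"
    using mean_dist_le_dist_bar[OF n x] mean_dist_nonneg by (intro power_mono) auto
  moreover have "(mean_dist n x y)\<^sup>2 = (1 / real n) * (\<Sum>i=1..n. (dist_i i x y)\<^sup>2)"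
    unfolding mean_dist_def by (intro real_sqrt_pow2 mult_nonneg_nonneg sum_nonneg) auto
  ultimately show ?thesis using n by (simp add: field_simps)
qed

lemma dist_i_le_dist_bar:
  assumes i: "i \<ge> 1" and x: "x \<in> X" "y \<in> X"
  shows "dist_i i x y \<le> sqrt (real i) * dist_bar x y"
proof -
  have "(dist_i i x y)\<^sup>2 \<le> (\<Sum>j=1..i. (dist_i j x y)\<^sup>2)"
    using i by (intro member_le_sum[of i "{1..i}" "\<lambda>j. (dist_i j x y)\<^sup>2"]) auto
  also have "\<dots> \<le> real i * (dist_bar x y)\<^sup>2" by (rule sum_dist_i_le[OF assms])
  finally have "sqrt ((dist_i i x y)\<^sup>2) \<le> sqrt (real i * (dist_bar x y)\<^sup>2)" by (rule real_sqrt_le_mono)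
  then show ?thesis using dist_i_nonneg[of i x y] dist_bar_nonneg[OF x] by (simp add: real_sqrt_mult)
qed

lemma rosenthal_ge: "2 < p \<Longrightarrow> 1 \<le> p / ln p" for p :: real
  using ln_le_minus_one[of p] by (simp add: le_divide_eq)

lemma entropy_space_dist_bar:
  assumes ne: "X \<noteq> {}" and comp: "compact_space (semidist_topology X dist_bar)"
    and ent: "(\<integral>\<^sup>+\<epsilon>\<in>{0<..semidist_diameter X dist_bar}.
            ennreal (exp (lower_transform B (rosenthal_fun \<psi>)
                            (ln 2 + metric_entropy X dist_bar \<epsilon>))) \<partial>lborel) < \<infinity>"
  shows "entropy_space X dist_bar B (rosenthal_fun \<psi>)"
proof
  show "rosenthal_fun \<psi> p < \<infinity>" if p: "2 < p" "ereal p < B" for p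
    using psi_finite[of p] p by (simp add: rosenthal_fun_def ennreal_mult_less_top)
  obtain c where c: "c > 0" "\<And>p. 2 < p \<Longrightarrow> ereal p < B \<Longrightarrow> ennreal c \<le> \<psi> p" using psi_lower by blast
  have "ennreal c \<le> rosenthal_fun \<psi> p" if p: "2 < p" "ereal p < B" for p
  proof -
    have "1 * ennreal c \<le> ennreal (p / ln p) * \<psi> p"
      using rosenthal_ge[OF p(1)] c(2)[OF p] by (intro mult_mono) auto
    then show ?thesis by (simp add: rosenthal_fun_def)
  qed
  then show "\<exists>c>0. \<forall>p. 2 < p \<longrightarrow> ereal p < B \<longrightarrow> ennreal c \<le> rosenthal_fun \<psi> p" using c(1) by blast
qed (use ne comp ent B2 dist_bar_nonneg dist_bar_refl dist_bar_sym dist_bar_triangle in auto)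

end

section \<open>Weak compactness of the normalized sums\<close>

text \<open>The entropy condition is applied twice, with the same semi-distance: to each \<open>\<xi>\<^sub>i\<close>, whose increments
  satisfy the moment bounds with the constant \<open>\<surd>i\<close>, since the \<open>i\<close>-th distance is at most \<open>\<surd>i\<close> times
  the averaged one, and to all normalized sums with the common constant \<open>3\<close>. Any continuous
  modification inherits the bounds, as it agrees almost surely with the field at each point.\<close>

theorem theorem2p1:
  fixes M :: "'a measure" and F :: "nat \<Rightarrow> 'a measure"
    and X :: "'x set" and \<xi> :: "nat \<Rightarrow> 'x \<Rightarrow> 'a \<Rightarrow> real" and B :: ereal
  assumes "prob_space M"
    and "filtration (space M) F"
    and "\<And>i. subalgebra M (F i)"
    and "sets (F 0) = {{}, space M}"
    and "\<And>i x. i \<ge> 1 \<Longrightarrow> x \<in> X \<Longrightarrow> \<xi> i x \<in> borel_measurable M"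
    and "\<And>i x. i \<ge> 1 \<Longrightarrow> x \<in> X \<Longrightarrow> prob_space.expectation M (\<xi> i x) = 0"
    and "martingale_difference_field M F X \<xi>"
    and "2 < B"
    and "\<And>p. 1 \<le> p \<Longrightarrow> ereal p < B \<Longrightarrow> natural_fun M X \<xi> p < \<infinity>"
    and "0 < (INF p\<in>{p. 2 < p \<and> ereal p < B}. natural_fun M X \<xi> p)"
    and "compact_space (semidist_topology X (d_bar M X B \<xi>))"
    and "(INF x\<in>X. SUP n\<in>{1..}.
            ereal ((1 / real n) * (\<Sum>k=1..n. prob_space.variance M (\<xi> k x)))) < \<infinity>"
    and "(\<integral>\<^sup>+\<epsilon>\<in>{0<..semidist_diameter X (d_bar M X B \<xi>)}.
            ennreal (exp (lower_transform B (rosenthal_fun (natural_fun M X \<xi>))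
                            (ln 2 + metric_entropy X (d_bar M X B \<xi>) \<epsilon>))) \<partial>lborel) < \<infinity>"
  shows "(\<exists>\<zeta>. continuous_modification M (semidist_topology X (d_bar M X B \<xi>)) \<xi> \<zeta>) \<and>
    (\<forall>\<zeta>. continuous_modification M (semidist_topology X (d_bar M X B \<xi>)) \<xi> \<zeta> \<longrightarrow>
       (\<forall>n\<ge>1. sample_path X (normalized_sum \<zeta> n)
                 \<in> measurable M (borel_of (C_space (semidist_topology X (d_bar M X B \<xi>))))) \<and>
       weakly_compact (C_space (semidist_topology X (d_bar M X B \<xi>)))
         ((\<lambda>n. field_distribution M (semidist_topology X (d_bar M X B \<xi>)) (normalized_sum \<zeta> n)) ` {1..}))"
proof -
  let ?T = "semidist_topology X (d_bar M X B \<xi>)"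
  interpret prob_space M by fact
  interpret N: natural_field M X B \<xi>
    by unfold_locales (use assms in auto)
  have "X \<noteq> {}" using assms(12) by (auto simp: top_ereal_def)
  then interpret entropy_space X "d_bar M X B \<xi>" B "rosenthal_fun (natural_fun M X \<xi>)"
    using assms(11,13) by (rule N.entropy_space_dist_bar)
  have R_eq: "R p = p / ln p * N.\<Psi> p" if p: "2 < p" "ereal p < B" for p
  proof -
    have "rosenthal_fun (natural_fun M X \<xi>) p = ennreal (p / ln p * N.\<Psi> p)"
      unfolding rosenthal_fun_def N.psi(1)[OF p]
      using N.rosenthal_ge[OF p(1)] N.psi(2)[OF p] by (intro ennreal_mult[symmetric]) auto
    moreover have "0 \<le> p / ln p * N.\<Psi> p"
      using N.rosenthal_ge[OF p(1)] N.psi(2)[OF p] by (intro mult_nonneg_nonneg) auto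
    ultimately show ?thesis by (simp add: R_def)
  qed
  have mart: "AE \<omega> in M. real_cond_exp M (F k) (\<xi> i x) \<omega> = 0" if "i \<ge> 1" "x \<in> X" "k < i" for i k x
    using assms(7) that by (simp add: martingale_difference_field_def)
  have adapt: "AE \<omega> in M. real_cond_exp M (F i) (\<xi> i x) \<omega> = \<xi> i x \<omega>" if "i \<ge> 1" "x \<in> X" for i x
    using assms(7) that by (simp add: martingale_difference_field_def)
  have sfs: "sigma_finite_subalgebra M (F k)" for k
  proof -
    interpret finite_measure_subalgebra M "F k" by unfold_locales (rule assms(3))
    show ?thesis by unfold_locales
  qed
  have Lp_sum: "Lp_norm M p (normalized_sum \<xi> n x) \<le> ennreal (3 * (p / ln p) * N.\<Psi> p)"
    if n: "n \<ge> 1" and x: "x \<in> X" and p: "2 < p" "ereal p < B" for n x p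
    unfolding normalized_sum_def
  proof (rule Lp_norm_normalized_martingale_sum[OF assms(1-3) p(1)])
    show "Lp_norm M p (\<xi> i x) \<le> ennreal (N.\<Psi> p)" if "i \<ge> 1" for i
      using N.Lp_norm_le_psi[OF that x, of p] N.psi(1)[OF p] by simp
    show "\<xi> i x \<in> borel_measurable M" if "i \<ge> 1" for i using N.meas that x by blast
  qed (use mart adapt x n N.psi(2)[OF p] in auto)
  have Lp_sum_diff: "Lp_norm M p (\<lambda>\<omega>. normalized_sum \<xi> n x \<omega> - normalized_sum \<xi> n y \<omega>)
      \<le> ennreal (3 * R p * d_bar M X B \<xi> x y)"
    if n: "n \<ge> 1" and x: "x \<in> X" "y \<in> X" and p: "2 < p" "ereal p < B" for n x y p
  proof -
    have \<Psi>: "0 < N.\<Psi> p" by (rule N.psi(2)[OF p])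
    let ?Y = "\<lambda>i \<omega>. \<xi> i x \<omega> - \<xi> i y \<omega>"
    have cd: "AE \<omega> in M. real_cond_exp M (F k) (?Y i) \<omega> = real_cond_exp M (F k) (\<xi> i x) \<omega> - real_cond_exp M (F k) (\<xi> i y) \<omega>"
      if "i \<ge> 1" for i k
      using N.integrable_field[OF that] x by (intro sigma_finite_subalgebra.real_cond_exp_diff[OF sfs]) auto
    have "Lp_norm M p (\<lambda>\<omega>. (1 / sqrt (real n)) * (\<Sum>i=1..n. ?Y i \<omega>))
        \<le> ennreal (3 * (p / ln p) * (N.\<Psi> p * d_bar M X B \<xi> x y))"
    proof (rule Lp_norm_normalized_martingale_sum[OF assms(1-3) p(1)])
      show "?Y i \<in> borel_measurable M" if "i \<ge> 1" for i
        using N.meas that x by (intro borel_measurable_diff) auto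
      show "AE \<omega> in M. real_cond_exp M (F k) (?Y i) \<omega> = 0" if "i \<ge> 1" "k < i" for i k
        using cd[OF that(1), of k] mart[OF that(1) x(1) that(2)] mart[OF that(1) x(2) that(2)] by eventually_elim simp
      show "AE \<omega> in M. real_cond_exp M (F i) (?Y i) \<omega> = ?Y i \<omega>" if "i \<ge> 1" for i
        using cd[OF that, of i] adapt[OF that x(1)] adapt[OF that x(2)] by eventually_elim simp
      show "Lp_norm M p (?Y i) \<le> ennreal (d_inc M X B \<xi> i x y * N.\<Psi> p)" if "i \<ge> 1" for i
        by (rule N.Lp_norm_increment[OF that x p])
      show "0 \<le> d_inc M X B \<xi> i x y * N.\<Psi> p" for i using N.dist_i_nonneg \<Psi> by simp
      have "(\<Sum>i=1..n. (d_inc M X B \<xi> i x y * N.\<Psi> p)\<^sup>2) = (\<Sum>i=1..n. (d_inc M X B \<xi> i x y)\<^sup>2) * (N.\<Psi> p)\<^sup>2"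
        by (simp add: power_mult_distrib sum_distrib_right)
      also have "\<dots> \<le> (real n * (d_bar M X B \<xi> x y)\<^sup>2) * (N.\<Psi> p)\<^sup>2"
        by (intro mult_right_mono N.sum_dist_i_le[OF n x]) simp
      finally show "(\<Sum>i=1..n. (d_inc M X B \<xi> i x y * N.\<Psi> p)\<^sup>2) \<le> real n * (N.\<Psi> p * d_bar M X B \<xi> x y)\<^sup>2"
        by (simp add: power_mult_distrib mult_ac)
    qed (use n \<Psi> N.dist_bar_nonneg[OF x] in auto)
    also have "3 * (p / ln p) * (N.\<Psi> p * d_bar M X B \<xi> x y) = 3 * R p * d_bar M X B \<xi> x y"
      by (simp add: R_eq[OF p])
    also have "(\<lambda>\<omega>. (1 / sqrt (real n)) * (\<Sum>i=1..n. ?Y i \<omega>)) = (\<lambda>\<omega>. normalized_sum \<xi> n x \<omega> - normalized_sum \<xi> n y \<omega>)"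
      by (simp add: normalized_sum_def sum_subtractf right_diff_distrib diff_divide_distrib fun_eq_iff)
    finally show ?thesis .
  qed
  show ?thesis
  proof (intro conjI allI impI)
    have "\<exists>\<zeta>. (\<forall>x\<in>X. \<zeta> x \<in> borel_measurable M \<and> (AE \<omega> in M. \<zeta> x \<omega> = \<xi> i x \<omega>)) \<and>
        (\<forall>\<omega>\<in>space M. continuous_map ?T euclideanreal (\<lambda>x. \<zeta> x \<omega>))" if i: "i \<ge> 1" for i
    proof (rule continuous_modification_exists[OF assms(1), where C = "sqrt (real i)"])
      show "Lp_increments M (\<xi> i) (sqrt (real i))"
        unfolding Lp_increments_def
      proof (intro conjI ballI allI impI)
        show "\<xi> i x \<in> borel_measurable M" if "x \<in> X" for x using N.meas i that .
        fix p x y assume p: "2 < p" "ereal p < B" and x: "x \<in> X" "y \<in> X"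
        have "Lp_norm M p (\<lambda>\<omega>. \<xi> i x \<omega> - \<xi> i y \<omega>) \<le> ennreal (d_inc M X B \<xi> i x y * N.\<Psi> p)"
          by (rule N.Lp_norm_increment[OF i x p])
        also have "\<dots> \<le> ennreal (sqrt (real i) * d_bar M X B \<xi> x y * R p)"
        proof (intro ennreal_leI mult_mono N.dist_i_le_dist_bar[OF i x])
          have "1 * N.\<Psi> p \<le> p / ln p * N.\<Psi> p"
            using N.rosenthal_ge[OF p(1)] N.psi(2)[OF p] by (intro mult_right_mono) auto
          then show "N.\<Psi> p \<le> R p" by (simp add: R_eq[OF p])
        qed (use N.psi(2)[OF p] N.dist_bar_nonneg[OF x] in auto)
        finally show "Lp_norm M p (\<lambda>\<omega>. \<xi> i x \<omega> - \<xi> i y \<omega>) \<le> ennreal (sqrt (real i) * R p * d_bar M X B \<xi> x y)"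
          by (simp add: mult_ac)
      qed
    qed simp
    then obtain \<zeta> where "\<And>i. i \<ge> 1 \<Longrightarrow> (\<forall>x\<in>X. \<zeta> i x \<in> borel_measurable M \<and> (AE \<omega> in M. \<zeta> i x \<omega> = \<xi> i x \<omega>)) \<and>
        (\<forall>\<omega>\<in>space M. continuous_map ?T euclideanreal (\<lambda>x. \<zeta> i x \<omega>))" by metis
    then show "\<exists>\<zeta>. continuous_modification M ?T \<xi> \<zeta>"
      by (intro exI[of _ \<zeta>]) (simp add: continuous_modification_def)
  next
    fix \<zeta> assume \<zeta>: "continuous_modification M ?T \<xi> \<zeta>"
    have \<zeta>m: "\<zeta> i x \<in> borel_measurable M" and \<zeta>\<xi>: "AE \<omega> in M. \<zeta> i x \<omega> = \<xi> i x \<omega>" if "i \<ge> 1" "x \<in> X" for i x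
      using \<zeta> that by (auto simp: continuous_modification_def)
    have \<zeta>c: "continuous_map ?T euclideanreal (\<lambda>x. \<zeta> i x \<omega>)" if "i \<ge> 1" "\<omega> \<in> space M" for i \<omega>
      using \<zeta> that by (auto simp: continuous_modification_def)
    have ae: "AE \<omega> in M. normalized_sum \<zeta> n x \<omega> = normalized_sum \<xi> n x \<omega>" if x: "x \<in> X" for n x
    proof -
      have "AE \<omega> in M. \<forall>i\<in>{1..n}. \<zeta> i x \<omega> = \<xi> i x \<omega>"
        by (rule AE_finite_allI) (use \<zeta>\<xi> x in auto)
      then show ?thesis by (rule eventually_mono) (simp add: normalized_sum_def)
    qed
    have nm: "normalized_sum \<zeta> n x \<in> borel_measurable M" if x: "x \<in> X" for n x
      unfolding normalized_sum_def using \<zeta>m x by (intro borel_measurable_times borel_measurable_sum) auto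
    have nc: "continuous_map ?T euclideanreal (\<lambda>x. normalized_sum \<zeta> n x \<omega>)" if "\<omega> \<in> space M" for n \<omega>
      unfolding normalized_sum_def using \<zeta>c that by (intro continuous_map_real_mult_left continuous_map_sum) auto
    show "sample_path X (normalized_sum \<zeta> n) \<in> measurable M (borel_of (C_space ?T))" for n
      using nm nc by (rule measurable_sample_path)
    obtain p where p: "2 < p" "ereal p < B" by (rule exponent)
    show "weakly_compact (C_space ?T) ((\<lambda>n. field_distribution M ?T (normalized_sum \<zeta> n)) ` {1..})"
    proof (rule weakly_compact_distributions[OF assms(1), where C = 3 and b = "3 * (p / ln p) * N.\<Psi> p"])
      fix n :: nat assume n: "n \<ge> 1"
      show "Lp_increments M (normalized_sum \<zeta> n) 3"
        unfolding Lp_increments_def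
      proof (intro conjI ballI allI impI nm)
        fix p x y assume p: "2 < p" "ereal p < B" and x: "x \<in> X" "y \<in> X"
        have "AE \<omega> in M. \<bar>normalized_sum \<zeta> n x \<omega> - normalized_sum \<zeta> n y \<omega>\<bar> = \<bar>normalized_sum \<xi> n x \<omega> - normalized_sum \<xi> n y \<omega>\<bar>"
          using ae[OF x(1), of n] ae[OF x(2), of n] by eventually_elim simp
        then have "Lp_norm M p (\<lambda>\<omega>. normalized_sum \<zeta> n x \<omega> - normalized_sum \<zeta> n y \<omega>)
            = Lp_norm M p (\<lambda>\<omega>. normalized_sum \<xi> n x \<omega> - normalized_sum \<xi> n y \<omega>)"
          using p by (intro Lp_norm_cong_AE) auto
        then show "Lp_norm M p (\<lambda>\<omega>. normalized_sum \<zeta> n x \<omega> - normalized_sum \<zeta> n y \<omega>) \<le> ennreal (3 * R p * d_bar M X B \<xi> x y)"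
          using Lp_sum_diff[OF n x p] by simp
      qed
      fix x assume x: "x \<in> X"
      have "(\<integral>\<^sup>+\<omega>. ennreal \<bar>normalized_sum \<zeta> n x \<omega>\<bar> \<partial>M) \<le> Lp_norm M p (normalized_sum \<zeta> n x)"
        using p nm[OF x] by (intro nn_integral_abs_le_Lp_norm) auto
      also have "\<dots> = Lp_norm M p (normalized_sum \<xi> n x)"
        using p ae[OF x, of n] by (intro Lp_norm_cong_AE) (auto elim!: eventually_mono)
      also have "\<dots> \<le> ennreal (3 * (p / ln p) * N.\<Psi> p)" by (rule Lp_sum[OF n x p])
      finally show "(\<integral>\<^sup>+\<omega>. ennreal \<bar>normalized_sum \<zeta> n x \<omega>\<bar> \<partial>M) \<le> ennreal (3 * (p / ln p) * N.\<Psi> p)" .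
    next
      show "0 \<le> 3 * (p / ln p) * N.\<Psi> p"
        using N.rosenthal_ge[OF p(1)] N.psi(2)[OF p] by (intro mult_nonneg_nonneg) auto
    qed (use nc in auto)
  qed
qed

end
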